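(* For every $\varepsilon>0$ there is a $(2+\varepsilon)$-approximation algorithm for the Matroid Median problem that runs in fixed-parameter time, i.e., in time $f(k,\varepsilon)\,n^{O(1)}$ for some function $f$.
   Context: An instance of Matroid Median consists of a finite metric space $(V,d)$ with $n=|V|$ points, a set of clients $C\subseteq V$, a set of facility locations $\mathbb{F}\subseteq V$, and a matroid on ground set $\mathbb{F}$ of rank $k$. The goal is to choose a set $F\subseteq\mathbb{F}$ of open facilities that is independent in the matroid so as to minimize $\sum_{j\in C} d(j,F)$, where $d(j,F)=\min_{f\in F}d(j,f)$. The parameter is $k$. *)

theory Defs
  imports "HOL-Analysis.Analysis"
begin

locale matroid =
  fixes ground :: "'a set" and indep :: "'a set \<Rightarrow> bool"
  assumes finite_ground: "finite ground"
    and indep_subset_ground: "indep X \<Longrightarrow> X \<subseteq> ground"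
    and indep_empty: "indep {}"
    and indep_hereditary: "indep X \<Longrightarrow> Y \<subseteq> X \<Longrightarrow> indep Y"
    and indep_augment:
      "indep X \<Longrightarrow> indep Y \<Longrightarrow> card X < card Y \<Longrightarrow> \<exists>y\<in>Y - X. indep (insert y X)"

definition matroid_rank :: "('a set \<Rightarrow> bool) \<Rightarrow> nat" where
  "matroid_rank indep = Max (card ` {X. indep X})"


text \<open>
  The points of an instance with \<open>n\<close> points are named \<open>0, \<dots>, n - 1\<close>, since an algorithm has to be
  able to address them. The metric axioms concern these points only, apart
  from the symmetry and nonnegativity that the library asks of a distance function everywhere.
\<close>

record mm_input =
  npoints :: nat
  metric :: "nat \<Rightarrow> nat \<Rightarrow> real"
  clients :: "nat set"
  facilities :: "nat set"
  independent :: "nat set \<Rightarrow> bool"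

definition mm_instance :: "mm_input \<Rightarrow> bool" where
  "mm_instance I \<longleftrightarrow>
     Metric_space {..<npoints I} (metric I) \<and>
     clients I \<subseteq> {..<npoints I} \<and>
     facilities I \<subseteq> {..<npoints I} \<and>
     matroid (facilities I) (independent I)"

definition mm_rank :: "mm_input \<Rightarrow> nat" where
  "mm_rank I = matroid_rank (independent I)"

text \<open>
  The minimum is taken in the extended reals, so that \<open>d(j, {}) = \<infinity>\<close>; for a nonempty finite set of
  facilities it is the ordinary minimum.
\<close>

definition connection_cost :: "mm_input \<Rightarrow> nat \<Rightarrow> nat set \<Rightarrow> ereal" where
  "connection_cost I j F = (INF f\<in>F. ereal (metric I j f))"

definition mm_cost :: "mm_input \<Rightarrow> nat set \<Rightarrow> ereal" where
  "mm_cost I F = (\<Sum>j\<in>clients I. connection_cost I j F)"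

definition mm_opt :: "mm_input \<Rightarrow> ereal" where
  "mm_opt I = (INF F\<in>{F. independent I F}. mm_cost I F)"


text \<open>
  Algorithms are programs of a while language over a random access memory with natural-number cells and
  real cells, grouped into finitely many named arrays (a scalar variable is the cell with index 0).
  The points, the distances, the clients and the facilities can be read off the input; the matroid
  is available only through an independence oracle, which is queried on the set of points that are
  marked by nonzero entries in an array.

  Every assignment, test and oracle query takes one step. This is a fair measure because the
  expressions in a program have fixed size, independent of the input, and because arithmetic is
  restricted to addition, subtraction and comparison, with rational constants only: no
  multiplication or rounding is provided that could be used to pack long computations into single
  operations on huge numbers.
\<close>

type_synonym vname = string

datatype nexp =
    NConst nat
  | NPoints
  | NCell vname nexp
  | NAdd nexp nexp
  | NSub nexp nexp

datatype rexp =
    RConst rat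
  | RDist nexp nexp
  | RCell vname nexp
  | RAdd rexp rexp
  | RSub rexp rexp

datatype bexp =
    NLess nexp nexp
  | RLess rexp rexp
  | IsClient nexp
  | IsFacility nexp
  | IsIndep vname
  | BNot bexp
  | BAnd bexp bexp

datatype com =
    Skip
  | NAssign vname nexp nexp
  | RAssign vname nexp rexp
  | Seq com com
  | Cond bexp com com
  | While bexp com

record state =
  nmem :: "vname \<Rightarrow> nat \<Rightarrow> nat"
  rmem :: "vname \<Rightarrow> nat \<Rightarrow> real"

definition init_state :: state where
  "init_state = \<lparr>nmem = (\<lambda>_ _. 0), rmem = (\<lambda>_ _. 0)\<rparr>"

definition marked :: "mm_input \<Rightarrow> state \<Rightarrow> vname \<Rightarrow> nat set" where
  "marked I s x = {v. v < npoints I \<and> nmem s x v \<noteq> 0}"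

fun nval :: "mm_input \<Rightarrow> state \<Rightarrow> nexp \<Rightarrow> nat" where
  "nval I s (NConst m) = m"
| "nval I s NPoints = npoints I"
| "nval I s (NCell x e) = nmem s x (nval I s e)"
| "nval I s (NAdd e1 e2) = nval I s e1 + nval I s e2"
| "nval I s (NSub e1 e2) = nval I s e1 - nval I s e2"

fun rval :: "mm_input \<Rightarrow> state \<Rightarrow> rexp \<Rightarrow> real" where
  "rval I s (RConst q) = of_rat q"
| "rval I s (RDist e1 e2) = metric I (nval I s e1) (nval I s e2)"
| "rval I s (RCell x e) = rmem s x (nval I s e)"
| "rval I s (RAdd a1 a2) = rval I s a1 + rval I s a2"
| "rval I s (RSub a1 a2) = rval I s a1 - rval I s a2"

fun bval :: "mm_input \<Rightarrow> state \<Rightarrow> bexp \<Rightarrow> bool" where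
  "bval I s (NLess e1 e2) \<longleftrightarrow> nval I s e1 < nval I s e2"
| "bval I s (RLess a1 a2) \<longleftrightarrow> rval I s a1 < rval I s a2"
| "bval I s (IsClient e) \<longleftrightarrow> nval I s e \<in> clients I"
| "bval I s (IsFacility e) \<longleftrightarrow> nval I s e \<in> facilities I"
| "bval I s (IsIndep x) \<longleftrightarrow> independent I (marked I s x)"
| "bval I s (BNot b) \<longleftrightarrow> \<not> bval I s b"
| "bval I s (BAnd b1 b2) \<longleftrightarrow> bval I s b1 \<and> bval I s b2"

definition nupdate :: "vname \<Rightarrow> nat \<Rightarrow> nat \<Rightarrow> state \<Rightarrow> state" where
  "nupdate x i v s = s\<lparr>nmem := (nmem s)(x := (nmem s x)(i := v))\<rparr>"

definition rupdate :: "vname \<Rightarrow> nat \<Rightarrow> real \<Rightarrow> state \<Rightarrow> state" where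
  "rupdate x i v s = s\<lparr>rmem := (rmem s)(x := (rmem s x)(i := v))\<rparr>"

text \<open>\<open>exec I c s t s'\<close>: on input \<open>I\<close>, program \<open>c\<close> started in \<open>s\<close> halts in \<open>s'\<close> after \<open>t\<close> steps.\<close>

inductive exec :: "mm_input \<Rightarrow> com \<Rightarrow> state \<Rightarrow> nat \<Rightarrow> state \<Rightarrow> bool" for I where
  Skip: "exec I Skip s 1 s"
| NAssign: "exec I (NAssign x e1 e2) s 1 (nupdate x (nval I s e1) (nval I s e2) s)"
| RAssign: "exec I (RAssign x e a) s 1 (rupdate x (nval I s e) (rval I s a) s)"
| Seq: "exec I c1 s t1 s' \<Longrightarrow> exec I c2 s' t2 s'' \<Longrightarrow> exec I (Seq c1 c2) s (t1 + t2) s''"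
| CondTrue: "bval I s b \<Longrightarrow> exec I c1 s t s' \<Longrightarrow> exec I (Cond b c1 c2) s (1 + t) s'"
| CondFalse: "\<not> bval I s b \<Longrightarrow> exec I c2 s t s' \<Longrightarrow> exec I (Cond b c1 c2) s (1 + t) s'"
| WhileFalse: "\<not> bval I s b \<Longrightarrow> exec I (While b c) s 1 s"
| WhileTrue: "bval I s b \<Longrightarrow> exec I c s t1 s' \<Longrightarrow> exec I (While b c) s' t2 s''
    \<Longrightarrow> exec I (While b c) s (1 + t1 + t2) s''"

inductive_cases SkipE: "exec I Skip s t s'"
inductive_cases NAssignE: "exec I (NAssign x e1 e2) s t s'"
inductive_cases RAssignE: "exec I (RAssign x e a) s t s'"
inductive_cases SeqE: "exec I (Seq c1 c2) s t s'"
inductive_cases CondE: "exec I (Cond b c1 c2) s t s'"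
inductive_cases WhileE: "exec I (While b c) s t s'"

lemma exec_deterministic:
  "exec I c s t s' \<Longrightarrow> exec I c s u s'' \<Longrightarrow> u = t \<and> s'' = s'"
proof (induction arbitrary: u s'' rule: exec.induct)
  case (Skip s)
  from Skip.prems show ?case by (rule SkipE) simp
next
  case (NAssign x e1 e2 s)
  from NAssign.prems show ?case by (rule NAssignE) simp
next
  case (RAssign x e a s)
  from RAssign.prems show ?case by (rule RAssignE) simp
next
  case (Seq c1 s t1 s1 c2 t2 s2)
  from Seq.prems obtain u1 u2 r where "exec I c1 s u1 r" "exec I c2 r u2 s''" "u = u1 + u2"
    by (rule SeqE)
  moreover from this Seq.IH(1) have "u1 = t1" "r = s1" by simp_all
  ultimately show ?case using Seq.IH(2) by simp
next
  case (CondTrue s b c1 t s1 c2)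
  from CondTrue.prems obtain v where "exec I c1 s v s''" "u = 1 + v"
    by (rule CondE) (use CondTrue.hyps in simp_all)
  then show ?case using CondTrue.IH by simp
next
  case (CondFalse s b c2 t s1 c1)
  from CondFalse.prems obtain v where "exec I c2 s v s''" "u = 1 + v"
    by (rule CondE) (use CondFalse.hyps in simp_all)
  then show ?case using CondFalse.IH by simp
next
  case (WhileFalse s b c)
  from WhileFalse.prems show ?case
    by (rule WhileE) (use WhileFalse.hyps in simp_all)
next
  case (WhileTrue s b c t1 s1 t2 s2)
  from WhileTrue.prems obtain u1 u2 r
    where "exec I c s u1 r" "exec I (While b c) r u2 s''" "u = 1 + u1 + u2"
    by (rule WhileE) (use WhileTrue.hyps in simp_all)
  moreover from this WhileTrue.IH(1) have "u1 = t1" "r = s1" by simp_all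
  ultimately show ?case using WhileTrue.IH(2) by simp
qed

text \<open>The solution computed by a program is the set marked in the array named \<open>out\<close>.\<close>

definition mm_approx_algorithm :: "real \<Rightarrow> com \<Rightarrow> bool" where
  "mm_approx_algorithm \<rho> A \<longleftrightarrow>
     (\<forall>I. mm_instance I \<longrightarrow>
        (\<exists>t s. exec I A init_state t s \<and>
               independent I (marked I s ''out'') \<and>
               mm_cost I (marked I s ''out'') \<le> ereal \<rho> * mm_opt I))"

definition mm_runs_in_time :: "com \<Rightarrow> (mm_input \<Rightarrow> real) \<Rightarrow> bool" where
  "mm_runs_in_time A T \<longleftrightarrow>
     (\<forall>I. mm_instance I \<longrightarrow> (\<exists>t s. exec I A init_state t s \<and> real t \<le> T I))"

end

theory Submission
  imports Defs
begin

text \<open>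
  Fix an optimal solution and let \<open>D\<close> be its largest connection distance, which is guessed. For every
  optimal facility \<open>f\<close> we want a nearby leader: a point \<open>p\<close> whose distance to \<open>f\<close> is, up to a small
  additive error, at most the average connection distance in the cluster of \<open>f\<close>. A list of
  polylogarithmically many points contains a leader for every cluster: weight each client by its
  (truncated) distance to the points listed so far and add a greedy hitting set for the balls around
  all points that carry a noticeable fraction of the weight. If the ball of roughly the average radius
  around \<open>f\<close> is not hit, it is light, so by the Lipschitz property the list is already close to \<open>f\<close>.
  Each round at least halves the weight until it is proportional to the optimum, and logarithmically
  many rounds suffice.

  Guess the leader \<open>p\<^sub>i\<close> and the rounded distance \<open>r\<^sub>i\<close> to it for each optimal facility \<open>f\<^sub>i\<close>. Any choice of
  one facility \<open>g\<^sub>i\<close> in each ball around \<open>p\<^sub>i\<close> of radius \<open>r\<^sub>i\<close> connects a client \<open>j\<close> at cost at most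
  \<open>u j = min\<^sub>i (d j p\<^sub>i + r\<^sub>i)\<close>, and \<open>u\<close> sums to about three times the optimum. Choose the \<open>g\<^sub>i\<close> one after
  the other; the \<open>i\<close>-th step minimizes the cost truncated by \<open>u\<close>. To keep
  \<open>g\<^sub>1, \<dots>, g\<^sub>i, f\<^bsub>i+1\<^esub>, \<dots>, f\<^sub>k\<close> independent, try all members of a basis of the \<open>i\<close>-th ball that is
  greedy for this cost: one of them is independent of the rest and at least as good as \<open>f\<^sub>i\<close>. The steps
  then close half of the gap between \<open>u\<close> and the optimum, which leaves a factor of about \<open>(3 + 1) / 2\<close>.
  There are polylogarithmically many options per facility, and \<open>(log n)^k\<close> is at most \<open>n\<close> times a
  function of \<open>k\<close>.
\<close>

section \<open>Programs with bounded loops\<close>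

text \<open>Only polylogarithmically many options per facility are affordable, so leaders and radii
  cannot range over all points and distances; both are digits below \<open>Y = (Q * lg)^2\<close>,
  and so is the position in the greedy basis. The factor three arises as follows: a facility in the
  ball of radius about \<open>d p f\<close> around \<open>p\<close> serves a client \<open>j\<close>
  of \<open>f\<close> at cost about \<open>d j f + 2 * d p f\<close>, and over all clients the
  \<open>d p f\<close> sum to about the optimum. Selecting the facilities is greedy maximization of
  a monotone submodular saving under two constraints, one facility per ball and independence;
  guessing a position in a greedy basis lets matroid exchange take care of independence, so that
  only the factor one half of the greedy method is lost. The machine neither multiplies nor divides.
  Small errors are therefore obtained by enlarging the metric by \<open>n * m\<close> instead of
  shrinking the unit: an error of one \<open>D\<close> per client totals at most \<open>n\<close>
  times the optimum, which is the fraction \<open>1 / m\<close> of the scaled optimum.\<close>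

datatype prog =
    PSkip
  | PN vname nexp nexp
  | PR vname nexp rexp
  | PSeq prog prog (infixr \<open>;;\<close> 60)
  | PIf bexp prog prog
  | PFor vname nexp prog

text \<open>With bounded loops only, the final state is a function of the initial one. The number of
  iterations is fixed on entry to a loop, whereas the compiled \<open>While\<close> evaluates its
  bound before every iteration; \<open>limits_in\<close> and the separation of limits from written
  variables make the two agree.\<close>

primrec ev :: "mm_input \<Rightarrow> prog \<Rightarrow> state \<Rightarrow> state" where
  "ev I PSkip s = s"
| "ev I (PN x e1 e2) s = nupdate x (nval I s e1) (nval I s e2) s"
| "ev I (PR x e a) s = rupdate x (nval I s e) (rval I s a) s"
| "ev I (PSeq p q) s = ev I q (ev I p s)"
| "ev I (PIf b p q) s = (if bval I s b then ev I p s else ev I q s)"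
| "ev I (PFor x e p) s =
     ((\<lambda>s. nupdate x 0 (Suc (nmem s x 0)) (ev I p s)) ^^ nval I s e) (nupdate x 0 0 s)"

primrec compile :: "prog \<Rightarrow> com" where
  "compile PSkip = Skip"
| "compile (PN x e1 e2) = NAssign x e1 e2"
| "compile (PR x e a) = RAssign x e a"
| "compile (PSeq p q) = Seq (compile p) (compile q)"
| "compile (PIf b p q) = Cond b (compile p) (compile q)"
| "compile (PFor x e p) =
     Seq (NAssign x (NConst 0) (NConst 0))
       (While (NLess (NCell x (NConst 0)) e)
         (Seq (compile p) (NAssign x (NConst 0) (NAdd (NCell x (NConst 0)) (NConst 1)))))"

text \<open>The write sets \<open>nw\<close> and \<open>rw\<close> serve as frame conditions:
  whatever lies outside them need not occur in a loop invariant.\<close>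

primrec nw :: "prog \<Rightarrow> vname set" where
  "nw PSkip = {}"
| "nw (PN x e1 e2) = {x}"
| "nw (PR x e a) = {}"
| "nw (PSeq p q) = nw p \<union> nw q"
| "nw (PIf b p q) = nw p \<union> nw q"
| "nw (PFor x e p) = insert x (nw p)"

primrec rw :: "prog \<Rightarrow> vname set" where
  "rw PSkip = {}"
| "rw (PN x e1 e2) = {}"
| "rw (PR x e a) = {x}"
| "rw (PSeq p q) = rw p \<union> rw q"
| "rw (PIf b p q) = rw p \<union> rw q"
| "rw (PFor x e p) = rw p"

lemma nmem_nupdate [simp]:
  "nmem (nupdate x i v s) = (nmem s)(x := (nmem s x)(i := v))"
  by (simp add: nupdate_def)

lemma rmem_nupdate [simp]: "rmem (nupdate x i v s) = rmem s"
  by (simp add: nupdate_def)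

lemma rmem_rupdate [simp]:
  "rmem (rupdate x i v s) = (rmem s)(x := (rmem s x)(i := v))"
  by (simp add: rupdate_def)

lemma nmem_rupdate [simp]: "nmem (rupdate x i v s) = nmem s"
  by (simp add: rupdate_def)

lemma funpow_inv:
  "P 0 s \<Longrightarrow> (\<And>i t. i < N \<Longrightarrow> P i t \<Longrightarrow> P (Suc i) (f t)) \<Longrightarrow> P N ((f ^^ N) s)"
  by (induction N) auto

lemma nmem_ev: "x \<notin> nw p \<Longrightarrow> nmem (ev I p s) x = nmem s x"
proof (induction p arbitrary: s)
  case (PFor y e p)
  show ?case unfolding ev.simps
    by (rule funpow_inv[where P = "\<lambda>_ t. nmem t x = nmem s x"]) (use PFor in auto)
qed auto

lemma rmem_ev: "x \<notin> rw p \<Longrightarrow> rmem (ev I p s) x = rmem s x"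
proof (induction p arbitrary: s)
  case (PFor y e p)
  show ?case unfolding ev.simps
    by (rule funpow_inv[where P = "\<lambda>_ t. rmem t x = rmem s x"]) (use PFor in auto)
qed auto

text \<open>A Hoare rule for counted loops. Besides the invariant, the step may use that the counter
  holds \<open>i\<close> and that everything outside the write sets is as on entry.\<close>

lemma ev_For_inv:
  assumes "x \<notin> nw p"
    and "P 0 (nupdate x 0 0 s)"
    and "\<And>i t. \<lbrakk>i < nval I s e; P i t; nmem t x 0 = i;
           \<And>y. y \<noteq> x \<Longrightarrow> y \<notin> nw p \<Longrightarrow> nmem t y = nmem s y;
           \<And>y. y \<notin> rw p \<Longrightarrow> rmem t y = rmem s y\<rbrakk>
         \<Longrightarrow> P (Suc i) (nupdate x 0 (Suc i) (ev I p t))"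
  shows "P (nval I s e) (ev I (PFor x e p) s)"
proof -
  let ?R = "\<lambda>i (t::state). P i t \<and> nmem t x 0 = i \<and>
    (\<forall>y. y \<noteq> x \<longrightarrow> y \<notin> nw p \<longrightarrow> nmem t y = nmem s y) \<and> (\<forall>y. y \<notin> rw p \<longrightarrow> rmem t y = rmem s y)"
  have "?R (nval I s e) (ev I (PFor x e p) s)"
    unfolding ev.simps
  proof (rule funpow_inv[where P = ?R])
    show "?R 0 (nupdate x 0 0 s)" using assms(2) by simp
  next
    fix i t assume "i < nval I s e" and R: "?R i t"
    then have "P (Suc i) (nupdate x 0 (Suc i) (ev I p t))"
      by (intro assms(3)) auto
    then show "?R (Suc i) (nupdate x 0 (Suc (nmem t x 0)) (ev I p t))"
      using R assms(1) by (auto simp: nmem_ev rmem_ev)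
  qed
  then show ?thesis by blast
qed

primrec limits_in :: "vname set \<Rightarrow> prog \<Rightarrow> bool" where
  "limits_in L PSkip = True"
| "limits_in L (PN x e1 e2) = True"
| "limits_in L (PR x e a) = True"
| "limits_in L (PSeq p q) = (limits_in L p \<and> limits_in L q)"
| "limits_in L (PIf b p q) = (limits_in L p \<and> limits_in L q)"
| "limits_in L (PFor x e p) =
     (limits_in L p \<and> x \<notin> nw p \<and> (e = NPoints \<or> (\<exists>l\<in>L. e = NCell l (NConst 0))))"

text \<open>The 4 of a loop pays for the initial assignment, the final test, and one test and one
  increment in each iteration.\<close>

primrec sz :: "prog \<Rightarrow> nat" where
  "sz PSkip = 1"
| "sz (PN x e1 e2) = 1"
| "sz (PR x e a) = 1"
| "sz (PSeq p q) = sz p + sz q"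
| "sz (PIf b p q) = 1 + sz p + sz q"
| "sz (PFor x e p) = 4 + sz p"

primrec depth :: "prog \<Rightarrow> nat" where
  "depth PSkip = 0"
| "depth (PN x e1 e2) = 0"
| "depth (PR x e a) = 0"
| "depth (PSeq p q) = max (depth p) (depth q)"
| "depth (PIf b p q) = max (depth p) (depth q)"
| "depth (PFor x e p) = Suc (depth p)"

text \<open>\<open>P i\<close> ties the state to the number of completed iterations, so that the
  test of the loop decides \<open>i < N\<close>; the induction is on the iterations that
  remain.\<close>

lemma exec_While_funpow:
  assumes step: "\<And>i t. \<lbrakk>i < N; P i t\<rbrakk> \<Longrightarrow> \<exists>u\<le>B. exec I c t u (f t) \<and> P (Suc i) (f t)"
    and b: "\<And>i t. \<lbrakk>i \<le> N; P i t\<rbrakk> \<Longrightarrow> bval I t b \<longleftrightarrow> i < N"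
    and "P i s" "i \<le> N"
  shows "\<exists>u\<le>(N - i) * (B + 1) + 1. exec I (While b c) s u ((f ^^ (N - i)) s)"
  using assms(3,4)
proof (induction "N - i" arbitrary: i s)
  case 0
  then have "\<not> bval I s b" using b[OF 0(3,2)] by simp
  with 0 show ?case by (auto intro!: exI[of _ 1] exec.WhileFalse)
next
  case (Suc r)
  then have i: "i < N" "N - i = Suc (N - Suc i)" by auto
  obtain u where u: "u \<le> B" "exec I c s u (f s)" "P (Suc i) (f s)"
    using step[OF i(1) Suc.prems(1)] by blast
  obtain v where v: "v \<le> (N - Suc i) * (B + 1) + 1"
      "exec I (While b c) (f s) v ((f ^^ (N - Suc i)) (f s))"
    using Suc.hyps(1)[of "Suc i" "f s"] Suc.hyps(2) u(3) i by auto
  have "bval I s b" using b[OF Suc.prems(2,1)] i by simp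
  then have "exec I (While b c) s (1 + u + v) ((f ^^ (N - i)) s)"
    using exec.WhileTrue[OF _ u(2) v(2)] i(2) by (simp add: funpow_swap1)
  moreover have "1 + u + v \<le> (N - i) * (B + 1) + 1"
    using u(1) v(1) i(2) by (simp add: algebra_simps)
  ultimately show ?case by blast
qed

text \<open>Each loop makes at most \<open>X\<close> iterations, which gives one factor
  \<open>X\<close> per nesting level. The limits in \<open>L\<close> are never written, so they stay
  below \<open>X\<close> and the test of a loop keeps comparing with the bound found on
  entry.\<close>

lemma exec_compile:
  assumes "1 \<le> X" "npoints I \<le> X" "limits_in L p" "L \<inter> nw p = {}" "\<forall>l\<in>L. nmem s l 0 \<le> X"
  shows "\<exists>t\<le>sz p * X ^ depth p. exec I (compile p) s t (ev I p s)"
  using assms(3-5)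
proof (induction p arbitrary: s)
  case PSkip
  then show ?case by (auto intro!: exI[of _ 1] exec.Skip)
next
  case (PN x e1 e2)
  then show ?case by (auto intro!: exI[of _ 1] exec.NAssign)
next
  case (PR x e a)
  then show ?case by (auto intro!: exI[of _ 1] exec.RAssign)
next
  case (PSeq p q)
  have mono: "r * X ^ a \<le> r * X ^ max a b" "r * X ^ b \<le> r * X ^ max a b" for r a b
    using assms(1) by (auto intro: power_increasing)
  obtain t where t: "t \<le> sz p * X ^ depth p" "exec I (compile p) s t (ev I p s)"
    using PSeq.IH(1)[of s] PSeq.prems by auto
  have "\<forall>l\<in>L. nmem (ev I p s) l 0 \<le> X"
  proof
    fix l assume "l \<in> L"
    moreover from this have "l \<notin> nw p" using PSeq.prems by auto
    ultimately show "nmem (ev I p s) l 0 \<le> X" using PSeq.prems by (simp add: nmem_ev)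
  qed
  then obtain u where u: "u \<le> sz q * X ^ depth q" "exec I (compile q) (ev I p s) u (ev I q (ev I p s))"
    using PSeq.IH(2)[of "ev I p s"] PSeq.prems by auto
  have "t + u \<le> sz (p;; q) * X ^ depth (p;; q)"
    using order_trans[OF t(1) mono(1)] order_trans[OF u(1) mono(2)]
    by (simp only: sz.simps depth.simps add_mult_distrib) (rule add_mono)
  then show ?case using exec.Seq[OF t(2) u(2)] by auto
next
  case (PIf b p q)
  have mono: "r * X ^ a \<le> r * X ^ max a b" "r * X ^ b \<le> r * X ^ max a b" for r a b
    using assms(1) by (auto intro: power_increasing)
  have one: "1 \<le> X ^ a" for a using assms(1) by simp
  let ?m = "max (depth p) (depth q)"
  have exp: "sz (PIf b p q) * X ^ depth (PIf b p q) = X ^ ?m + sz p * X ^ ?m + sz q * X ^ ?m"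
    by (simp add: algebra_simps)
  show ?case
  proof (cases "bval I s b")
    case True
    obtain t where t: "t \<le> sz p * X ^ depth p" "exec I (compile p) s t (ev I p s)"
      using PIf.IH(1)[of s] PIf.prems by auto
    have "1 + t \<le> sz (PIf b p q) * X ^ depth (PIf b p q)"
      unfolding exp using t(1) mono(1)[of "sz p" "depth p" "depth q"] one[of ?m] by linarith
    then show ?thesis using exec.CondTrue[OF True t(2)] True by auto
  next
    case False
    obtain t where t: "t \<le> sz q * X ^ depth q" "exec I (compile q) s t (ev I q s)"
      using PIf.IH(2)[of s] PIf.prems by auto
    have "1 + t \<le> sz (PIf b p q) * X ^ depth (PIf b p q)"
      unfolding exp using t(1) mono(2)[of "sz q" "depth q" "depth p"] one[of ?m] by linarith
    then show ?thesis using exec.CondFalse[OF False t(2)] False by auto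
  qed
next
  case (PFor x e p)
  let ?f = "\<lambda>s. nupdate x 0 (Suc (nmem s x 0)) (ev I p s)"
  let ?N = "nval I s e" and ?B = "sz p * X ^ depth p + 1"
  let ?P = "\<lambda>i (t::state). nmem t x 0 = i \<and> (\<forall>l\<in>L. nmem t l 0 = nmem s l 0)"
  let ?c = "Seq (compile p) (NAssign x (NConst 0) (NAdd (NCell x (NConst 0)) (NConst 1)))"
  have xL: "x \<notin> L" "x \<notin> nw p" using PFor.prems by auto
  have N: "?N \<le> X" using PFor.prems assms(2) by auto
  have eN: "nval I t e = ?N" if "?P i t" for i t using PFor.prems that by auto
  have "\<exists>u\<le>(?N - 0) * (?B + 1) + 1. exec I (While (NLess (NCell x (NConst 0)) e) ?c) (nupdate x 0 0 s) u
          ((?f ^^ (?N - 0)) (nupdate x 0 0 s))"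
  proof (rule exec_While_funpow[where P = ?P])
    show "?P 0 (nupdate x 0 0 s)" using xL by auto
  next
    fix i t assume "i < ?N" and P: "?P i t"
    then obtain u where u: "u \<le> sz p * X ^ depth p" "exec I (compile p) t u (ev I p t)"
      using PFor.IH[of t] PFor.prems by auto
    have ex: "exec I ?c t (u + 1) (?f t)"
      using exec.Seq[OF u(2) exec.NAssign[of I x "NConst 0" "NAdd (NCell x (NConst 0)) (NConst 1)"]] xL
      by (simp add: nmem_ev)
    have "?P (Suc i) (?f t)"
    proof (intro conjI ballI)
      fix l assume "l \<in> L"
      moreover from this have "l \<noteq> x" "l \<notin> nw p" using PFor.prems by auto
      ultimately show "nmem (?f t) l 0 = nmem s l 0"
        using P by (simp add: nmem_ev)
    qed (use P in simp)
    then show "\<exists>u\<le>?B. exec I ?c t u (?f t) \<and> ?P (Suc i) (?f t)"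
      by (intro exI[where x = "u + 1"] conjI[OF add_right_mono[OF u(1)]] conjI[OF ex])
  next
    fix i t assume P: "?P i t"
    then show "bval I t (NLess (NCell x (NConst 0)) e) \<longleftrightarrow> i < ?N"
      unfolding bval.simps eN[OF P] by simp
  qed (rule le0)
  then obtain u where u: "u \<le> ?N * (?B + 1) + 1"
    "exec I (While (NLess (NCell x (NConst 0)) e) ?c) (nupdate x 0 0 s) u (ev I (PFor x e p) s)"
    unfolding ev.simps diff_zero by (elim exE conjE)
  have "exec I (compile (PFor x e p)) s (1 + u) (ev I (PFor x e p) s)"
    using exec.Seq[OF exec.NAssign[of I x "NConst 0" "NConst 0" s]] u(2)
    by (simp only: compile.simps nval.simps)
  moreover have "1 + u \<le> sz (PFor x e p) * X ^ depth (PFor x e p)"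
  proof -
    have "1 + u \<le> X * (?B + 1) + 2" using u(1) N mult_le_mono1[OF N, of "?B + 1"] by linarith
    also have "\<dots> = sz p * (X * X ^ depth p) + 2 * X + 2" by (simp add: algebra_simps)
    also have "\<dots> \<le> sz p * (X * X ^ depth p) + 2 * (X * X ^ depth p) + 2 * (X * X ^ depth p)"
    proof -
      have "1 \<le> X ^ depth p" using assms(1) by simp
      then have "X \<le> X * X ^ depth p" "1 \<le> X * X ^ depth p" using assms(1) by auto
      then show ?thesis by linarith
    qed
    finally show ?thesis by (simp add: algebra_simps)
  qed
  ultimately show ?case by (intro exI[where x = "1 + u"] conjI)
qed

section \<open>Matroids, hitting sets and clusters\<close>

context matroid
begin

lemma indep_finite: "indep X \<Longrightarrow> finite X"
  by (rule finite_subset[OF indep_subset_ground finite_ground])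

lemma finite_indep_sets: "finite {X. indep X}"
proof (rule finite_subset)
  show "{X. indep X} \<subseteq> Pow ground" using indep_subset_ground by blast
  show "finite (Pow ground)" using finite_ground by simp
qed

lemma card_le_rank: "indep X \<Longrightarrow> card X \<le> matroid_rank indep"
  unfolding matroid_rank_def by (rule Max_ge) (simp_all add: finite_indep_sets)

text \<open>By augmentation an inclusion-maximal independent set is a largest one. This justifies
  computing the rank greedily.\<close>

lemma rank_eq_card_maximal:
  assumes "indep A" and "\<And>v. v \<notin> A \<Longrightarrow> \<not> indep (insert v A)"
  shows "matroid_rank indep = card A"
  unfolding matroid_rank_def
proof (rule Max_eqI)
  show "finite (card ` {X. indep X})" using finite_indep_sets by simp
  show "card A \<in> card ` {X. indep X}" using assms by auto
next
  fix y assume "y \<in> card ` {X. indep X}"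
  then obtain X where "indep X" "y = card X" by auto
  moreover have "card X \<le> card A"
  proof (rule ccontr)
    assume "\<not> card X \<le> card A"
    then obtain v where "v \<in> X - A" "indep (insert v A)"
      using indep_augment[OF assms(1) \<open>indep X\<close>] by auto
    then show False using assms(2) by blast
  qed
  ultimately show "y \<le> card A" by simp
qed

lemma indep_extend:
  assumes "indep A" "indep Y" "card A \<le> card Y"
  shows "\<exists>A'. A \<subseteq> A' \<and> A' \<subseteq> A \<union> Y \<and> indep A' \<and> card A' = card Y"
  using assms
proof (induction "card Y - card A" arbitrary: A)
  case 0
  then show ?case by (intro exI[of _ A]) simp
next
  case (Suc r)
  obtain y where y: "y \<in> Y - A" "indep (insert y A)"
  proof -
    have "card A < card Y" using Suc.hyps(2) by linarith
    then show ?thesis using indep_augment[OF Suc.prems(1,2)] that by blast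
  qed
  have "card (insert y A) = Suc (card A)" using y indep_finite[OF Suc.prems(1)] by simp
  then have "r = card Y - card (insert y A)" "card (insert y A) \<le> card Y"
    using Suc.hyps(2) by linarith+
  then obtain A' where A': "insert y A \<subseteq> A'" "A' \<subseteq> insert y A \<union> Y" "indep A'" "card A' = card Y"
    using Suc.hyps(1)[OF _ y(2) Suc.prems(2)] by blast
  show ?case by (intro exI[of _ A'] conjI) (use A' y in \<open>simp_all, blast\<close>)
qed

text \<open>If no element of \<open>A\<close> could be added to \<open>Y\<close>, then
  \<open>Y\<close> would be a largest independent subset of \<open>A \<union> Y\<close>. Extend
  \<open>A\<close> within this union to the size of \<open>Y\<close> and augment the result from
  \<open>insert x Y\<close>: the new element cannot be \<open>x\<close>, which \<open>A\<close>
  spans, nor an element of \<open>Y\<close>, as the set would become too large.\<close>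

lemma span_exchange:
  assumes A: "indep A" and Y: "indep (insert x Y)" "x \<notin> Y"
    and span: "x \<in> A \<or> \<not> indep (insert x A)"
  shows "\<exists>a\<in>A - Y. indep (insert a Y)"
proof (rule ccontr)
  assume no: "\<not> ?thesis"
  have iY: "indep Y" by (rule indep_hereditary[OF Y(1)]) blast
  have max: "card B \<le> card Y" if "indep B" "B \<subseteq> A \<union> Y" for B
  proof (rule ccontr)
    assume "\<not> card B \<le> card Y"
    then obtain b where "b \<in> B - Y" "indep (insert b Y)"
      using indep_augment[OF iY \<open>indep B\<close>] by auto
    then show False using no that(2) by blast
  qed
  have "x \<notin> A" using no Y by auto
  obtain A' where A': "A \<subseteq> A'" "A' \<subseteq> A \<union> Y" "indep A'" "card A' = card Y"
    using indep_extend[OF A iY max[OF A]] by auto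
  have "card A' < card (insert x Y)" using A' Y indep_finite[OF iY] by simp
  then obtain y where y: "y \<in> insert x Y - A'" "indep (insert y A')"
    using indep_augment[OF A'(3) Y(1)] by auto
  show False
  proof (cases "y = x")
    case True
    then have "insert x A \<subseteq> insert y A'" using A'(1) by blast
    then have "indep (insert x A)" by (rule indep_hereditary[OF y(2)])
    then show False using span \<open>x \<notin> A\<close> by simp
  next
    case False
    then have "insert y A' \<subseteq> A \<union> Y" using y A' by auto
    then have "card (insert y A') \<le> card Y" using max y by blast
    then show False using y A' indep_finite[OF A'(3)] by simp
  qed
qed

end

section \<open>Hitting sets for heavy balls\<close>

text \<open>
  Equivalently, \<open>p\<close> lies in the smallest ball around \<open>f\<close> whose clients carry at least the fraction
  \<open>1 / Q\<close> of the total weight.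
\<close>

definition hit :: "('a \<Rightarrow> 'a \<Rightarrow> real) \<Rightarrow> 'a set \<Rightarrow> ('a \<Rightarrow> real) \<Rightarrow> nat \<Rightarrow> 'a \<Rightarrow> 'a \<Rightarrow> bool" where
  "hit d C w Q f p \<longleftrightarrow> real Q * sum w {j\<in>C. d j f < d p f} < sum w C"

text \<open>Consider the nearest client \<open>p\<close> that does not hit \<open>f\<close>. All
  clients strictly nearer do hit \<open>f\<close>, and because \<open>p\<close> does not, they carry
  at least the fraction \<open>1 / Q\<close> of the weight.\<close>

lemma weight_of_hits:
  assumes "finite C" and w: "\<And>j. j \<in> C \<Longrightarrow> 0 \<le> w j" and "1 \<le> Q"
  shows "sum w C \<le> real Q * sum w {p\<in>C. hit d C w Q f p}"
proof (cases "\<exists>p\<in>C. \<not> hit d C w Q f p")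
  case False
  then have "{p\<in>C. hit d C w Q f p} = C" by auto
  moreover have "1 * sum w C \<le> real Q * sum w C"
    using assms by (intro mult_right_mono sum_nonneg) auto
  ultimately show ?thesis by simp
next
  case True
  let ?N = "{p\<in>C. \<not> hit d C w Q f p}"
  have "finite ?N" "?N \<noteq> {}" using assms True by auto
  then obtain p where p: "p \<in> ?N" "\<And>q. q \<in> ?N \<Longrightarrow> d p f \<le> d q f"
    using ex_is_arg_min_if_finite[of ?N "\<lambda>q. d q f"] unfolding is_arg_min_linorder by auto
  have "sum w C \<le> real Q * sum w {j\<in>C. d j f < d p f}"
    using p(1) by (auto simp: hit_def)
  also have "\<dots> \<le> real Q * sum w {p\<in>C. hit d C w Q f p}"
  proof (intro mult_left_mono sum_mono2)
    show "{j\<in>C. d j f < d p f} \<subseteq> {p\<in>C. hit d C w Q f p}"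
    proof (intro subsetI, rule ccontr)
      fix q assume q: "q \<in> {j\<in>C. d j f < d p f}" "q \<notin> {p\<in>C. hit d C w Q f p}"
      then have "d p f \<le> d q f" by (intro p(2)) auto
      then show False using q(1) by simp
    qed
  qed (use assms in auto)
  finally show ?thesis .
qed

text \<open>Double counting of the weighted pairs of an \<open>f\<close> and a client hitting it:
  every \<open>f\<close> is hit by the fraction \<open>1 / Q\<close> of the weight, so an average
  client hits the fraction \<open>1 / Q\<close> of \<open>U\<close>. This drives the greedy hitting
  set.\<close>

lemma frequent_hit:
  assumes "finite C" and w: "\<And>j. j \<in> C \<Longrightarrow> 0 \<le> w j" and "1 \<le> Q" and "0 < sum w C"
    and "finite U"
  shows "\<exists>p\<in>C. card U \<le> Q * card {f\<in>U. hit d C w Q f p}"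
proof (rule ccontr)
  assume no: "\<not> ?thesis"
  let ?c = "\<lambda>p. card {f\<in>U. hit d C w Q f p}"
  have lt: "Q * ?c p < card U" if "p \<in> C" for p using no that by (simp add: not_le)
  have "real (card U) * sum w C = (\<Sum>f\<in>U. sum w C)" by simp
  also have "\<dots> \<le> (\<Sum>f\<in>U. real Q * sum w {p\<in>C. hit d C w Q f p})"
    by (intro sum_mono weight_of_hits assms)
  also have "\<dots> = (\<Sum>f\<in>U. \<Sum>p\<in>C. if hit d C w Q f p then real Q * w p else 0)"
    by (intro sum.cong refl) (simp add: sum_distrib_left sum.inter_filter[OF assms(1)] if_distrib[of "\<lambda>x. real Q * x"] cong: if_cong)
  also have "\<dots> = (\<Sum>p\<in>C. \<Sum>f\<in>U. if hit d C w Q f p then real Q * w p else 0)"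
    by (rule sum.swap)
  also have "\<dots> = (\<Sum>p\<in>C. w p * real (Q * ?c p))"
    by (intro sum.cong refl)
      (simp add: sum.inter_filter[OF assms(5), symmetric] mult_ac)
  also have "\<dots> < (\<Sum>p\<in>C. w p * real (card U))"
  proof (rule sum_strict_mono_ex1)
    show "\<forall>p\<in>C. w p * real (Q * ?c p) \<le> w p * real (card U)"
      using lt w by (intro ballI mult_left_mono) (simp_all only: of_nat_le_iff less_imp_le)
    have "\<exists>p\<in>C. 0 < w p"
    proof (rule ccontr)
      assume "\<not> ?thesis"
      then have "sum w C \<le> 0" by (intro sum_nonpos) auto
      then show False using assms by simp
    qed
    then obtain p where "p \<in> C" "0 < w p" by auto
    moreover from this have "real (Q * ?c p) < real (card U)" using lt by (simp only: of_nat_less_iff)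
    ultimately show "\<exists>p\<in>C. w p * real (Q * ?c p) < w p * real (card U)"
      by (intro bexI[of _ p] mult_strict_left_mono)
  qed (use assms in auto)
  also have "\<dots> = real (card U) * sum w C" by (simp add: sum_distrib_right mult.commute)
  finally show False by simp
qed

lemma shrinking_step:
  assumes "2 \<le> Q" "u \<le> Q * v" "real u \<le> B"
  shows "real (u - v) \<le> B * (1 - 1 / real Q)"
proof (cases "v \<le> u")
  case True
  have "real u \<le> real Q * real v" using assms(2) by (metis of_nat_le_iff of_nat_mult)
  then have "real (u - v) \<le> real u * (1 - 1 / real Q)"
    using True assms(1) by (simp add: of_nat_diff field_simps)
  also have "\<dots> \<le> B * (1 - 1 / real Q)" using assms by (intro mult_right_mono) auto
  finally show ?thesis .
next
  case False
  have "0 \<le> B * (1 - 1 / real Q)" using assms by (intro mult_nonneg_nonneg) auto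
  then show ?thesis using False by simp
qed

text \<open>Every \<open>Q\<close> picks at least halve the number of points not yet hit, since
  \<open>(1 - 1 / Q) ^ Q\<close> is at most \<open>exp (- 1)\<close>. After \<open>lg\<close>
  halvings fewer than one of the \<open>2 ^ (lg - 1)\<close> points is left, that is, none.\<close>

lemma shrinking_vanishes:
  assumes "2 \<le> Q" "1 \<le> lg" "N \<le> 2 ^ (lg - 1)"
  shows "real N * (1 - 1 / real Q) ^ (Q * lg) < 1"
proof -
  have Q0: "0 < real Q" using assms by simp
  have "(1 - 1 / real Q) ^ Q \<le> exp (- 1 / real Q) ^ Q"
    using exp_ge_add_one_self[of "- 1 / real Q"] assms(1) by (intro power_mono) auto
  also have "\<dots> = exp (- 1)" using Q0 by (simp flip: exp_of_nat_mult)
  also have "\<dots> \<le> 1 / 2"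
    using exp_ge_add_one_self[of "1::real"] by (simp add: exp_minus field_simps)
  finally have half: "(1 - 1 / real Q) ^ Q \<le> 1 / 2" .
  have "real N * (1 - 1 / real Q) ^ (Q * lg) = real N * ((1 - 1 / real Q) ^ Q) ^ lg"
    by (simp add: power_mult)
  also have "\<dots> \<le> 2 ^ (lg - 1) * (1 / 2) ^ lg"
  proof (intro mult_mono power_mono half)
    show "real N \<le> 2 ^ (lg - 1)" using assms(3) by (metis of_nat_le_iff of_nat_numeral of_nat_power)
  qed (use assms(1) in auto)
  also have "\<dots> = 1 / 2" using assms(2) by (cases lg) (simp_all add: power_one_over field_simps)
  finally show ?thesis by simp
qed

section \<open>Distance of a cluster to the list\<close>

text \<open>Markov's inequality: if \<open>s - c\<close> of \<open>s\<close> clients are farther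
  away than \<open>1 + 1 / m\<close> times the average, then the other \<open>c\<close> make up at
  least the fraction \<open>1 / (m + 1)\<close>.\<close>

lemma markov_arith:
  fixes m s c :: real
  assumes "0 < m" "(s - c) * (1 + 1 / m) \<le> s"
  shows "s \<le> (m + 1) * c"
proof -
  have "(s - c) * (1 + 1 / m) * m \<le> s * m" using assms by (intro mult_right_mono) auto
  moreover have "(1 + 1 / m) * m = m + 1" using assms by (simp add: distrib_right)
  ultimately have "(s - c) * (m + 1) \<le> s * m" by (simp only: mult.assoc)
  then show ?thesis by (simp add: algebra_simps)
qed

text \<open>Think of \<open>w\<close> as the truncated distance to the list before a round and of
  \<open>w'\<close> as the distance of \<open>f\<close> after it. Let \<open>R\<close> be
  \<open>1 + 1 / m\<close> times the average distance in the cluster \<open>B\<close>. If a hitting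
  point lies within \<open>R\<close> of \<open>f\<close>, or \<open>w f\<close> is at most
  \<open>R\<close>, the bound is clear. Otherwise the clients of \<open>B\<close> within
  \<open>R\<close> lie strictly nearer to \<open>f\<close> than the hitting point, so they carry at
  most \<open>sum w C / Q\<close>. By Markov they are at least \<open>card B / (m + 1)\<close> many,
  and by the Lipschitz property each weighs at least \<open>w f - R\<close>. Everything is
  multiplied by \<open>card B\<close> to avoid division.\<close>

lemma cluster_distance_bound:
  fixes w :: "'a \<Rightarrow> real"
  assumes "finite C" "B \<subseteq> C" and w: "\<And>j. j \<in> C \<Longrightarrow> 0 \<le> w j"
    and dpos: "\<And>j. j \<in> B \<Longrightarrow> 0 \<le> d j f"
    and lip: "\<And>j. j \<in> B \<Longrightarrow> w f \<le> w j + d j f"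
    and "1 \<le> m" "1 \<le> Q"
    and w': "w' \<le> w f" and hits: "0 < sum w C \<Longrightarrow> \<exists>p. hit d C w Q f p \<and> w' \<le> d p f"
  shows "real (card B) * w' \<le> (1 + 1 / real m) * (\<Sum>j\<in>B. d j f) + real (m + 1) * sum w C / real Q"
proof -
  let ?s = "real (card B)" and ?c = "\<Sum>j\<in>B. d j f" and ?W = "sum w C"
  have finB: "finite B" using assms finite_subset by auto
  have c0: "0 \<le> ?c" using dpos by (rule sum_nonneg)
  have W0: "0 \<le> ?W" using w by (rule sum_nonneg)
  have m0: "0 < real m" "0 < real Q" using assms by auto
  show ?thesis
  proof (cases "?W = 0")
    \<comment> \<open>Without weight nothing hits \<open>f\<close>, as \<open>hit\<close> is a
      strict inequality. But then every client of \<open>B\<close> has weight zero, and the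
      Lipschitz property alone bounds \<open>w f\<close>.\<close>
    case True
    then have "w j = 0" if "j \<in> B" for j
      using that sum_nonneg_eq_0_iff[OF assms(1), of w] w assms(2) by auto
    then have "w f \<le> d j f" if "j \<in> B" for j using lip that by auto
    then have "(\<Sum>j\<in>B. w f) \<le> ?c" by (rule sum_mono)
    then have "?s * w f \<le> ?c" by simp
    moreover have "?s * w' \<le> ?s * w f" using w' by (intro mult_left_mono) auto
    ultimately have "?s * w' \<le> ?c" by (rule order_trans[rotated])
    also have "\<dots> \<le> (1 + 1 / real m) * ?c" using c0 m0 by (simp add: field_simps)
    finally show ?thesis using True by simp
  next
    case False
    then obtain p where p: "hit d C w Q f p" "w' \<le> d p f" using hits W0 by auto
    let ?t = "(1 + 1 / real m) * ?c"
    let ?N = "{j\<in>B. ?s * d j f \<le> ?t}"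
    have tail: "0 \<le> real (m + 1) * ?W / real Q" using W0 by simp
    show ?thesis
    proof (cases "?s * d p f \<le> ?t \<or> ?s * w f \<le> ?t")
      case True
      moreover have "?s * w' \<le> ?s * d p f" "?s * w' \<le> ?s * w f"
        using p w' by (auto intro: mult_left_mono)
      ultimately have "?s * w' \<le> ?t" by (auto intro: order_trans)
      then show ?thesis using tail by simp
    next
      case F: False
      then have s0: "0 < ?s" using c0 m0 by (cases "card B = 0") auto
      have sub: "?N \<subseteq> {j\<in>C. d j f < d p f}"
      proof
        fix j assume j: "j \<in> ?N"
        then have "?s * d j f < ?s * d p f" using F by auto
        then show "j \<in> {j\<in>C. d j f < d p f}" using j s0 assms(2) by auto
      qed
      have "sum w ?N \<le> sum w {j\<in>C. d j f < d p f}"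
        by (rule sum_mono2) (use sub assms in auto)
      then have "real Q * sum w ?N \<le> real Q * sum w {j\<in>C. d j f < d p f}"
        by (rule mult_left_mono) simp
      then have h1: "real Q * sum w ?N \<le> ?W" using p(1) unfolding hit_def by simp
      have h2: "real (card ?N) * (?s * w f - ?t) \<le> ?s * sum w ?N"
      proof -
        have "real (card ?N) * (?s * w f - ?t) = (\<Sum>j\<in>?N. ?s * w f - ?t)" by simp
        also have "\<dots> \<le> (\<Sum>j\<in>?N. ?s * w j)"
        proof (rule sum_mono)
          fix j assume j: "j \<in> ?N"
          then have "?s * w f \<le> ?s * (w j + d j f)" using lip s0 by (intro mult_left_mono) auto
          then show "?s * w f - ?t \<le> ?s * w j" using j by (auto simp: distrib_left)
        qed
        finally show ?thesis by (simp add: sum_distrib_left)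
      qed
      \<comment> \<open>The Markov argument cancels the cost of the cluster. If that cost is zero,
        all of \<open>B\<close> lies at distance zero and \<open>?N\<close> is the whole
        cluster.\<close>
      have h3: "?s \<le> real (m + 1) * real (card ?N)"
      proof (cases "?c = 0")
        case True
        then have "d j f = 0" if "j \<in> B" for j
          using that sum_nonneg_eq_0_iff[OF finB, of "\<lambda>j. d j f"] dpos by auto
        then have "?N = B" using True by auto
        then have "1 * ?s \<le> real (m + 1) * real (card ?N)" using s0 by (intro mult_mono) auto
        then show ?thesis by simp
      next
        case False
        then have c1: "0 < ?c" using c0 by simp
        have "real (card (B - ?N)) * ?t = (\<Sum>j\<in>B - ?N. ?t)" by simp
        also have "\<dots> \<le> (\<Sum>j\<in>B - ?N. ?s * d j f)" by (rule sum_mono) auto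
        also have "\<dots> \<le> (\<Sum>j\<in>B. ?s * d j f)" by (rule sum_mono2) (use finB dpos in auto)
        also have "\<dots> = ?s * ?c" by (simp add: sum_distrib_left)
        finally have "real (card (B - ?N)) * (1 + 1 / real m) * ?c \<le> ?s * ?c" by (simp add: mult_ac)
        then have "real (card (B - ?N)) * (1 + 1 / real m) \<le> ?s" using c1 by simp
        moreover have "real (card (B - ?N)) = ?s - real (card ?N)"
          using finB by (simp add: card_Diff_subset card_mono)
        ultimately show ?thesis using markov_arith[of "real m" ?s "real (card ?N)"] m0 by (simp only: of_nat_add of_nat_1)
      qed
      have "?s * (?s * w f - ?t) \<le> real (m + 1) * real (card ?N) * (?s * w f - ?t)"
        by (rule mult_right_mono[OF h3]) (use F in auto)
      then have "?s * (?s * w f - ?t) * real Q \<le> real (m + 1) * real (card ?N) * (?s * w f - ?t) * real Q"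
        by (rule mult_right_mono) simp
      also have "\<dots> = real (m + 1) * (real (card ?N) * (?s * w f - ?t) * real Q)"
        by (simp only: mult.assoc)
      also have "\<dots> \<le> real (m + 1) * (?s * sum w ?N * real Q)"
        by (intro mult_left_mono mult_right_mono h2) simp_all
      also have "\<dots> = real (m + 1) * (?s * (real Q * sum w ?N))"
        by (simp only: mult_ac)
      also have "\<dots> \<le> real (m + 1) * (?s * ?W)"
        by (intro mult_left_mono h1) simp_all
      finally have "?s * (?s * w f - ?t) * real Q \<le> real (m + 1) * (?s * ?W)" .
      then have "?s * ((?s * w f - ?t) * real Q) \<le> ?s * (real (m + 1) * ?W)" by (simp only: mult_ac)
      then have "(?s * w f - ?t) * real Q \<le> real (m + 1) * ?W" using s0 by simp
      then have "?s * w f - ?t \<le> real (m + 1) * ?W / real Q" using m0 by (simp add: pos_le_divide_eq)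
      moreover have "?s * w' \<le> ?s * w f" using w' by (intro mult_left_mono) auto
      ultimately show ?thesis by simp
    qed
  qed
qed

lemma sum_over_fibres:
  fixes h :: "'b \<Rightarrow> real"
  assumes "finite C"
  shows "(\<Sum>j\<in>C. h (\<pi> j)) = (\<Sum>f\<in>\<pi> ` C. real (card {j\<in>C. \<pi> j = f}) * h f)"
proof -
  have "(\<Sum>j\<in>C. h (\<pi> j)) = (\<Sum>f\<in>\<pi> ` C. \<Sum>j\<in>{j\<in>C. \<pi> j = f}. h (\<pi> j))"
    by (rule sum.image_gen[OF assms])
  also have "\<dots> = (\<Sum>f\<in>\<pi> ` C. real (card {j\<in>C. \<pi> j = f}) * h f)"
    by (intro sum.cong refl) simp
  finally show ?thesis .
qed

text \<open>Charge client \<open>j\<close> to step \<open>c j\<close>. The drop of the total in step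
  \<open>i\<close> is at least what \<open>f i\<close> would save on the clients charged to
  \<open>i\<close>, hence at least their final cost minus their distance to \<open>f i\<close>,
  because \<open>cur\<close> only decreases. The drops telescope, so the final total minus the
  target is at most the initial total minus the final one.\<close>

lemma greedy_half:
  fixes cur :: "nat \<Rightarrow> 'a \<Rightarrow> real"
  assumes "finite C" and c: "\<And>j. j \<in> C \<Longrightarrow> c j < k"
    and step: "\<And>i j. i < k \<Longrightarrow> j \<in> C \<Longrightarrow> cur (Suc i) j \<le> cur i j"
    and greedy: "\<And>i. i < k \<Longrightarrow> sum (cur (Suc i)) C \<le> (\<Sum>j\<in>C. min (cur i j) (d j (f i)))"
  shows "2 * sum (cur k) C \<le> sum (cur 0) C + (\<Sum>j\<in>C. d j (f (c j)))"
proof -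
  have anti: "cur b j \<le> cur a j" if "a \<le> b" "b \<le> k" "j \<in> C" for a b j
    using that(1,2)
  proof (induction b rule: dec_induct)
    case (step b)
    have "cur (Suc b) j \<le> cur b j" using assms(3)[of b j] step that(3) by simp
    then show ?case using step by simp
  qed simp
  have gain: "(\<Sum>j\<in>{j\<in>C. c j = i}. cur k j - d j (f i)) \<le> sum (cur i) C - sum (cur (Suc i)) C"
    if "i < k" for i
  proof -
    have "(\<Sum>j\<in>{j\<in>C. c j = i}. cur k j - d j (f i))
        \<le> (\<Sum>j\<in>{j\<in>C. c j = i}. cur i j - min (cur i j) (d j (f i)))"
    proof (rule sum_mono)
      fix j assume "j \<in> {j\<in>C. c j = i}"
      then have "cur k j \<le> cur i j" using anti[of i k j] that by simp
      then show "cur k j - d j (f i) \<le> cur i j - min (cur i j) (d j (f i))"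
        by (simp add: min_def)
    qed
    also have "\<dots> \<le> (\<Sum>j\<in>C. cur i j - min (cur i j) (d j (f i)))"
      by (rule sum_mono2) (use assms(1) in auto)
    also have "\<dots> \<le> sum (cur i) C - sum (cur (Suc i)) C"
      using greedy[OF that] by (simp add: sum_subtractf)
    finally show ?thesis .
  qed
  have "(\<Sum>j\<in>C. cur k j - d j (f (c j))) = (\<Sum>i<k. \<Sum>j\<in>{j\<in>C. c j = i}. cur k j - d j (f (c j)))"
    by (rule sum.group[symmetric]) (use assms(1) c in auto)
  also have "\<dots> = (\<Sum>i<k. \<Sum>j\<in>{j\<in>C. c j = i}. cur k j - d j (f i))"
    by (intro sum.cong refl) simp
  also have "\<dots> \<le> (\<Sum>i<k. sum (cur i) C - sum (cur (Suc i)) C)"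
    by (rule sum_mono) (rule gain, simp)
  also have "\<dots> = sum (cur 0) C - sum (cur k) C"
    by (rule sum_lessThan_telescope')
  finally show ?thesis by (simp add: sum_subtractf)
qed

section \<open>Rounded radii and numbered words\<close>

text \<open>The grid consists of the blocks \<open>2^t D, 2 2^t D, \<dots>, m 2^t D\<close>.\<close>

lemma grid_rounding:
  fixes gr :: "nat \<Rightarrow> real"
  assumes "1 \<le> m" "0 < D"
    and small: "\<And>e. e < m \<Longrightarrow> e < Y \<Longrightarrow> gr e = real (e + 1) * D"
    and double: "\<And>e. m \<le> e \<Longrightarrow> e < Y \<Longrightarrow> gr e = 2 * gr (e - m)"
    and "0 \<le> x" "x \<le> 2 ^ t * real m * D" "m * (t + 1) \<le> Y"
  shows "\<exists>e<Y. x \<le> gr e \<and> gr e \<le> (1 + 2 / real m) * x + D"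
proof -
  have "\<exists>e<m * (t + 1). x \<le> gr e \<and> (x \<le> real m * D \<and> gr e \<le> x + D \<or> gr e \<le> (1 + 2 / real m) * x)"
    using assms(5-7)
  proof (induction t arbitrary: x)
    case 0
    define e where "e = nat \<lceil>x / D\<rceil> - 1"
    have ce: "\<lceil>x / D\<rceil> \<le> int m" using 0 assms(2) by (simp add: ceiling_le_iff divide_le_eq)
    have xD: "0 \<le> x / D" using 0 assms(2) by simp
    have em: "e < m" using ce assms(1) unfolding e_def by linarith
    have gr: "gr e = real (e + 1) * D" using small em 0 by simp
    have "x / D \<le> real (e + 1)" "real (e + 1) \<le> x / D + 1"
      using xD unfolding e_def by linarith+
    then have "x \<le> real (e + 1) * D" "real (e + 1) * D \<le> x + D"
      using assms(2) by (simp_all add: field_simps)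
    then show ?case using em gr 0 by auto
  next
    case (Suc t)
    show ?case
    proof (cases "x \<le> real m * D")
      case True
      then have "x \<le> 2 ^ t * real m * D"
        using assms(2) mult_right_mono[of 1 "2 ^ t" "real m * D"] by simp
      then obtain e where "e < m * (t + 1)" "x \<le> gr e"
         "x \<le> real m * D \<and> gr e \<le> x + D \<or> gr e \<le> (1 + 2 / real m) * x"
        using Suc.IH[of x] Suc.prems by auto
      then show ?thesis by (intro exI[of _ e]) auto
    next
      case False
      obtain e where e: "e < m * (t + 1)" "x / 2 \<le> gr e"
         "x / 2 \<le> real m * D \<and> gr e \<le> x / 2 + D \<or> gr e \<le> (1 + 2 / real m) * (x / 2)"
        using Suc.IH[of "x / 2"] Suc.prems by auto
      have g: "gr (e + m) = 2 * gr e" using double[of "e + m"] e(1) Suc.prems by simp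
      define q where "q = 2 / real m * x"
      have q: "(1 + 2 / real m) * (x / 2) = (x + q) / 2" "(1 + 2 / real m) * x = x + q"
        by (simp_all add: q_def algebra_simps)
      \<comment> \<open>Beyond \<open>m * D\<close> the doubled additive error \<open>2 * D\<close>
        is absorbed by the relative error \<open>2 / m\<close>.\<close>
      have "2 * D \<le> q" using False assms(1) by (simp add: q_def field_simps)
      then have "gr (e + m) \<le> (1 + 2 / real m) * x"
        using e(3) unfolding g q by (elim disjE conjE) (linarith, simp add: field_simps)
      moreover have "e + m < m * (Suc t + 1)" using e(1) by simp
      moreover have "x \<le> gr (e + m)" using e(2) unfolding g by linarith
      ultimately show ?thesis by blast
    qed
  qed
  then obtain e where e: "e < m * (t + 1)" "x \<le> gr e"
      "gr e \<le> x + D \<or> gr e \<le> (1 + 2 / real m) * x"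
    by (elim exE conjE disjE) auto
  have "0 \<le> 2 / real m * x" using assms(5) by simp
  then have "gr e \<le> (1 + 2 / real m) * x + D"
    using e(3) assms(2) unfolding distrib_right by linarith
  then show ?thesis using e(1,2) assms(7) by (intro exI[of _ e]) simp
qed

text \<open>Words of guesses are enumerated as base-\<open>Y\<close> expansions of a counter; every
  word is reached before the counter gets to \<open>Y ^ M\<close>.\<close>

lemma exists_number_with_digits:
  fixes g :: "nat \<Rightarrow> nat"
  assumes "\<And>i. i < M \<Longrightarrow> g i < Y"
  shows "\<exists>c<Y ^ M. \<forall>i<M. c div Y ^ i mod Y = g i"
  using assms
proof (induction M arbitrary: g)
  case (Suc M)
  obtain c where c: "c < Y ^ M" "\<forall>i<M. c div Y ^ i mod Y = g (Suc i)"
    using Suc.IH[of "\<lambda>i. g (Suc i)"] Suc.prems by auto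
  have g0: "g 0 < Y" using Suc.prems by auto
  let ?c = "c * Y + g 0"
  have "?c div Y ^ i mod Y = g i" if "i < Suc M" for i
  proof (cases i)
    case 0
    then show ?thesis using g0 by simp
  next
    case (Suc i')
    have "?c div Y ^ i = ?c div Y div Y ^ i'" by (simp add: Suc div_mult2_eq)
    also have "?c div Y = c" using g0 by simp
    finally show ?thesis using c(2) that Suc by auto
  qed
  moreover have "?c < Y ^ Suc M"
  proof -
    have "?c < (c + 1) * Y" using g0 by simp
    also have "\<dots> \<le> Y ^ M * Y" using c(1) by (intro mult_right_mono) auto
    finally show ?thesis by (simp add: mult.commute)
  qed
  ultimately show ?case by blast
qed simp

text \<open>The carry rule: incrementing changes the part of the number from position
  \<open>i\<close> on exactly when all lower digits overflow, that is, when \<open>Y ^ i\<close>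
  divides the new value.\<close>

lemma div_power_Suc_eq:
  fixes c Y :: nat
  assumes "1 < Y"
  shows "Suc c div Y ^ i = c div Y ^ i + (if Y ^ i dvd Suc c then 1 else 0)"
  by (simp add: div_Suc dvd_eq_mod_eq_0)

section \<open>The algorithm\<close>

abbreviation nv :: "vname \<Rightarrow> nexp" where "nv x \<equiv> NCell x (NConst 0)"
abbreviation rv :: "vname \<Rightarrow> rexp" where "rv x \<equiv> RCell x (NConst 0)"
abbreviation setn :: "vname \<Rightarrow> nexp \<Rightarrow> prog" where "setn x e \<equiv> PN x (NConst 0) e"
abbreviation setr :: "vname \<Rightarrow> rexp \<Rightarrow> prog" where "setr x e \<equiv> PR x (NConst 0) e"
abbreviation incn :: "vname \<Rightarrow> nexp \<Rightarrow> prog" where "incn x e \<equiv> setn x (NAdd (nv x) e)"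
abbreviation incr :: "vname \<Rightarrow> rexp \<Rightarrow> prog" where "incr x e \<equiv> setr x (RAdd (rv x) e)"
abbreviation ifp :: "bexp \<Rightarrow> prog \<Rightarrow> prog" where "ifp b p \<equiv> PIf b p PSkip"
abbreviation pos :: "nexp \<Rightarrow> bexp" where "pos e \<equiv> NLess (NConst 0) e"
text \<open>Tables over pairs of points are stored row by row. The row offsets \<open>x * n\<close>
  are looked up in \<open>off\<close>, since an expression cannot multiply.\<close>

abbreviation sdist :: "nexp \<Rightarrow> nexp \<Rightarrow> rexp" where
  "sdist a b \<equiv> RCell ''sd'' (NAdd (NCell ''off'' a) b)"
abbreviation hits :: "nexp \<Rightarrow> nexp \<Rightarrow> nexp" where
  "hits f p \<equiv> NCell ''hit'' (NAdd (NCell ''off'' f) p)"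

section \<open>Rank, logarithm, products and scaled distances\<close>

definition rank_prog :: prog where
  "rank_prog = PFor ''v'' NPoints
     (PN ''A'' (nv ''v'') (NConst 1);;
      PIf (IsIndep ''A'') (incn ''kk'' (NConst 1)) (PN ''A'' (nv ''v'') (NConst 0)))"

definition log_prog :: prog where
  "log_prog = setn ''pow'' (NConst 1);; setn ''lg'' (NConst 1);;
     PFor ''v'' NPoints
       (ifp (NLess (nv ''pow'') NPoints)
         (setn ''pow'' (NAdd (nv ''pow'') (nv ''pow''));; incn ''lg'' (NConst 1)))"

definition mul_prog :: "vname \<Rightarrow> vname \<Rightarrow> nexp \<Rightarrow> prog" where
  "mul_prog z l e = setn z (NConst 0);; PFor ''v'' (nv l) (incn z e)"

definition pow_prog :: prog where
  "pow_prog = setn ''PW'' (NConst 1);;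
     PFor ''u'' (nv ''M'') (mul_prog ''tmp'' ''Y'' (nv ''PW'');; setn ''PW'' (nv ''tmp''))"

text \<open>\<open>sd\<close> is the metric scaled by \<open>n * m\<close>, obtained by that many
  additions. On this scale the guessed distance itself is a fine enough unit for the radii.\<close>

definition dist_prog :: prog where
  "dist_prog =
     PFor ''x'' NPoints (PN ''off'' (NAdd (nv ''x'') (NConst 1)) (NAdd (NCell ''off'' (nv ''x'')) NPoints));;
     PFor ''x'' NPoints (PFor ''y'' NPoints (
       setr ''acc'' (RConst 0);;
       PFor ''i'' NPoints (PFor ''j'' (nv ''m'') (incr ''acc'' (RDist (nv ''x'') (nv ''y''))));;
       PR ''sd'' (NAdd (NCell ''off'' (nv ''x'')) (nv ''y'')) (rv ''acc'')))"

section \<open>Leaders and radii\<close>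

text \<open>The multiples in \<open>wq\<close> let the test for \<open>hit\<close> be done with sums
  only.\<close>

definition weights_prog :: prog where
  "weights_prog =
     PFor ''x'' NPoints (setr ''acc'' (RConst 0);;
       PFor ''i'' (nv ''Q'') (incr ''acc'' (RCell ''w'' (nv ''x'')));;
       PR ''wq'' (nv ''x'') (rv ''acc''));;
     setr ''W'' (RConst 0);;
     PFor ''x'' NPoints (ifp (IsClient (nv ''x'')) (incr ''W'' (RCell ''w'' (nv ''x''))))"

definition hit_prog :: prog where
  "hit_prog = PFor ''f'' NPoints (PN ''un'' (nv ''f'') (NConst 1);;
     PFor ''p'' NPoints (setr ''h'' (RConst 0);;
       PFor ''x'' NPoints
         (ifp (BAnd (IsClient (nv ''x'')) (RLess (RDist (nv ''x'') (nv ''f'')) (RDist (nv ''p'') (nv ''f''))))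
           (incr ''h'' (RCell ''wq'' (nv ''x''))));;
       PIf (RLess (rv ''h'') (rv ''W''))
         (PN ''hit'' (NAdd (NCell ''off'' (nv ''f'')) (nv ''p'')) (NConst 1))
         (PN ''hit'' (NAdd (NCell ''off'' (nv ''f'')) (nv ''p'')) (NConst 0))))"

definition best_prog :: prog where
  "best_prog = setn ''bc'' (NConst 0);; setn ''bp'' (NConst 0);;
     PFor ''p'' NPoints (setn ''c'' (NConst 0);;
       PFor ''f'' NPoints
         (ifp (BAnd (pos (NCell ''un'' (nv ''f''))) (pos (hits (nv ''f'') (nv ''p''))))
           (incn ''c'' (NConst 1)));;
       ifp (NLess (nv ''bc'') (nv ''c'')) (setn ''bc'' (nv ''c'');; setn ''bp'' (nv ''p'')))"

definition pick_prog :: prog where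
  "pick_prog = best_prog;;
     PN ''T'' (nv ''tc'') (nv ''bp'');; incn ''tc'' (NConst 1);;
     PFor ''f'' NPoints (ifp (pos (hits (nv ''f'') (nv ''bp''))) (PN ''un'' (nv ''f'') (NConst 0)));;
     PFor ''x'' NPoints
       (ifp (RLess (RDist (nv ''x'') (nv ''bp'')) (RCell ''w'' (nv ''x'')))
         (PR ''w'' (nv ''x'') (RDist (nv ''x'') (nv ''bp''))))"

text \<open>The table \<open>hit\<close> is fixed at the start of a round, while the picks of that
  round already lower \<open>w\<close>.\<close>

definition round_prog :: prog where
  "round_prog = weights_prog;; hit_prog;; PFor ''q'' (nv ''Z'') pick_prog"

text \<open>The truncation level of \<open>w\<close> is the scaled value \<open>n * m * D\<close>.
  It is so high that no optimal facility still has this weight at the end, so its weight is a true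
  distance to a listed point.\<close>

definition leaders_prog :: prog where
  "leaders_prog =
     PFor ''x'' NPoints (PR ''w'' (nv ''x'') (sdist (nv ''u'') (nv ''v'')));;
     setn ''tc'' (NConst 0);; PFor ''r'' (nv ''Z'') round_prog"

definition grid_prog :: prog where
  "grid_prog = setr ''acc'' (RConst 0);;
     PFor ''e'' (nv ''Y'') (incr ''acc'' (RDist (nv ''u'') (nv ''v''));;
       PIf (NLess (nv ''e'') (nv ''m'')) (PR ''gr'' (nv ''e'') (rv ''acc''))
         (PR ''gr'' (nv ''e'') (RAdd (RCell ''gr'' (NSub (nv ''e'') (nv ''m'')))
                                     (RCell ''gr'' (NSub (nv ''e'') (nv ''m''))))))"

text \<open>A word consists of three blocks of \<open>k\<close> digits: indices of leaders, indices
  of radii, and positions in the greedy bases.\<close>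

abbreviation leader :: "nexp \<Rightarrow> nexp" where "leader i \<equiv> NCell ''T'' (NCell ''dig'' i)"
abbreviation radius :: "nexp \<Rightarrow> rexp" where
  "radius i \<equiv> RCell ''gr'' (NCell ''dig'' (NAdd i (nv ''kk'')))"
abbreviation choice :: "nexp \<Rightarrow> nexp" where
  "choice i \<equiv> NCell ''dig'' (NAdd i (NAdd (nv ''kk'') (nv ''kk'')))"

section \<open>Evaluation of one word\<close>

definition bound_prog :: prog where
  "bound_prog = PFor ''x'' NPoints (
     PR ''cur'' (nv ''x'') (RAdd (sdist (nv ''x'') (leader (NConst 0))) (radius (NConst 0)));;
     PFor ''i'' (nv ''kk'') (
       setr ''val'' (RAdd (sdist (nv ''x'') (leader (nv ''i''))) (radius (nv ''i'')));;
       ifp (RLess (rv ''val'') (RCell ''cur'' (nv ''x''))) (PR ''cur'' (nv ''x'') (rv ''val''))))"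

definition value_prog :: prog where
  "value_prog = PFor ''f'' NPoints (setr ''acc'' (RConst 0);;
     PFor ''x'' NPoints (ifp (IsClient (nv ''x''))
       (PIf (RLess (sdist (nv ''x'') (nv ''f'')) (RCell ''cur'' (nv ''x'')))
         (incr ''acc'' (sdist (nv ''x'') (nv ''f'')))
         (incr ''acc'' (RCell ''cur'' (nv ''x''))))) ;;
     PR ''vl'' (nv ''f'') (rv ''acc''))"

text \<open>The value \<open>NPoints\<close> in \<open>bf\<close> means that no candidate has been
  found. A new candidate must be strictly better, so ties go to the smallest index, as in
  \<open>best\<close>. Independence is tested by marking \<open>f\<close> tentatively in
  \<open>A\<close>.\<close>

definition cand_prog :: prog where
  "cand_prog = ifp (BAnd (BNot (pos (NCell ''A'' (nv ''f''))))
      (BAnd (BNot (RLess (radius (nv ''i'')) (sdist (leader (nv ''i'')) (nv ''f''))))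
            (BNot (BAnd (NLess (nv ''bf'') NPoints)
                        (BNot (RLess (RCell ''vl'' (nv ''f'')) (RCell ''vl'' (nv ''bf''))))))))
     (PN ''A'' (nv ''f'') (NConst 1);;
      ifp (IsIndep ''A'') (setn ''bf'' (nv ''f''));;
      PN ''A'' (nv ''f'') (NConst 0))"

definition next_prog :: prog where
  "next_prog = setn ''bf'' NPoints;; PFor ''f'' NPoints cand_prog;;
     ifp (NLess (nv ''bf'') NPoints) (PN ''A'' (nv ''bf'') (NConst 1);; setn ''g'' (nv ''bf''))"

text \<open>Digit \<open>c\<close> asks for the \<open>c\<close>-th greedy element; digit 0 leaves
  \<open>g\<close> at \<open>NPoints\<close>, which opens nothing. The loop runs \<open>k\<close>
  times under a guard because digits change during the run and thus cannot serve as loop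
  limits.\<close>

definition choose_prog :: prog where
  "choose_prog = PFor ''x'' NPoints (PN ''A'' (nv ''x'') (NConst 0));; setn ''g'' NPoints;;
     PFor ''t'' (nv ''kk'') (ifp (NLess (nv ''t'') (choice (nv ''i''))) next_prog)"

definition stage_prog :: prog where
  "stage_prog = value_prog;; choose_prog;;
     ifp (NLess (nv ''g'') NPoints) (PN ''S'' (nv ''g'') (NConst 1);;
       PFor ''x'' NPoints (ifp (RLess (sdist (nv ''x'') (nv ''g'')) (RCell ''cur'' (nv ''x'')))
         (PR ''cur'' (nv ''x'') (sdist (nv ''x'') (nv ''g'')))))"

definition total_prog :: prog where
  "total_prog = setr ''tot'' (RConst 0);;
     PFor ''x'' NPoints (ifp (IsClient (nv ''x''))
       (setr ''val'' (sdist (nv ''x'') (nv ''g''));;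
        PFor ''f'' NPoints (ifp (BAnd (pos (NCell ''S'' (nv ''f''))) (RLess (sdist (nv ''x'') (nv ''f'')) (rv ''val'')))
          (setr ''val'' (sdist (nv ''x'') (nv ''f''))));;
        incr ''tot'' (rv ''val'')))"

definition evaluate_prog :: prog where
  "evaluate_prog = setn ''g'' NPoints;;
     PFor ''f'' NPoints (ifp (pos (NCell ''S'' (nv ''f''))) (setn ''g'' (nv ''f'')));;
     ifp (BAnd (NLess (nv ''g'') NPoints) (IsIndep ''S''))
       (total_prog;;
        ifp (BNot (BAnd (pos (nv ''has'')) (BNot (RLess (rv ''tot'') (rv ''best'')))))
          (setn ''has'' (NConst 1);; setr ''best'' (rv ''tot'');;
           PFor ''x'' NPoints (PN ''out'' (nv ''x'') (NCell ''S'' (nv ''x'')))))"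

definition word_prog :: prog where
  "word_prog = bound_prog;; PFor ''x'' NPoints (PN ''S'' (nv ''x'') (NConst 0));;
     PFor ''i'' (nv ''kk'') stage_prog;; evaluate_prog"

section \<open>Enumeration of words and of pairs of points\<close>

definition succ_prog :: prog where
  "succ_prog = setn ''cy'' (NConst 1);;
     PFor ''i'' (nv ''M'') (ifp (pos (nv ''cy''))
       (PN ''dig'' (nv ''i'') (NAdd (NCell ''dig'' (nv ''i'')) (NConst 1));;
        PIf (NLess (NCell ''dig'' (nv ''i'')) (nv ''Y'')) (setn ''cy'' (NConst 0))
          (PN ''dig'' (nv ''i'') (NConst 0))))"

definition words_prog :: prog where
  "words_prog = PFor ''i'' (nv ''M'') (PN ''dig'' (nv ''i'') (NConst 0));;
     PFor ''cnt'' (nv ''PW'') (word_prog;; succ_prog)"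

definition guess_prog :: prog where
  "guess_prog = ifp (RLess (RConst 0) (RDist (nv ''u'') (nv ''v'')))
     (leaders_prog;; grid_prog;; words_prog)"

text \<open>If the clients themselves form an independent set, opening all of them costs nothing.
  With this case settled, the largest connection distance of a solution is positive, so
  \<open>guess_prog\<close> may skip pairs at distance zero.\<close>

definition main_prog :: prog where
  "main_prog = PFor ''x'' NPoints (ifp (IsClient (nv ''x'')) (PN ''out'' (nv ''x'') (NConst 1)));;
     PIf (IsIndep ''out'') PSkip
       (PFor ''x'' NPoints (PN ''out'' (nv ''x'') (NConst 0));;
        PFor ''u'' NPoints (PFor ''v'' NPoints guess_prog))"

lemmas prog_defs = rank_prog_def log_prog_def mul_prog_def pow_prog_def dist_prog_def
  weights_prog_def hit_prog_def best_prog_def pick_prog_def round_prog_def leaders_prog_def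
  grid_prog_def bound_prog_def value_prog_def cand_prog_def next_prog_def choose_prog_def
  stage_prog_def total_prog_def evaluate_prog_def word_prog_def succ_prog_def words_prog_def
  guess_prog_def main_prog_def

section \<open>Written variables and loop limits\<close>

lemma nw_weights_prog [simp]: "y \<notin> {''x'', ''i''} \<Longrightarrow> y \<notin> nw weights_prog"
  by (simp add: weights_prog_def)

lemma rw_weights_prog [simp]: "y \<notin> {''acc'', ''wq'', ''W''} \<Longrightarrow> y \<notin> rw weights_prog"
  by (simp add: weights_prog_def)

lemma nw_hit_prog [simp]: "y \<notin> {''f'', ''un'', ''p'', ''x'', ''hit''} \<Longrightarrow> y \<notin> nw hit_prog"
  by (simp add: hit_prog_def)

lemma rw_hit_prog [simp]: "y \<notin> {''h''} \<Longrightarrow> y \<notin> rw hit_prog"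
  by (simp add: hit_prog_def)

lemma nw_best_prog [simp]: "y \<notin> {''bc'', ''bp'', ''p'', ''c'', ''f''} \<Longrightarrow> y \<notin> nw best_prog"
  by (simp add: best_prog_def)

lemma rw_best_prog [simp]: "y \<notin> rw best_prog"
  by (simp add: best_prog_def)

lemma nw_pick_prog [simp]: "y \<notin> {''bc'', ''bp'', ''p'', ''c'', ''f'', ''T'', ''tc'', ''un'', ''x''} \<Longrightarrow> y \<notin> nw pick_prog"
  by (simp add: pick_prog_def)

lemma rw_pick_prog [simp]: "y \<notin> {''w''} \<Longrightarrow> y \<notin> rw pick_prog"
  by (simp add: pick_prog_def)

lemma nw_round_prog [simp]: "y \<notin> {''x'', ''i'', ''f'', ''un'', ''p'', ''hit'', ''bc'', ''bp'', ''c'', ''T'', ''tc'', ''q''} \<Longrightarrow> y \<notin> nw round_prog"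
  by (simp add: round_prog_def)

lemma rw_round_prog [simp]: "y \<notin> {''acc'', ''wq'', ''W'', ''h'', ''w''} \<Longrightarrow> y \<notin> rw round_prog"
  by (simp add: round_prog_def)

lemma nw_leaders_prog [simp]: "y \<notin> {''x'', ''i'', ''f'', ''un'', ''p'', ''hit'', ''bc'', ''bp'', ''c'', ''T'', ''tc'', ''q'', ''r''} \<Longrightarrow> y \<notin> nw leaders_prog"
  by (simp add: leaders_prog_def)

lemma rw_leaders_prog [simp]: "y \<notin> {''acc'', ''wq'', ''W'', ''h'', ''w''} \<Longrightarrow> y \<notin> rw leaders_prog"
  by (simp add: leaders_prog_def)

lemma nw_grid_prog [simp]: "y \<notin> {''e''} \<Longrightarrow> y \<notin> nw grid_prog"
  by (simp add: grid_prog_def)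

lemma rw_grid_prog [simp]: "y \<notin> {''acc'', ''gr''} \<Longrightarrow> y \<notin> rw grid_prog"
  by (simp add: grid_prog_def)

lemma nw_bound_prog [simp]: "y \<notin> {''x'', ''i''} \<Longrightarrow> y \<notin> nw bound_prog"
  by (simp add: bound_prog_def)

lemma rw_bound_prog [simp]: "y \<notin> {''cur'', ''val''} \<Longrightarrow> y \<notin> rw bound_prog"
  by (simp add: bound_prog_def)

lemma nw_value_prog [simp]: "y \<notin> {''f'', ''x''} \<Longrightarrow> y \<notin> nw value_prog"
  by (simp add: value_prog_def)

lemma rw_value_prog [simp]: "y \<notin> {''acc'', ''vl''} \<Longrightarrow> y \<notin> rw value_prog"
  by (simp add: value_prog_def)

lemma nw_cand_prog [simp]: "y \<notin> {''A'', ''bf''} \<Longrightarrow> y \<notin> nw cand_prog"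
  by (simp add: cand_prog_def)

lemma rw_cand_prog [simp]: "y \<notin> rw cand_prog"
  by (simp add: cand_prog_def)

lemma nw_next_prog [simp]: "y \<notin> {''A'', ''bf'', ''f'', ''g''} \<Longrightarrow> y \<notin> nw next_prog"
  by (simp add: next_prog_def)

lemma rw_next_prog [simp]: "y \<notin> rw next_prog"
  by (simp add: next_prog_def)

lemma nw_choose_prog [simp]: "y \<notin> {''A'', ''bf'', ''f'', ''g'', ''t'', ''x''} \<Longrightarrow> y \<notin> nw choose_prog"
  by (simp add: choose_prog_def)

lemma rw_choose_prog [simp]: "y \<notin> rw choose_prog"
  by (simp add: choose_prog_def)

lemma nw_stage_prog [simp]: "y \<notin> {''A'', ''bf'', ''f'', ''g'', ''t'', ''x'', ''S''} \<Longrightarrow> y \<notin> nw stage_prog"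
  by (simp add: stage_prog_def)

lemma rw_stage_prog [simp]: "y \<notin> {''acc'', ''vl'', ''cur''} \<Longrightarrow> y \<notin> rw stage_prog"
  by (simp add: stage_prog_def)

lemma nw_total_prog [simp]: "y \<notin> {''x'', ''f''} \<Longrightarrow> y \<notin> nw total_prog"
  by (simp add: total_prog_def)

lemma rw_total_prog [simp]: "y \<notin> {''tot'', ''val''} \<Longrightarrow> y \<notin> rw total_prog"
  by (simp add: total_prog_def)

lemma nw_evaluate_prog [simp]: "y \<notin> {''x'', ''f'', ''g'', ''has'', ''out''} \<Longrightarrow> y \<notin> nw evaluate_prog"
  by (simp add: evaluate_prog_def)

lemma rw_evaluate_prog [simp]: "y \<notin> {''tot'', ''val'', ''best''} \<Longrightarrow> y \<notin> rw evaluate_prog"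
  by (simp add: evaluate_prog_def)

lemma nw_word_prog [simp]: "y \<notin> {''x'', ''f'', ''g'', ''has'', ''out'', ''A'', ''bf'', ''t'', ''S'', ''i''} \<Longrightarrow> y \<notin> nw word_prog"
  by (simp add: word_prog_def)

lemma rw_word_prog [simp]: "y \<notin> {''acc'', ''vl'', ''cur'', ''tot'', ''val'', ''best''} \<Longrightarrow> y \<notin> rw word_prog"
  by (simp add: word_prog_def)

lemma nw_succ_prog [simp]: "y \<notin> {''cy'', ''i'', ''dig''} \<Longrightarrow> y \<notin> nw succ_prog"
  by (simp add: succ_prog_def)

lemma rw_succ_prog [simp]: "y \<notin> rw succ_prog"
  by (simp add: succ_prog_def)

lemma nw_words_prog [simp]: "y \<notin> {''x'', ''f'', ''g'', ''has'', ''out'', ''A'', ''bf'', ''t'', ''S'', ''i'', ''cy'', ''dig'', ''cnt''} \<Longrightarrow> y \<notin> nw words_prog"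
  by (simp add: words_prog_def)

lemma rw_words_prog [simp]: "y \<notin> {''acc'', ''vl'', ''cur'', ''tot'', ''val'', ''best''} \<Longrightarrow> y \<notin> rw words_prog"
  by (simp add: words_prog_def)

lemma nw_guess_prog [simp]: "y \<notin> {''x'', ''i'', ''f'', ''un'', ''p'', ''hit'', ''bc'', ''bp'', ''c'', ''T'', ''tc'', ''q'', ''r'', ''e'', ''g'', ''has'', ''out'', ''A'', ''bf'', ''t'', ''S'', ''cy'', ''dig'', ''cnt''} \<Longrightarrow> y \<notin> nw guess_prog"
  by (simp add: guess_prog_def)

lemma rw_guess_prog [simp]: "y \<notin> {''acc'', ''wq'', ''W'', ''h'', ''w'', ''gr'', ''vl'', ''cur'', ''tot'', ''val'', ''best''} \<Longrightarrow> y \<notin> rw guess_prog"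
  by (simp add: guess_prog_def)

text \<open>For instance: the two loops over the guessed pair, the rounds, the picks, and the two
  loops of \<open>best_prog\<close>.\<close>

lemma depth_main [simp]: "depth main_prog = 6"
  by (simp add: prog_defs)

lemma limits [simp]:
  "''Q'' \<in> L \<Longrightarrow> limits_in L weights_prog"
  "limits_in L hit_prog" "limits_in L pick_prog"
  "''Y'' \<in> L \<Longrightarrow> limits_in L grid_prog"
  "''kk'' \<in> L \<Longrightarrow> limits_in L bound_prog"
  "limits_in L value_prog" "limits_in L next_prog" "limits_in L evaluate_prog"
  "''M'' \<in> L \<Longrightarrow> limits_in L succ_prog"
  by (auto simp: weights_prog_def hit_prog_def pick_prog_def best_prog_def grid_prog_def bound_prog_def
      value_prog_def next_prog_def cand_prog_def evaluate_prog_def total_prog_def succ_prog_def)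

lemma limits_main: "limits_in {''kk'', ''Q'', ''Z'', ''Y'', ''M'', ''PW''} main_prog"
  by (simp add: main_prog_def guess_prog_def words_prog_def leaders_prog_def word_prog_def
    round_prog_def stage_prog_def choose_prog_def)

lemma nw_main: "{''kk'', ''Q'', ''Z'', ''Y'', ''M'', ''PW''} \<inter> nw main_prog = {}"
  unfolding main_prog_def by simp

section \<open>Choosing candidate leaders\<close>

declare ev.simps(6) [simp del] One_nat_def [simp del]

lemma sum_lessThan_filter:
  fixes h :: "nat \<Rightarrow> real"
  assumes "C \<subseteq> {..<n}"
  shows "(\<Sum>j<n. if j \<in> C \<and> P j then h j else 0) = sum h {j\<in>C. P j}"
proof -
  have "{j. j < n \<and> j \<in> C \<and> P j} = {j\<in>C. P j}" using assms by auto
  then show ?thesis by (simp add: sum.inter_filter[symmetric])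
qed

lemma sum_lessThan_clients:
  fixes h :: "nat \<Rightarrow> real"
  assumes "C \<subseteq> {..<n}"
  shows "(\<Sum>j<n. if j \<in> C then h j else 0) = sum h C"
  using sum_lessThan_filter[OF assms, of "\<lambda>_. True" h] by simp

text \<open>Row-major indices do not collide, so writing one entry of a table leaves all the others
  intact.\<close>

lemma index_inj:
  fixes n :: nat
  assumes "p < n" "p' < n"
  shows "f * n + p = f' * n + p' \<longleftrightarrow> f = f' \<and> p = p'"
proof
  assume eq: "f * n + p = f' * n + p'"
  have "(f * n + p) div n = f" "(f' * n + p') div n = f'" using assms by simp_all
  then have "f = f'" using eq by simp
  then show "f = f' \<and> p = p'" using eq by simp
qed simp

lemma ev_repeat_incr:
  assumes "\<And>t. \<lbrakk>\<And>y. y \<noteq> x \<Longrightarrow> nmem t y = nmem s y; \<And>y. y \<noteq> acc \<Longrightarrow> rmem t y = rmem s y\<rbrakk>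
      \<Longrightarrow> rval I t a = c"
  shows "rmem (ev I (PFor x e (incr acc a)) s) acc 0 = rmem s acc 0 + real (nval I s e) * c"
  by (rule ev_For_inv[where P = "\<lambda>i t. rmem t acc 0 = rmem s acc 0 + real i * c"])
    (simp_all add: assms algebra_simps)

section \<open>Parameters and prepared data of a run\<close>

locale mm_run =
  fixes I :: mm_input and m lg :: nat
  assumes inst: "mm_instance I" and m9: "9 \<le> m" and lg1: "1 \<le> lg"
    and n_le: "npoints I \<le> 2 ^ (lg - 1)"
begin

abbreviation n :: nat where "n \<equiv> npoints I"
abbreviation d :: "nat \<Rightarrow> nat \<Rightarrow> real" where "d \<equiv> metric I"
abbreviation C :: "nat set" where "C \<equiv> clients I"
abbreviation k :: nat where "k \<equiv> mm_rank I"
text \<open>With this \<open>Q\<close> the error \<open>(m + 1) * W / Q\<close> of one cluster is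
  \<open>W / (m * k)\<close>, hence at most \<open>W / m\<close> over all clusters. \<open>Z\<close>
  is both the number of picks in a round and the number of rounds, which makes \<open>Y\<close> the
  length of the list of leaders.\<close>

definition Q :: nat where "Q = m * (m + 1) * k"
definition Z :: nat where "Z = Q * lg"
definition Y :: nat where "Y = Z * Z"
definition sd :: "nat \<Rightarrow> nat \<Rightarrow> real" where "sd x y = real (n * m) * d x y"

sublocale Metric_space "{..<n}" d
  using inst by (simp add: mm_instance_def)

lemma n_le_real: "real n \<le> 2 ^ (lg - 1)"
  using n_le by (metis of_nat_le_iff of_nat_numeral of_nat_power)

lemma m_le_real: "real m \<le> 2 ^ m"
  using less_exp[of m] by (metis less_imp_le of_nat_le_iff of_nat_numeral of_nat_power)

lemma C_sub: "C \<subseteq> {..<n}" and fin_C: "finite C"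
  using inst finite_subset by (auto simp: mm_instance_def)

lemma client_less: "j \<in> C \<Longrightarrow> j < n"
  using C_sub by auto

definition static :: "state \<Rightarrow> bool" where
  "static s \<longleftrightarrow> nmem s ''kk'' 0 = k \<and> nmem s ''Q'' 0 = Q \<and> nmem s ''Z'' 0 = Z \<and> nmem s ''Y'' 0 = Y \<and>
     nmem s ''M'' 0 = 3 * k \<and> nmem s ''PW'' 0 = Y ^ (3 * k) \<and> nmem s ''m'' 0 = m \<and>
     (\<forall>x<n. nmem s ''off'' x = x * n) \<and> (\<forall>x<n. \<forall>y<n. rmem s ''sd'' (x * n + y) = sd x y)"

lemma static_ev:
  assumes "static s"
    and "{''kk'', ''Q'', ''Z'', ''Y'', ''M'', ''PW'', ''m'', ''off''} \<inter> nw p = {}" "''sd'' \<notin> rw p"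
  shows "static (ev I p s)"
  using assms by (simp add: static_def nmem_ev rmem_ev)

lemma weights_spec:
  assumes "static s"
  shows "x < n \<Longrightarrow> rmem (ev I weights_prog s) ''wq'' x = real Q * rmem s ''w'' x"
    and "rmem (ev I weights_prog s) ''W'' 0 = sum (rmem s ''w'') C"
proof -
  let ?p = "PFor ''x'' NPoints (setr ''acc'' (RConst 0);;
       PFor ''i'' (nv ''Q'') (incr ''acc'' (RCell ''w'' (nv ''x'')));;
       PR ''wq'' (nv ''x'') (rv ''acc''))"
  let ?q = "PFor ''x'' NPoints (ifp (IsClient (nv ''x'')) (incr ''W'' (RCell ''w'' (nv ''x''))))"
  have Q: "nmem s ''Q'' 0 = Q" using assms by (simp add: static_def)
  have r: "rmem (ev I (PFor ''i'' (nv ''Q'') (incr ''acc'' (RCell ''w'' (nv ''x'')))) u) ''acc'' 0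
      = rmem u ''acc'' 0 + real (nval I u (nv ''Q'')) * rmem u ''w'' (nmem u ''x'' 0)" for u
    by (rule ev_repeat_incr) simp
  have 1: "\<forall>x<nval I s NPoints. rmem (ev I ?p s) ''wq'' x = real Q * rmem s ''w'' x"
  proof (rule ev_For_inv[where P = "\<lambda>i t. \<forall>x<i. rmem t ''wq'' x = real Q * rmem s ''w'' x"], goal_cases)
    case (3 i t)
    then show ?case by (simp add: r nmem_ev rmem_ev Q less_Suc_eq)
  qed simp_all
  then show "x < n \<Longrightarrow> rmem (ev I weights_prog s) ''wq'' x = real Q * rmem s ''w'' x"
    by (simp add: weights_prog_def rmem_ev)
  have 2: "rmem (ev I ?q u) ''W'' 0 = rmem u ''W'' 0 + (\<Sum>j<nval I u NPoints. if j \<in> C then rmem u ''w'' j else 0)" for u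
    by (rule ev_For_inv[where P = "\<lambda>i t. rmem t ''W'' 0 = rmem u ''W'' 0 + (\<Sum>j<i. if j \<in> C then rmem u ''w'' j else 0)"])
      simp_all
  show "rmem (ev I weights_prog s) ''W'' 0 = sum (rmem s ''w'') C"
    by (simp add: weights_prog_def 2 rmem_ev sum_lessThan_clients[OF C_sub])
qed

definition Hit :: "state \<Rightarrow> nat \<Rightarrow> nat \<Rightarrow> bool" where
  "Hit s f p \<longleftrightarrow> nmem s ''hit'' (f * n + p) \<noteq> 0"

lemma hit_spec:
  assumes "static s"
  shows "f < n \<Longrightarrow> nmem (ev I hit_prog s) ''un'' f = 1"
    and "f < n \<Longrightarrow> p < n \<Longrightarrow> Hit (ev I hit_prog s) f p \<longleftrightarrow>
      sum (rmem s ''wq'') {j\<in>C. d j f < d p f} < rmem s ''W'' 0"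
proof -
  let ?h = "PFor ''x'' NPoints
         (ifp (BAnd (IsClient (nv ''x'')) (RLess (RDist (nv ''x'') (nv ''f'')) (RDist (nv ''p'') (nv ''f''))))
           (incr ''h'' (RCell ''wq'' (nv ''x''))))"
  let ?p = "PFor ''p'' NPoints (setr ''h'' (RConst 0);; ?h;;
       PIf (RLess (rv ''h'') (rv ''W''))
         (PN ''hit'' (NAdd (NCell ''off'' (nv ''f'')) (nv ''p'')) (NConst 1))
         (PN ''hit'' (NAdd (NCell ''off'' (nv ''f'')) (nv ''p'')) (NConst 0)))"
  let ?H = "\<lambda>f p. sum (rmem s ''wq'') {j\<in>C. d j f < d p f} < rmem s ''W'' 0"
  have off: "x < n \<Longrightarrow> nmem s ''off'' x = x * n" for x using assms by (simp add: static_def)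
  have h: "rmem (ev I ?h u) ''h'' 0 = rmem u ''h'' 0 +
      sum (rmem u ''wq'') {j\<in>C. d j (nmem u ''f'' 0) < d (nmem u ''p'' 0) (nmem u ''f'' 0)}" for u
  proof -
    have "rmem (ev I ?h u) ''h'' 0 = rmem u ''h'' 0 + (\<Sum>j<nval I u NPoints.
        if j \<in> C \<and> d j (nmem u ''f'' 0) < d (nmem u ''p'' 0) (nmem u ''f'' 0) then rmem u ''wq'' j else 0)"
      by (rule ev_For_inv[where P = "\<lambda>i t. rmem t ''h'' 0 = rmem u ''h'' 0 + (\<Sum>j<i.
          if j \<in> C \<and> d j (nmem u ''f'' 0) < d (nmem u ''p'' 0) (nmem u ''f'' 0) then rmem u ''wq'' j else 0)"])
        simp_all
    then show ?thesis by (simp add: sum_lessThan_filter[OF C_sub])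
  qed
  have p: "(\<forall>p<nval I u NPoints. Hit (ev I ?p u) f p \<longleftrightarrow> ?H f p) \<and>
      (\<forall>f' p. f' \<noteq> f \<longrightarrow> p < n \<longrightarrow> Hit (ev I ?p u) f' p = Hit u f' p)"
    if u: "nmem u ''f'' 0 = f" "f < n" "nmem u ''off'' = nmem s ''off''"
      "rmem u ''wq'' = rmem s ''wq''" "rmem u ''W'' = rmem s ''W''" for u f
  proof (rule ev_For_inv[where P = "\<lambda>i t. (\<forall>p<i. Hit t f p \<longleftrightarrow> ?H f p) \<and>
      (\<forall>f' p. f' \<noteq> f \<longrightarrow> p < n \<longrightarrow> Hit t f' p = Hit u f' p)"], goal_cases)
    case (3 i t)
    then show ?case by (auto simp: Hit_def h nmem_ev rmem_ev less_Suc_eq u off index_inj)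
  qed (simp_all add: Hit_def)
  have "\<forall>f<nval I s NPoints. nmem (ev I hit_prog s) ''un'' f = 1 \<and> (\<forall>p<n. Hit (ev I hit_prog s) f p \<longleftrightarrow> ?H f p)"
    unfolding hit_prog_def
  proof (rule ev_For_inv[where P = "\<lambda>i t. \<forall>f<i. nmem t ''un'' f = 1 \<and> (\<forall>p<n. Hit t f p \<longleftrightarrow> ?H f p)"], goal_cases)
    case (3 i t)
    let ?u = "nupdate ''un'' i 1 t"
    define v where "v = ev I ?p ?u"
    have i: "i < n" using 3(1) by simp
    have u: "nmem ?u ''f'' 0 = i" "nmem ?u ''off'' = nmem s ''off''"
      "rmem ?u ''wq'' = rmem s ''wq''" "rmem ?u ''W'' = rmem s ''W''"
      using 3(3-5) by simp_all
    have v: "\<forall>p<n. Hit v i p \<longleftrightarrow> ?H i p" "\<forall>f p. f \<noteq> i \<longrightarrow> p < n \<longrightarrow> Hit v f p = Hit t f p"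
      using p[OF u(1) i u(2-4), folded v_def] by (simp_all add: Hit_def)
    have un: "nmem v ''un'' = (nmem t ''un'')(i := 1)" by (simp add: v_def nmem_ev)
    have "ev I (PN ''un'' (nv ''f'') (NConst 1);; ?p) t = v" using 3(3) by (simp add: v_def)
    then show ?case using 3(2) v by (auto simp: less_Suc_eq un Hit_def)
  qed simp_all
  then show "f < n \<Longrightarrow> nmem (ev I hit_prog s) ''un'' f = 1"
    "f < n \<Longrightarrow> p < n \<Longrightarrow> Hit (ev I hit_prog s) f p \<longleftrightarrow> ?H f p"
    by simp_all
qed

definition Unhit :: "state \<Rightarrow> nat set" where
  "Unhit s = {f. f < n \<and> nmem s ''un'' f \<noteq> 0}"

lemma best_spec:
  assumes "static s" "0 < n"
  shows "nmem (ev I best_prog s) ''bp'' 0 < n"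
    and "p < n \<Longrightarrow> card {f\<in>Unhit s. Hit s f p}
      \<le> card {f\<in>Unhit s. Hit s f (nmem (ev I best_prog s) ''bp'' 0)}"
proof -
  let ?c = "PFor ''f'' NPoints
         (ifp (BAnd (pos (NCell ''un'' (nv ''f''))) (pos (hits (nv ''f'') (nv ''p''))))
           (incn ''c'' (NConst 1)))"
  let ?N = "\<lambda>p. card {f\<in>Unhit s. Hit s f p}"
  have off: "x < n \<Longrightarrow> nmem s ''off'' x = x * n" for x using assms by (simp add: static_def)
  have c: "nmem (ev I ?c u) ''c'' 0 = nmem u ''c'' 0 + ?N (nmem u ''p'' 0)"
    if u: "nmem u ''off'' = nmem s ''off''" "nmem u ''un'' = nmem s ''un''" "nmem u ''hit'' = nmem s ''hit''" for u
  proof -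
    have "nmem (ev I ?c u) ''c'' 0 = nmem u ''c'' 0 +
        card {f. f < nval I u NPoints \<and> f \<in> Unhit s \<and> Hit s f (nmem u ''p'' 0)}"
    proof (rule ev_For_inv[where P = "\<lambda>i t. nmem t ''c'' 0 = nmem u ''c'' 0 +
        card {f. f < i \<and> f \<in> Unhit s \<and> Hit s f (nmem u ''p'' 0)}"], goal_cases)
      case (3 i t)
      have "{f. f < Suc i \<and> f \<in> Unhit s \<and> Hit s f (nmem u ''p'' 0)} =
          (if i \<in> Unhit s \<and> Hit s i (nmem u ''p'' 0)
           then insert i {f. f < i \<and> f \<in> Unhit s \<and> Hit s f (nmem u ''p'' 0)}
           else {f. f < i \<and> f \<in> Unhit s \<and> Hit s f (nmem u ''p'' 0)})"
        by (auto simp: less_Suc_eq)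
      then show ?case using 3 by (auto simp: u off Unhit_def Hit_def)
    qed simp_all
    moreover have "{f. f < n \<and> f \<in> Unhit s \<and> Hit s f (nmem u ''p'' 0)} = {f\<in>Unhit s. Hit s f (nmem u ''p'' 0)}"
      by (auto simp: Unhit_def)
    ultimately show ?thesis by simp
  qed
  let ?p = "PFor ''p'' NPoints (setn ''c'' (NConst 0);; ?c;;
       ifp (NLess (nv ''bc'') (nv ''c'')) (setn ''bc'' (nv ''c'');; setn ''bp'' (nv ''p'')))"
  have best: "nmem (ev I ?p u) ''bp'' 0 < n \<and> nmem (ev I ?p u) ''bc'' 0 \<le> ?N (nmem (ev I ?p u) ''bp'' 0) \<and>
      (\<forall>p<nval I u NPoints. ?N p \<le> nmem (ev I ?p u) ''bc'' 0)"
    if u: "nmem u ''bp'' 0 = 0" "nmem u ''bc'' 0 = 0" "nmem u ''off'' = nmem s ''off''"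
      "nmem u ''un'' = nmem s ''un''" "nmem u ''hit'' = nmem s ''hit''" for u
  proof (rule ev_For_inv[where P = "\<lambda>i t. nmem t ''bp'' 0 < n \<and> nmem t ''bc'' 0 \<le> ?N (nmem t ''bp'' 0) \<and>
      (\<forall>p<i. ?N p \<le> nmem t ''bc'' 0)"], goal_cases)
    case (3 i t)
    define v where "v = ev I ?c (nupdate ''c'' 0 0 t)"
    have "nmem v ''c'' 0 = ?N i" "nmem v ''bc'' = nmem t ''bc''" "nmem v ''bp'' = nmem t ''bp''"
        "nmem v ''p'' 0 = i"
      using c[of "nupdate ''c'' 0 0 t"] 3(3,4) u by (simp_all add: v_def nmem_ev)
    then show ?case using 3(1,2) by (auto simp: v_def[symmetric] less_Suc_eq)
  qed (simp_all add: assms u)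
  show "nmem (ev I best_prog s) ''bp'' 0 < n"
     "p < n \<Longrightarrow> ?N p \<le> ?N (nmem (ev I best_prog s) ''bp'' 0)"
    using best[of "nupdate ''bp'' 0 0 (nupdate ''bc'' 0 0 s)"]
    by (auto simp: best_prog_def intro: order_trans)
qed

lemma pick_spec:
  assumes "static s" "0 < n"
  shows "\<exists>p<n. nmem (ev I pick_prog s) ''T'' = (nmem s ''T'')(nmem s ''tc'' 0 := p) \<and>
     nmem (ev I pick_prog s) ''tc'' 0 = Suc (nmem s ''tc'' 0) \<and>
     Unhit (ev I pick_prog s) = Unhit s - {f. Hit s f p} \<and>
     (\<forall>x<n. rmem (ev I pick_prog s) ''w'' x = min (rmem s ''w'' x) (d x p)) \<and>
     (\<forall>q<n. card {f\<in>Unhit s. Hit s f q} \<le> card {f\<in>Unhit s. Hit s f p})"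
proof -
  let ?u = "PFor ''f'' NPoints (ifp (pos (hits (nv ''f'') (nv ''bp''))) (PN ''un'' (nv ''f'') (NConst 0)))"
  let ?w = "PFor ''x'' NPoints
       (ifp (RLess (RDist (nv ''x'') (nv ''bp'')) (RCell ''w'' (nv ''x'')))
         (PR ''w'' (nv ''x'') (RDist (nv ''x'') (nv ''bp''))))"
  have off: "x < n \<Longrightarrow> nmem s ''off'' x = x * n" for x using assms by (simp add: static_def)
  have u: "\<forall>f. nmem (ev I ?u t) ''un'' f =
      (if f < nval I t NPoints \<and> Hit s f (nmem t ''bp'' 0) then 0 else nmem t ''un'' f)"
    if t: "nmem t ''off'' = nmem s ''off''" "nmem t ''hit'' = nmem s ''hit''" for t
    by (rule ev_For_inv[where P = "\<lambda>i r. \<forall>f. nmem r ''un'' f =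
      (if f < i \<and> Hit s f (nmem t ''bp'' 0) then 0 else nmem t ''un'' f)"])
      (auto simp: t off Hit_def less_Suc_eq)
  have w: "\<forall>x. rmem (ev I ?w t) ''w'' x =
      (if x < nval I t NPoints then min (rmem t ''w'' x) (d x (nmem t ''bp'' 0)) else rmem t ''w'' x)" for t
    by (rule ev_For_inv[where P = "\<lambda>i r. \<forall>x. rmem r ''w'' x =
      (if x < i then min (rmem t ''w'' x) (d x (nmem t ''bp'' 0)) else rmem t ''w'' x)"])
      (auto simp: less_Suc_eq min_def)
  define b where "b = ev I best_prog s"
  define b' where "b' = nupdate ''tc'' 0 (nmem b ''tc'' 0 + 1) (nupdate ''T'' (nmem b ''tc'' 0) (nmem b ''bp'' 0) b)"
  have ev: "ev I pick_prog s = ev I ?w (ev I ?u b')" by (simp add: pick_prog_def b_def b'_def)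
  have fr: "nmem b ''off'' = nmem s ''off''" "nmem b ''hit'' = nmem s ''hit''" "nmem b ''un'' = nmem s ''un''"
    "nmem b ''tc'' = nmem s ''tc''" "nmem b ''T'' = nmem s ''T''" "rmem b ''w'' = rmem s ''w''"
    by (simp_all add: b_def nmem_ev rmem_ev)
  show ?thesis
  proof (intro exI[of _ "nmem b ''bp'' 0"] conjI)
    show "nmem b ''bp'' 0 < n" using best_spec(1)[OF assms] by (simp add: b_def)
    show "\<forall>q<n. card {f\<in>Unhit s. Hit s f q} \<le> card {f\<in>Unhit s. Hit s f (nmem b ''bp'' 0)}"
      using best_spec(2)[OF assms] by (simp add: b_def)
    have "nmem (ev I ?w (ev I ?u b')) ''un'' f =
        (if f < n \<and> Hit s f (nmem b ''bp'' 0) then 0 else nmem s ''un'' f)" for f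
      using u[of b'] by (simp add: nmem_ev b'_def fr)
    then show "Unhit (ev I pick_prog s) = Unhit s - {f. Hit s f (nmem b ''bp'' 0)}"
      unfolding ev by (auto simp: Unhit_def)
    show "\<forall>x<n. rmem (ev I pick_prog s) ''w'' x = min (rmem s ''w'' x) (d x (nmem b ''bp'' 0))"
      unfolding ev using w[of "ev I ?u b'"] by (simp add: nmem_ev rmem_ev b'_def fr)
  qed (simp_all add: ev nmem_ev b'_def fr)
qed

section \<open>Progress of the leader rounds\<close>

text \<open>Says that \<open>w\<close> is the minimum of \<open>D0\<close> and the distances to the
  listed points, as a lower bound together with attainment.\<close>

definition Winv :: "real \<Rightarrow> state \<Rightarrow> bool" where
  "Winv D0 t \<longleftrightarrow> (\<forall>e<nmem t ''tc'' 0. nmem t ''T'' e < n) \<and>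
     (\<forall>x<n. rmem t ''w'' x \<le> D0 \<and> (\<forall>e<nmem t ''tc'' 0. rmem t ''w'' x \<le> d x (nmem t ''T'' e)) \<and>
       (rmem t ''w'' x = D0 \<or> (\<exists>e<nmem t ''tc'' 0. rmem t ''w'' x = d x (nmem t ''T'' e))))"

lemma Winv_nonneg: "Winv D0 t \<Longrightarrow> 0 \<le> D0 \<Longrightarrow> x < n \<Longrightarrow> 0 \<le> rmem t ''w'' x"
  unfolding Winv_def using nonneg by metis

text \<open>A minimum of a constant and of distance functions is 1-Lipschitz.\<close>

lemma Winv_lipschitz:
  assumes "Winv D0 t" "x < n" "y < n"
  shows "rmem t ''w'' x \<le> rmem t ''w'' y + d x y"
proof (cases "rmem t ''w'' y = D0")
  case True
  have "rmem t ''w'' x \<le> D0" using assms(1,2) by (simp add: Winv_def)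
  then show ?thesis unfolding True using nonneg[of x y] by linarith
next
  case False
  then obtain e where e: "e < nmem t ''tc'' 0" "rmem t ''w'' y = d y (nmem t ''T'' e)"
    using assms(1,3) unfolding Winv_def by blast
  then have "rmem t ''w'' x \<le> d x (nmem t ''T'' e)" "nmem t ''T'' e < n"
    using assms(1,2) unfolding Winv_def by blast+
  then show ?thesis using triangle[of x y "nmem t ''T'' e"] e assms(2,3) by simp
qed

lemma Winv_pick:
  assumes "Winv D0 s" "p < n"
    and "nmem t ''T'' = (nmem s ''T'')(nmem s ''tc'' 0 := p)"
    and "nmem t ''tc'' 0 = Suc (nmem s ''tc'' 0)"
    and "\<forall>x<n. rmem t ''w'' x = min (rmem s ''w'' x) (d x p)"
  shows "Winv D0 t"
  unfolding Winv_def
proof (intro conjI allI impI)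
  fix e assume "e < nmem t ''tc'' 0"
  then show "nmem t ''T'' e < n" using assms by (auto simp: Winv_def less_Suc_eq)
next
  fix x assume x: "x < n"
  then have w: "rmem t ''w'' x = min (rmem s ''w'' x) (d x p)" using assms(5) by simp
  have W: "rmem s ''w'' x \<le> D0" "\<And>e. e < nmem s ''tc'' 0 \<Longrightarrow> rmem s ''w'' x \<le> d x (nmem s ''T'' e)"
    "rmem s ''w'' x = D0 \<or> (\<exists>e<nmem s ''tc'' 0. rmem s ''w'' x = d x (nmem s ''T'' e))"
    using assms(1) x by (auto simp: Winv_def)
  show "rmem t ''w'' x \<le> D0" using w W(1) by simp
  show "rmem t ''w'' x \<le> d x (nmem t ''T'' e)" if "e < nmem t ''tc'' 0" for e
    using that w W(2)[of e] assms(3,4) by (auto simp: less_Suc_eq)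
  show "rmem t ''w'' x = D0 \<or> (\<exists>e<nmem t ''tc'' 0. rmem t ''w'' x = d x (nmem t ''T'' e))"
  proof (cases "d x p \<le> rmem s ''w'' x")
    case True
    then have "rmem t ''w'' x = d x (nmem t ''T'' (nmem s ''tc'' 0))" using w assms(3) by simp
    then show ?thesis using assms(4) by auto
  next
    case False
    then have eq: "rmem t ''w'' x = rmem s ''w'' x" using w by simp
    show ?thesis
    proof (cases "rmem s ''w'' x = D0")
      case False
      then obtain e where "e < nmem s ''tc'' 0" "rmem s ''w'' x = d x (nmem s ''T'' e)" using W(3) by blast
      then have "e < nmem t ''tc'' 0" "rmem t ''w'' x = d x (nmem t ''T'' e)"
        using eq assms(3,4) by auto
      then show ?thesis by blast
    qed (use eq in simp)
  qed
qed

text \<open>The last claim concerns all points, because the optimal facilities are unknown. A point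
  leaves \<open>Unhit\<close> only when a listed point hits it, and as long as there is weight every
  pick removes the fraction \<open>1 / Q\<close> of \<open>Unhit\<close>, so after \<open>Z\<close>
  picks it is empty.\<close>

lemma round_spec:
  assumes s: "static s" and n0: "0 < n" and k1: "1 \<le> k" and W: "Winv D0 s" and D0: "0 \<le> D0"
  defines "s' \<equiv> ev I round_prog s"
  shows "Winv D0 s'" "nmem s' ''tc'' 0 = nmem s ''tc'' 0 + Z"
    and "x < n \<Longrightarrow> rmem s' ''w'' x \<le> rmem s ''w'' x"
    and "0 < sum (rmem s ''w'') C \<Longrightarrow> f < n \<Longrightarrow>
      \<exists>p<n. hit d C (rmem s ''w'') Q f p \<and> rmem s' ''w'' f \<le> d p f"
proof -
  define a where "a = ev I hit_prog (ev I weights_prog s)"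
  let ?p = "PFor ''q'' (nv ''Z'') pick_prog"
  let ?H = "hit d C (rmem s ''w'') Q"
  let ?r = "1 - 1 / real Q"
  have Q2: "2 \<le> Q"
  proof -
    have "9 * 10 * 1 \<le> m * (m + 1) * k" using m9 k1 by (intro mult_le_mono) auto
    then show ?thesis by (simp add: Q_def)
  qed
  have sw: "static (ev I weights_prog s)" by (rule static_ev[OF s]) simp_all
  have sa: "static a" unfolding a_def by (rule static_ev[OF sw]) simp_all
  have wa: "rmem a ''w'' = rmem s ''w''" "nmem a ''tc'' = nmem s ''tc''" "nmem a ''T'' = nmem s ''T''"
    by (simp_all add: a_def nmem_ev rmem_ev)
  have Wa: "Winv D0 a" using W by (simp add: Winv_def wa)
  have H: "Hit a f p \<longleftrightarrow> ?H f p" if "f < n" "p < n" for f p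
  proof -
    have "sum (rmem (ev I weights_prog s) ''wq'') {j\<in>C. d j f < d p f}
        = (\<Sum>j\<in>{j\<in>C. d j f < d p f}. real Q * rmem s ''w'' j)"
      by (intro sum.cong refl weights_spec(1)[OF s]) (auto dest: client_less)
    then show ?thesis
      unfolding a_def hit_spec(2)[OF sw that] hit_def weights_spec(2)[OF s]
      by (simp add: sum_distrib_left)
  qed
  have Ua: "Unhit a = {..<n}"
    using hit_spec(1)[OF sw] by (auto simp: Unhit_def a_def)
  have Zs: "nmem a ''Z'' 0 = Z" using sa by (simp add: static_def)
  let ?P = "\<lambda>q t. Winv D0 t \<and> nmem t ''tc'' 0 = nmem s ''tc'' 0 + q \<and>
      (\<forall>x<n. rmem t ''w'' x \<le> rmem s ''w'' x) \<and>
      (\<forall>f<n. f \<in> Unhit t \<or> (\<exists>p<n. ?H f p \<and> rmem t ''w'' f \<le> d p f)) \<and>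
      (0 < sum (rmem s ''w'') C \<longrightarrow> real (card (Unhit t)) \<le> real n * ?r ^ q)"
  have P: "?P (nval I a (nv ''Z'')) (ev I ?p a)"
  proof (rule ev_For_inv[where P = ?P], goal_cases)
    case 1
    show ?case by simp
  next
    case 2
    show ?case using Wa Ua by (simp add: Winv_def wa Unhit_def)
  next
    case (3 i t)
    have st: "static t" using sa 3(4,5) by (simp add: static_def)
    have Ht: "Hit t f p \<longleftrightarrow> ?H f p" if "f < n" "p < n" for f p
      using H[OF that] 3(4) by (simp add: Hit_def)
    obtain p where p: "p < n" "nmem (ev I pick_prog t) ''T'' = (nmem t ''T'')(nmem t ''tc'' 0 := p)"
     "nmem (ev I pick_prog t) ''tc'' 0 = Suc (nmem t ''tc'' 0)"
     "Unhit (ev I pick_prog t) = Unhit t - {f. Hit t f p}"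
     "\<forall>x<n. rmem (ev I pick_prog t) ''w'' x = min (rmem t ''w'' x) (d x p)"
     "\<forall>q<n. card {f\<in>Unhit t. Hit t f q} \<le> card {f\<in>Unhit t. Hit t f p}"
      using pick_spec[OF st n0] by blast
    have "Winv D0 (ev I pick_prog t)" by (rule Winv_pick[OF _ p(1-3,5)]) (use 3(2) in blast)
    moreover have "\<forall>f<n. f \<in> Unhit (ev I pick_prog t) \<or>
        (\<exists>p<n. ?H f p \<and> rmem (ev I pick_prog t) ''w'' f \<le> d p f)"
    proof (intro allI impI)
      fix f assume f: "f < n"
      show "f \<in> Unhit (ev I pick_prog t) \<or> (\<exists>p<n. ?H f p \<and> rmem (ev I pick_prog t) ''w'' f \<le> d p f)"
      proof (cases "f \<in> Unhit t")
        case True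
        show ?thesis
        proof (cases "Hit t f p")
          case True
          then have "?H f p" using Ht[OF f p(1)] by simp
          moreover have "rmem (ev I pick_prog t) ''w'' f \<le> d p f" using p(5) f commute[of f p] by simp
          ultimately show ?thesis using p(1) by blast
        qed (use True p(4) in blast)
      next
        case False
        then obtain q where "q < n" "?H f q" "rmem t ''w'' f \<le> d q f" using 3(2) f by blast
        moreover have "rmem (ev I pick_prog t) ''w'' f \<le> rmem t ''w'' f" using p(5) f by simp
        ultimately show ?thesis by (meson order_trans)
      qed
    qed
    moreover have "real (card (Unhit (ev I pick_prog t))) \<le> real n * ?r ^ Suc i"
      if pos: "0 < sum (rmem s ''w'') C"
    proof -
      have fin: "finite (Unhit t)" "\<And>f. f \<in> Unhit t \<Longrightarrow> f < n" by (auto simp: Unhit_def)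
      \<comment> \<open>\<open>frequent_hit\<close> yields some client \<open>q\<close> that hits
        enough of the remaining points; the pick \<open>p\<close> hits at least as many as any
        point.\<close>
      obtain q where q: "q \<in> C" "card (Unhit t) \<le> Q * card {f\<in>Unhit t. ?H f q}"
        using frequent_hit[OF fin_C, of "rmem s ''w''" Q "Unhit t" d] Winv_nonneg[OF W D0] client_less Q2 pos fin(1)
        by auto
      have "{f\<in>Unhit t. ?H f q} = {f\<in>Unhit t. Hit t f q}"
        using Ht fin(2) client_less[OF q(1)] by auto
      then have "card {f\<in>Unhit t. ?H f q} \<le> card {f\<in>Unhit t. Hit t f p}"
        using p(6) client_less[OF q(1)] by simp
      then have le: "card (Unhit t) \<le> Q * card {f\<in>Unhit t. Hit t f p}"
        using q(2) by (meson mult_le_mono2 order_trans)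
      have "Unhit (ev I pick_prog t) = Unhit t - {f\<in>Unhit t. Hit t f p}" using p(4) by blast
      then have "card (Unhit (ev I pick_prog t)) = card (Unhit t) - card {f\<in>Unhit t. Hit t f p}"
        using fin(1) by (simp add: card_Diff_subset)
      then show ?thesis
        using shrinking_step[OF Q2 le, of "real n * ?r ^ i"] 3(2) pos by (simp add: mult_ac)
    qed
    moreover have "\<forall>x<n. rmem (ev I pick_prog t) ''w'' x \<le> rmem s ''w'' x"
    proof (intro allI impI)
      fix x assume "x < n"
      then have "rmem (ev I pick_prog t) ''w'' x \<le> rmem t ''w'' x" "rmem t ''w'' x \<le> rmem s ''w'' x"
        using p(5) 3(2) by auto
      then show "rmem (ev I pick_prog t) ''w'' x \<le> rmem s ''w'' x" by linarith
    qed
    moreover have "nmem (ev I pick_prog t) ''tc'' 0 = nmem s ''tc'' 0 + Suc i"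
      using p(3) 3(2) by simp
    moreover have "?P j (nupdate ''q'' 0 j u) \<longleftrightarrow> ?P j u" for j u
      by (simp add: Winv_def Unhit_def)
    ultimately show ?case by blast
  qed
  have s': "s' = ev I ?p a" by (simp add: s'_def round_prog_def a_def)
  show "Winv D0 s'" "nmem s' ''tc'' 0 = nmem s ''tc'' 0 + Z"
    "x < n \<Longrightarrow> rmem s' ''w'' x \<le> rmem s ''w'' x"
    using P Zs unfolding s' by auto
  assume pos: "0 < sum (rmem s ''w'') C" and f: "f < n"
  have "real (card (Unhit s')) < 1"
    using P pos Zs shrinking_vanishes[OF Q2 lg1 n_le] unfolding s' by (simp add: Z_def)
  then have "Unhit s' = {}" by (simp add: Unhit_def)
  then show "\<exists>p<n. hit d C (rmem s ''w'') Q f p \<and> rmem s' ''w'' f \<le> d p f"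
    using P f unfolding s' by blast
qed


text \<open>By the triangle inequality the weight of a client is at most its connection distance
  plus the weight of its facility. With the cluster bound, a round thus turns total weight
  \<open>W\<close> into at most \<open>opt + (1 + 1 / m) * opt + W / m\<close>, which is below
  \<open>3 * opt + W / 2\<close>. The fixed point is \<open>6 * opt\<close>, and \<open>V r\<close>
  bounds the weight after \<open>r\<close> rounds. When the last round starts, the excess is at most
  \<open>opt\<close>, whence the 7.\<close>

lemma leaders_spec:
  fixes \<pi> :: "nat \<Rightarrow> nat"
  assumes s: "static s" and k1: "1 \<le> k"
    and uv: "nmem s ''u'' 0 < n" "nmem s ''v'' 0 < n" and D: "D = d (nmem s ''u'' 0) (nmem s ''v'' 0)" "0 < D"
    and \<pi>: "\<And>j. j \<in> C \<Longrightarrow> \<pi> j < n" "\<And>j. j \<in> C \<Longrightarrow> d j (\<pi> j) \<le> D" "card (\<pi> ` C) \<le> k"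
    and opt: "opt = (\<Sum>j\<in>C. d j (\<pi> j))" "D \<le> opt"
    and f: "f \<in> \<pi> ` C"
  shows "\<exists>e<Y. nmem (ev I leaders_prog s) ''T'' e < n \<and>
      real (card {j\<in>C. \<pi> j = f}) * d (nmem (ev I leaders_prog s) ''T'' e) f
        \<le> (1 + 1 / real m) * (\<Sum>j\<in>{j\<in>C. \<pi> j = f}. d j f) + 7 * opt / (real m * real k) \<and>
      d (nmem (ev I leaders_prog s) ''T'' e) f \<le> real (n * m) * D"
proof -
  let ?B = "\<lambda>f. {j\<in>C. \<pi> j = f}"
  let ?c = "\<lambda>f. \<Sum>j\<in>?B f. d j f"
  let ?init = "PFor ''x'' NPoints (PR ''w'' (nv ''x'') (sdist (nv ''u'') (nv ''v'')))"
  let ?rounds = "PFor ''r'' (nv ''Z'') round_prog"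
  define D0 where "D0 = real (n * m) * D"
  define W0 where "W0 = real n * D0"
  define V where "V r = 6 * opt + W0 / 2 ^ r" for r :: nat
  have n0: "0 < n" using uv by simp
  have m0: "0 < real m" "0 < real k" using m9 k1 by auto
  have Qk: "real Q = real (m + 1) * (real m * real k)" by (simp add: Q_def)
  have "1 * 1 * 1 \<le> m * (m + 1) * k" using m9 k1 by (intro mult_le_mono) auto
  then have Q0: "1 \<le> Q" by (simp add: Q_def)
  have D00: "0 \<le> D0" using D n0 by (simp add: D0_def)
  have opt0: "0 \<le> opt" using D opt by simp
  have V0: "0 \<le> V r" for r using opt0 D00 by (simp add: V_def W0_def)
  have init: "\<forall>x<nval I s NPoints. rmem (ev I ?init s) ''w'' x = D0"
  proof (rule ev_For_inv[where P = "\<lambda>i t. \<forall>x<i. rmem t ''w'' x = D0"], goal_cases)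
    case (3 i t)
    have "rmem t ''sd'' (nmem t ''off'' (nmem t ''u'' 0) + nmem t ''v'' 0) = D0"
      using 3(4,5) s uv by (simp add: static_def sd_def D0_def D)
    then show ?case using 3(2,3) by (simp add: less_Suc_eq)
  qed simp_all
  define a where "a = nupdate ''tc'' 0 0 (ev I ?init s)"
  have sa: "static a" unfolding a_def using static_ev[OF s, of ?init] by (simp add: static_def)
  have Wa: "Winv D0 a" "sum (rmem a ''w'') C \<le> V 0" "nmem a ''tc'' 0 = 0"
  proof -
    have w: "rmem a ''w'' x = D0" if "x < n" for x using init that by (simp add: a_def)
    show "Winv D0 a" "nmem a ''tc'' 0 = 0" using w by (simp_all add: Winv_def a_def)
    have "sum (rmem a ''w'') C = real (card C) * D0" using w client_less by simp
    also have "\<dots> \<le> W0" unfolding W0_def using card_mono[OF _ C_sub] D00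
      by (intro mult_right_mono) auto
    finally show "sum (rmem a ''w'') C \<le> V 0" using opt0 by (simp add: V_def)
  qed
  have Zs: "nmem a ''Z'' 0 = Z" using sa by (simp add: static_def)
  let ?near = "\<lambda>t v. \<forall>f\<in>\<pi> ` C. real (card (?B f)) * rmem t ''w'' f
      \<le> (1 + 1 / real m) * ?c f + v / (real m * real k)"
  let ?P = "\<lambda>r t. Winv D0 t \<and> nmem t ''tc'' 0 = r * Z \<and> sum (rmem t ''w'') C \<le> V r \<and>
      (1 \<le> r \<longrightarrow> ?near t (V (r - 1)))"
  have P: "?P (nval I a (nv ''Z'')) (ev I ?rounds a)"
  proof (rule ev_For_inv[where P = ?P], goal_cases)
    case 1
    show ?case by simp
  next
    case 2
    show ?case using Wa by (simp add: Winv_def)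
  next
    case (3 i t)
    define t' where "t' = ev I round_prog t"
    have st: "static t" using sa 3(4,5) by (simp add: static_def)
    have Wt: "Winv D0 t" and Vt: "sum (rmem t ''w'') C \<le> V i" using 3(2) by auto
    note rs = round_spec[OF st n0 k1 Wt D00, folded t'_def]
    have near: "?near t' (V i)"
    proof
      fix f assume f: "f \<in> \<pi> ` C"
      then have fn: "f < n" using \<pi>(1) by auto
      have "real (card (?B f)) * rmem t' ''w'' f
          \<le> (1 + 1 / real m) * ?c f + real (m + 1) * sum (rmem t ''w'') C / real Q"
      proof (rule cluster_distance_bound[where d = d and w = "rmem t ''w''"])
        show "0 \<le> rmem t ''w'' j" if "j \<in> C" for j using Winv_nonneg[OF Wt D00] client_less that by simp
        show "rmem t ''w'' f \<le> rmem t ''w'' j + d j f" if "j \<in> ?B f" for j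
          using Winv_lipschitz[OF Wt fn, of j] that client_less commute[of f j] by auto
        show "rmem t' ''w'' f \<le> rmem t ''w'' f" by (rule rs(3)[OF fn])
        show "\<exists>p. hit d C (rmem t ''w'') Q f p \<and> rmem t' ''w'' f \<le> d p f" if "0 < sum (rmem t ''w'') C"
          using rs(4)[OF that fn] by blast
      qed (use fin_C m9 Q0 in auto)
      also have "real (m + 1) * sum (rmem t ''w'') C / real Q = sum (rmem t ''w'') C / (real m * real k)"
        unfolding Qk by (rule mult_divide_mult_cancel_left) simp
      also have "\<dots> \<le> V i / (real m * real k)" using Vt m0 by (intro divide_right_mono) auto
      finally show "real (card (?B f)) * rmem t' ''w'' f \<le> (1 + 1 / real m) * ?c f + V i / (real m * real k)"
        by simp
    qed
    have W': "Winv D0 t'" by (rule rs(1))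
    have "sum (rmem t' ''w'') C \<le> (\<Sum>j\<in>C. d j (\<pi> j) + rmem t' ''w'' (\<pi> j))"
    proof (rule sum_mono)
      fix j assume "j \<in> C"
      then show "rmem t' ''w'' j \<le> d j (\<pi> j) + rmem t' ''w'' (\<pi> j)"
        using Winv_lipschitz[OF W', of j "\<pi> j"] client_less \<pi>(1) by simp
    qed
    also have "\<dots> = opt + (\<Sum>f\<in>\<pi> ` C. real (card (?B f)) * rmem t' ''w'' f)"
      by (simp add: sum.distrib opt sum_over_fibres[OF fin_C])
    also have "\<dots> \<le> opt + (\<Sum>f\<in>\<pi> ` C. (1 + 1 / real m) * ?c f + V i / (real m * real k))"
      using near by (intro add_left_mono sum_mono) auto
    also have "\<dots> = opt + (1 + 1 / real m) * (\<Sum>f\<in>\<pi> ` C. ?c f) + real (card (\<pi> ` C)) * (V i / (real m * real k))"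
      by (simp add: sum.distrib sum_distrib_left)
    also have "(\<Sum>f\<in>\<pi> ` C. ?c f) = opt"
    proof -
      have "opt = (\<Sum>f\<in>\<pi> ` C. \<Sum>j\<in>?B f. d j (\<pi> j))"
        unfolding opt(1) by (rule sum.image_gen[OF fin_C])
      also have "\<dots> = (\<Sum>f\<in>\<pi> ` C. ?c f)" by (intro sum.cong refl) auto
      finally show ?thesis by simp
    qed
    also have "opt + (1 + 1 / real m) * opt + real (card (\<pi> ` C)) * (V i / (real m * real k)) \<le> opt + 2 * opt + V i / 2"
    proof (intro add_mono order_refl)
      have "1 / real m \<le> 1" using m9 by simp
      then show "(1 + 1 / real m) * opt \<le> 2 * opt" using opt0 by (intro mult_right_mono) auto
      have "real (card (\<pi> ` C)) * (V i / (real m * real k)) \<le> real k * (V i / (real m * real k))"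
        using \<pi>(3) V0 m0 by (intro mult_right_mono) auto
      also have "\<dots> = V i / real m" using m0 by simp
      also have "\<dots> \<le> V i / 2" using V0 m9 by (intro divide_left_mono) auto
      finally show "real (card (\<pi> ` C)) * (V i / (real m * real k)) \<le> V i / 2" .
    qed
    also have "\<dots> = V (Suc i)" by (simp add: V_def field_simps)
    finally have sum': "sum (rmem t' ''w'') C \<le> V (Suc i)" .
    have tc: "nmem t' ''tc'' 0 = Suc i * Z" using rs(2) 3(2) by simp
    have "?P j (nupdate ''r'' 0 j u) \<longleftrightarrow> ?P j u" for j u by (simp add: Winv_def)
    moreover have "?P (Suc i) t'" using W' sum' tc near by simp
    ultimately show ?case unfolding t'_def by blast
  qed
  define z where "z = ev I leaders_prog s"
  have z: "z = ev I ?rounds a" by (simp add: z_def leaders_prog_def a_def)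
  have Z1: "1 \<le> Z" using mult_le_mono[OF Q0 lg1] by (simp add: Z_def)
  have Pz: "Winv D0 z" "nmem z ''tc'' 0 = Z * Z" "?near z (V (Z - 1))"
    using P Z1 unfolding z by (simp_all add: Zs)
  \<comment> \<open>The bound established by a round refers to the weight at its start, so
    \<open>Z - 1\<close> halvings must suffice. They do, because \<open>W0\<close> is
    \<open>m * n * n * D\<close>, \<open>D\<close> is at most \<open>opt\<close>, and
    \<open>m * n * n\<close> is at most \<open>2 ^ (Z - 1)\<close>.\<close>
  have "V (Z - 1) \<le> 7 * opt"
  proof -
    have "m * lg + 2 * lg \<le> Q * lg"
    proof -
      have "m + 2 \<le> m * (m + 1)" using m9 by (cases m) auto
      also have "\<dots> \<le> Q" using k1 by (simp add: Q_def)
      finally have "(m + 2) * lg \<le> Q * lg" by (rule mult_le_mono1)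
      then show ?thesis by (simp add: algebra_simps)
    qed
    moreover have "m \<le> m * lg" using lg1 by simp
    ultimately have e: "m + (lg - 1) + (lg - 1) \<le> Z - 1" using lg1 unfolding Z_def by linarith
    have "real m * real n * real n \<le> 2 ^ m * 2 ^ (lg - 1) * 2 ^ (lg - 1)"
      by (intro mult_mono n_le_real m_le_real) auto
    also have "\<dots> = 2 ^ (m + (lg - 1) + (lg - 1))" by (simp add: power_add)
    also have "\<dots> \<le> (2::real) ^ (Z - 1)" using e by (intro power_increasing) auto
    finally have "real m * real n * real n * D \<le> 2 ^ (Z - 1) * opt"
      using D opt by (intro mult_mono) auto
    then have "W0 / 2 ^ (Z - 1) \<le> opt" by (simp add: W0_def D0_def field_simps)
    then show ?thesis by (simp add: V_def)
  qed
  then have mono: "V (Z - 1) / (real m * real k) \<le> 7 * opt / (real m * real k)"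
    using m0 by (intro divide_right_mono) auto
  have near: "real (card (?B f)) * rmem z ''w'' f \<le> (1 + 1 / real m) * ?c f + 7 * opt / (real m * real k)"
    using Pz(3) f mono by fastforce
  have fn: "f < n" using f \<pi>(1) by auto
  \<comment> \<open>The weight of \<open>f\<close> must come from a listed point and not from
    truncation. The weight \<open>D0\<close>, times the cluster size \<open>s\<close>, would be
    \<open>s * n * m * D\<close>, whereas the bound allows at most \<open>2 * s * D + n * D\<close>,
    since no connection is longer than \<open>D\<close>.\<close>
  have "rmem z ''w'' f \<noteq> D0"
  proof
    assume eq: "rmem z ''w'' f = D0"
    let ?s = "real (card (?B f))"
    have s1: "1 \<le> ?s"
    proof -
      have "?B f \<noteq> {}" using f by auto
      then have "0 < card (?B f)" using fin_C by (simp add: card_gt_0_iff)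
      then show ?thesis by simp
    qed
    have "?c f \<le> (\<Sum>j\<in>?B f. D)" by (rule sum_mono) (use \<pi>(2) in auto)
    then have c: "?c f \<le> ?s * D" by simp
    have "opt \<le> (\<Sum>j\<in>C. D)" unfolding opt(1) by (rule sum_mono) (use \<pi>(2) in auto)
    also have "\<dots> \<le> real n * D" using card_mono[OF _ C_sub] D by (simp add: mult_right_mono)
    finally have on: "opt \<le> real n * D" .
    have "?s * D0 \<le> (1 + 1 / real m) * ?c f + 7 * opt / (real m * real k)"
      using near unfolding eq .
    also have "\<dots> \<le> 2 * (?s * D) + real n * D"
    proof (rule add_mono)
      have "1 / real m \<le> 1" using m9 by simp
      moreover have "0 \<le> ?c f" by (intro sum_nonneg nonneg)
      ultimately have "(1 + 1 / real m) * ?c f \<le> 2 * ?c f" by (intro mult_right_mono) auto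
      then show "(1 + 1 / real m) * ?c f \<le> 2 * (?s * D)" using c by linarith
      have "7 * 1 \<le> real m * real k" using m9 k1 by (intro mult_mono) auto
      then have "7 * opt / (real m * real k) \<le> 7 * opt / 7" using opt0 by (intro divide_left_mono) auto
      then show "7 * opt / (real m * real k) \<le> real n * D" using on by simp
    qed
    also have "\<dots> \<le> 2 * (?s * (real n * D)) + ?s * (real n * D)"
    proof (rule add_mono)
      have "1 * D \<le> real n * D" using n0 D by (intro mult_right_mono) auto
      then show "2 * (?s * D) \<le> 2 * (?s * (real n * D))" by (simp add: mult_left_mono)
      have "1 * (real n * D) \<le> ?s * (real n * D)" using s1 D by (intro mult_right_mono) auto
      then show "real n * D \<le> ?s * (real n * D)" by simp
    qed
    also have "\<dots> = 3 * (?s * (real n * D))" by simp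
    also have "\<dots> < real m * (?s * (real n * D))"
      using m9 s1 n0 D by (intro mult_strict_right_mono) auto
    also have "\<dots> = ?s * D0" by (simp add: D0_def)
    finally show False by simp
  qed
  then obtain e where e: "e < Z * Z" "rmem z ''w'' f = d f (nmem z ''T'' e)" "nmem z ''T'' e < n"
    using Pz(1,2) fn unfolding Winv_def by metis
  have "rmem z ''w'' f \<le> D0" using Pz(1) fn by (simp add: Winv_def)
  then show ?thesis
    using e near unfolding z_def[symmetric] Y_def
    by (intro exI[of _ e]) (simp add: D0_def commute[of f])
qed

lemma grid_spec:
  assumes s: "static s" and D: "D = d (nmem s ''u'' 0) (nmem s ''v'' 0)"
  shows "e < Y \<Longrightarrow> rmem (ev I grid_prog s) ''gr'' e =
      (if e < m then real (e + 1) * D else 2 * rmem (ev I grid_prog s) ''gr'' (e - m))"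
proof -
  let ?p = "PFor ''e'' (nv ''Y'') (incr ''acc'' (RDist (nv ''u'') (nv ''v''));;
       PIf (NLess (nv ''e'') (nv ''m'')) (PR ''gr'' (nv ''e'') (rv ''acc''))
         (PR ''gr'' (nv ''e'') (RAdd (RCell ''gr'' (NSub (nv ''e'') (nv ''m'')))
                                     (RCell ''gr'' (NSub (nv ''e'') (nv ''m''))))))"
  let ?a = "rupdate ''acc'' 0 0 s"
  have m: "nmem s ''m'' 0 = m" "nmem s ''Y'' 0 = Y" using s by (simp_all add: static_def)
  have "rmem (ev I ?p ?a) ''acc'' 0 = real (nval I ?a (nv ''Y'')) * D \<and>
     (\<forall>e<nval I ?a (nv ''Y''). rmem (ev I ?p ?a) ''gr'' e =
        (if e < m then real (e + 1) * D else 2 * rmem (ev I ?p ?a) ''gr'' (e - m)))"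
  proof (rule ev_For_inv[where P = "\<lambda>i t. rmem t ''acc'' 0 = real i * D \<and>
     (\<forall>e<i. rmem t ''gr'' e = (if e < m then real (e + 1) * D else 2 * rmem t ''gr'' (e - m)))"], goal_cases)
    case (3 i t)
    let ?t' = "nupdate ''e'' 0 (Suc i) (ev I (incr ''acc'' (RDist (nv ''u'') (nv ''v''));;
       PIf (NLess (nv ''e'') (nv ''m'')) (PR ''gr'' (nv ''e'') (rv ''acc''))
         (PR ''gr'' (nv ''e'') (RAdd (RCell ''gr'' (NSub (nv ''e'') (nv ''m'')))
                                     (RCell ''gr'' (NSub (nv ''e'') (nv ''m'')))))) t)"
    have "nmem t ''u'' 0 = nmem s ''u'' 0" "nmem t ''v'' 0 = nmem s ''v'' 0" "nmem t ''m'' 0 = m"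
      using 3(4) m by simp_all
    then have acc: "rmem ?t' ''acc'' 0 = real (Suc i) * D"
      and gr: "rmem ?t' ''gr'' = (rmem t ''gr'')(i := if i < m then real (i + 1) * D else 2 * rmem t ''gr'' (i - m))"
      using 3(2,3) by (auto simp: D algebra_simps)
    show ?case
    proof (intro conjI allI impI)
      fix e assume "e < Suc i"
      then consider "e = i" | "e < i" by linarith
      then show "rmem ?t' ''gr'' e = (if e < m then real (e + 1) * D else 2 * rmem ?t' ''gr'' (e - m))"
      proof cases
        case 1
        moreover have "\<not> i < m \<Longrightarrow> i - m \<noteq> i" using m9 by linarith
        ultimately show ?thesis unfolding gr by simp
      next
        case 2
        then have "e - m \<noteq> i" "e \<noteq> i" by linarith+
        then show ?thesis unfolding gr using 3(2)[THEN conjunct2, rule_format, OF 2] by simp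
      qed
    qed (rule acc)
  qed simp_all
  from this[THEN conjunct2] have "\<forall>e<Y. rmem (ev I ?p ?a) ''gr'' e =
        (if e < m then real (e + 1) * D else 2 * rmem (ev I ?p ?a) ''gr'' (e - m))"
    by (simp only: nval.simps nmem_rupdate m)
  moreover have "ev I grid_prog s = ev I ?p ?a" by (simp add: grid_prog_def)
  ultimately show "rmem (ev I grid_prog s) ''gr'' e =
      (if e < m then real (e + 1) * D else 2 * rmem (ev I grid_prog s) ''gr'' (e - m))" if "e < Y"
    using that by presburger
qed

section \<open>Replacing the optimal facilities greedily\<close>

sublocale matroid "facilities I" "independent I"
  using inst by (simp add: mm_instance_def)

lemma indep_less: "independent I S \<Longrightarrow> x \<in> S \<Longrightarrow> x < n"
  using inst indep_subset_ground[of S] by (auto simp: mm_instance_def)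

lemma card_indep_le: "independent I S \<Longrightarrow> card S \<le> k"
  unfolding mm_rank_def by (rule card_le_rank)

definition cands :: "nat set \<Rightarrow> nat set \<Rightarrow> nat set" where
  "cands B A = {f\<in>B. f \<notin> A \<and> independent I (insert f A)}"

text \<open>\<open>LEAST\<close> fixes one minimizer, the one that the scan in increasing order
  finds, so that the runs of the program are determined by the digits.\<close>

definition best :: "(nat \<Rightarrow> real) \<Rightarrow> nat set \<Rightarrow> nat" where
  "best v K = (LEAST f. f \<in> K \<and> (\<forall>f'\<in>K. v f \<le> v f'))"

primrec gset :: "(nat \<Rightarrow> real) \<Rightarrow> nat set \<Rightarrow> nat \<Rightarrow> nat set" where
  "gset v B 0 = {}"
| "gset v B (Suc t) = (if cands B (gset v B t) = {} then gset v B t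
     else insert (best v (cands B (gset v B t))) (gset v B t))"

text \<open>Position 0 is the non-facility \<open>n\<close>. Once the greedy set has stopped
  growing, the last pick is repeated.\<close>

primrec gpick :: "(nat \<Rightarrow> real) \<Rightarrow> nat set \<Rightarrow> nat \<Rightarrow> nat" where
  "gpick v B 0 = n"
| "gpick v B (Suc t) = (if cands B (gset v B t) = {} then gpick v B t else best v (cands B (gset v B t)))"

lemma cands_finite: "finite (cands B A)"
  by (rule finite_subset[of _ "{..<n}"]) (auto simp: cands_def dest: indep_less)

lemma best_minimal:
  assumes "cands B A \<noteq> {}"
  shows "best v (cands B A) \<in> cands B A" and "f \<in> cands B A \<Longrightarrow> v (best v (cands B A)) \<le> v f"
proof -
  obtain f where "is_arg_min v (\<lambda>f. f \<in> cands B A) f"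
    using ex_is_arg_min_if_finite[OF cands_finite assms] by blast
  then have f: "f \<in> cands B A \<and> (\<forall>f'\<in>cands B A. v f \<le> v f')"
    by (simp add: is_arg_min_linorder)
  show "best v (cands B A) \<in> cands B A" "f \<in> cands B A \<Longrightarrow> v (best v (cands B A)) \<le> v f" for f
    using LeastI[of "\<lambda>f. f \<in> cands B A \<and> (\<forall>f'\<in>cands B A. v f \<le> v f')", OF f]
    unfolding best_def by blast+
qed

lemma gset_indep: "independent I (gset v B t)"
proof (induction t)
  case 0
  show ?case using indep_empty by simp
next
  case (Suc t)
  then show ?case using best_minimal(1)[of B "gset v B t" v] by (auto simp: cands_def)
qed

text \<open>The greedy set spans everything it has passed by. If all of its elements chosen while \<open>x\<close> was
  available were spanned by \<open>X\<close>, then so would be \<open>x\<close>.\<close>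

lemma gpick_exchange:
  assumes x: "x \<in> B" "x \<notin> X" "independent I (insert x X)"
  shows "\<exists>c\<le>k. gpick v B c \<in> B \<and> gpick v B c \<notin> X \<and> independent I (insert (gpick v B c) X) \<and>
    v (gpick v B c) \<le> v x"
proof -
  let ?av = "\<lambda>t. x \<in> cands B (gset v B t)"
  have card: "card (gset v B t) = t" if "\<forall>t'<t. ?av t'" for t
    using that
  proof (induction t)
    case (Suc t)
    then have "cands B (gset v B t) \<noteq> {}" by auto
    moreover from this have "best v (cands B (gset v B t)) \<notin> gset v B t"
      using best_minimal(1) by (auto simp: cands_def)
    ultimately show ?case using Suc indep_finite[OF gset_indep[of v B t]] by simp
  qed simp
  have "\<exists>t. \<not> ?av t"
  proof (rule ccontr)
    assume "\<not> ?thesis"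
    then show False using card[of "Suc k"] card_indep_le[OF gset_indep[of v B "Suc k"]] by simp
  qed
  \<comment> \<open>At the first step \<open>c\<close> where \<open>x\<close> is no longer a
    candidate, it either belongs to the greedy set or is spanned by it, which is the hypothesis of
    \<open>span_exchange\<close>.\<close>
  then obtain c where c: "\<not> ?av c" "\<forall>t<c. ?av t"
    using exists_least_iff[of "\<lambda>t. \<not> ?av t"] by blast
  have ck: "c \<le> k" using card[OF c(2)] card_indep_le[OF gset_indep[of v B c]] by simp
  have sub: "gset v B t \<subseteq> gpick v B ` {1..t}" if "t \<le> c" for t
    using that
  proof (induction t)
    case (Suc t)
    then have "?av t" using c(2) Suc_le_eq by blast
    then have "cands B (gset v B t) \<noteq> {}" by blast
    then have "gset v B (Suc t) = insert (gpick v B (Suc t)) (gset v B t)" by simp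
    moreover have "{1..Suc t} = insert (Suc t) {1..t}" by auto
    ultimately show ?case using Suc by auto
  qed simp
  obtain a where a: "a \<in> gset v B c - X" "independent I (insert a X)"
    using span_exchange[OF gset_indep[of v B c] x(3,2)] c(1) x(1) by (auto simp: cands_def)
  then obtain t where t: "t \<in> {1..c}" "a = gpick v B t" using sub[of c] by blast
  then obtain t' where t': "t = Suc t'" "t' < c" by (cases t) auto
  \<comment> \<open>When \<open>a\<close> was picked, \<open>x\<close> was still available, so
    \<open>a\<close> is at least as good.\<close>
  then have ne: "cands B (gset v B t') \<noteq> {}" and av: "?av t'" using c(2) by auto
  have eq: "a = best v (cands B (gset v B t'))" using t t' ne by simp
  have "a \<in> B" "v a \<le> v x"
    using best_minimal(1)[OF ne, of v] best_minimal(2)[OF ne av, of v] unfolding eq by (auto simp: cands_def)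
  then show ?thesis using a t t' ck by (intro exI[of _ t]) auto
qed

section \<open>Runs determined by a word of choices\<close>

definition trunc_cost :: "(nat \<Rightarrow> real) \<Rightarrow> nat \<Rightarrow> real" where
  "trunc_cost cur f = (\<Sum>j\<in>C. min (cur j) (sd j f))"

definition ball :: "nat \<Rightarrow> real \<Rightarrow> nat set" where
  "ball p r = {f. f < n \<and> sd p f \<le> r}"

definition choice_of :: "(nat \<Rightarrow> real) \<Rightarrow> nat \<Rightarrow> real \<Rightarrow> nat \<Rightarrow> nat" where
  "choice_of cur p r c = gpick (trunc_cost cur) (ball p r) c"

primrec curs :: "(nat \<Rightarrow> real) \<Rightarrow> (nat \<Rightarrow> nat) \<Rightarrow> (nat \<Rightarrow> real) \<Rightarrow> (nat \<Rightarrow> nat) \<Rightarrow> nat \<Rightarrow> nat \<Rightarrow> real" where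
  "curs cur p r c 0 = cur"
| "curs cur p r c (Suc i) = (let g = choice_of (curs cur p r c i) (p i) (r i) (c i) in
     if g < n then (\<lambda>x. min (curs cur p r c i x) (sd x g)) else curs cur p r c i)"

definition opened :: "(nat \<Rightarrow> real) \<Rightarrow> (nat \<Rightarrow> nat) \<Rightarrow> (nat \<Rightarrow> real) \<Rightarrow> (nat \<Rightarrow> nat) \<Rightarrow> nat \<Rightarrow> nat set" where
  "opened cur p r c i = {g. g < n \<and> (\<exists>i'<i. g = choice_of (curs cur p r c i') (p i') (r i') (c i'))}"

definition scost :: "nat set \<Rightarrow> real" where
  "scost S = (\<Sum>j\<in>C. Min (sd j ` S))"

lemma curs_cong: "(\<And>i'. i' < i \<Longrightarrow> c i' = c' i') \<Longrightarrow> curs cur p r c i = curs cur p r c' i"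
  by (induction i) (simp_all add: Let_def)

lemma opened_cong: "(\<And>i'. i' < i \<Longrightarrow> c i' = c' i') \<Longrightarrow> opened cur p r c i = opened cur p r c' i"
proof -
  assume c: "\<And>i'. i' < i \<Longrightarrow> c i' = c' i'"
  have "choice_of (curs cur p r c i') (p i') (r i') (c i') = choice_of (curs cur p r c' i') (p i') (r i') (c' i')"
    if "i' < i" for i'
    using curs_cong[of i' c c' cur p r] c that by simp
  then show ?thesis unfolding opened_def by metis
qed

lemma opened_Suc:
  "opened cur p r c (Suc i) = (let g = choice_of (curs cur p r c i) (p i) (r i) (c i) in
     if g < n then insert g (opened cur p r c i) else opened cur p r c i)"
  by (auto simp: opened_def less_Suc_eq Let_def)

lemma curs_cases:
  "curs cur p r c i x = cur x \<or> (\<exists>g\<in>opened cur p r c i. curs cur p r c i x = sd x g)"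
  by (induction i) (auto simp: opened_Suc Let_def min_def)

text \<open>In step \<open>i\<close> the facility \<open>f i\<close> is exchanged for a member of
  the greedy basis of its ball, relative to the facilities opened so far and the optimal ones still
  to be replaced. Disjointness is part of the invariant because the exchange requires
  \<open>f i\<close> to lie outside this set.\<close>

lemma good_choices:
  assumes f: "\<And>i. i < l \<Longrightarrow> f i \<in> ball (p i) (r i)" "inj_on f {..<l}" "independent I (f ` {..<l})"
    and i: "i \<le> l"
  shows "\<exists>c. (\<forall>i'. c i' \<le> k) \<and>
    independent I (opened cur p r c i \<union> f ` {i..<l}) \<and> opened cur p r c i \<inter> f ` {i..<l} = {} \<and>
    (\<forall>i'<i. let g = choice_of (curs cur p r c i') (p i') (r i') (c i') in g \<in> ball (p i') (r i') \<and>
       trunc_cost (curs cur p r c i') g \<le> trunc_cost (curs cur p r c i') (f i'))"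
  using i
proof (induction i)
  case 0
  then show ?case using f(3) by (intro exI[of _ "\<lambda>_. 0"]) (simp add: opened_def lessThan_atLeast0)
next
  case (Suc i)
  then obtain c where c: "\<forall>i'. c i' \<le> k"
    "independent I (opened cur p r c i \<union> f ` {i..<l})" "opened cur p r c i \<inter> f ` {i..<l} = {}"
    "\<forall>i'<i. let g = choice_of (curs cur p r c i') (p i') (r i') (c i') in g \<in> ball (p i') (r i') \<and>
       trunc_cost (curs cur p r c i') g \<le> trunc_cost (curs cur p r c i') (f i')"
    by auto
  let ?X = "opened cur p r c i \<union> f ` {Suc i..<l}"
  have il: "i < l" using Suc by simp
  have split: "f ` {i..<l} = insert (f i) (f ` {Suc i..<l})"
  proof -
    have "{i..<l} = insert i {Suc i..<l}" using il by auto
    then show ?thesis by simp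
  qed
  have fX: "f i \<notin> ?X"
  proof -
    have "f i \<notin> f ` {Suc i..<l}"
    proof
      assume "f i \<in> f ` {Suc i..<l}"
      then obtain i' where "i' \<in> {Suc i..<l}" "f i = f i'" by auto
      then show False using inj_onD[OF f(2), of i i'] il by auto
    qed
    then show ?thesis using c(3) split by blast
  qed
  have "independent I (insert (f i) ?X)" using c(2) split by simp
  then obtain c0 where c0: "c0 \<le> k"
    and g0: "choice_of (curs cur p r c i) (p i) (r i) c0 \<in> ball (p i) (r i)"
      "choice_of (curs cur p r c i) (p i) (r i) c0 \<notin> ?X"
      "independent I (insert (choice_of (curs cur p r c i) (p i) (r i) c0) ?X)"
      "trunc_cost (curs cur p r c i) (choice_of (curs cur p r c i) (p i) (r i) c0)
        \<le> trunc_cost (curs cur p r c i) (f i)"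
    using gpick_exchange[OF f(1)[OF il] fX, of "trunc_cost (curs cur p r c i)"] unfolding choice_of_def by blast
  \<comment> \<open>The run up to step \<open>i\<close> reads only the digits before
    \<open>i\<close>, so digit \<open>i\<close> can be set once that run is known.\<close>
  define c' where "c' = c(i := c0)"
  define g where "g = choice_of (curs cur p r c i) (p i) (r i) c0"
  have same: "curs cur p r c' i' = curs cur p r c i'" "opened cur p r c' i' = opened cur p r c i'"
    if "i' \<le> i" for i'
    using that by (auto simp: c'_def intro!: curs_cong opened_cong)
  have gi: "choice_of (curs cur p r c' i) (p i) (r i) (c' i) = g" using same(1)[of i] by (simp add: g_def c'_def)
  have gn: "g < n" using g0(1) by (simp add: g_def ball_def)
  have op: "opened cur p r c' (Suc i) = insert g (opened cur p r c i)"
    using gi gn same(2)[of i] by (simp add: opened_Suc)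
  have op': "opened cur p r c' (Suc i) \<union> f ` {Suc i..<l} = insert g ?X" using op by blast
  show ?case
  proof (intro exI[of _ c'] conjI)
    show "\<forall>i'. c' i' \<le> k" using c(1) c0 by (simp add: c'_def)
    show "independent I (opened cur p r c' (Suc i) \<union> f ` {Suc i..<l})"
      unfolding op' using g0(3) by (simp add: g_def)
    show "opened cur p r c' (Suc i) \<inter> f ` {Suc i..<l} = {}"
      unfolding op using g0(2) c(3) split by (auto simp: g_def)
    show "\<forall>i'<Suc i. let g = choice_of (curs cur p r c' i') (p i') (r i') (c' i') in g \<in> ball (p i') (r i') \<and>
       trunc_cost (curs cur p r c' i') g \<le> trunc_cost (curs cur p r c' i') (f i')"
    proof (intro allI impI)
      fix i' assume "i' < Suc i"
      then consider "i' = i" | "i' < i" by linarith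
      then show "let g = choice_of (curs cur p r c' i') (p i') (r i') (c' i') in g \<in> ball (p i') (r i') \<and>
       trunc_cost (curs cur p r c' i') g \<le> trunc_cost (curs cur p r c' i') (f i')"
      proof cases
        case 1
        then show ?thesis using gi g0(1,4) same(1)[of i] by (simp add: Let_def g_def)
      next
        case 2
        then have "c' i' = c i'" "curs cur p r c' i' = curs cur p r c i'"
          using same(1)[of i'] by (simp_all add: c'_def)
        then show ?thesis using c(4) 2 by simp
      qed
    qed
  qed
qed

text \<open>Digit 0 opens nothing. A word can thus be padded to \<open>k\<close> positions when the
  optimal solution uses fewer facilities.\<close>

lemma curs_no_choice:
  assumes "l \<le> i" "\<And>i'. l \<le> i' \<Longrightarrow> c i' = 0"
  shows "curs cur p r c i = curs cur p r c l" "opened cur p r c i = opened cur p r c l"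
  using assms(1)
proof (induction i rule: dec_induct)
  case (step i)
  { case 1 then show ?case using step assms(2)[of i] by (simp add: choice_of_def) }
  { case 2 then show ?case using step assms(2)[of i] by (simp add: opened_Suc choice_of_def) }
qed simp_all

lemma sd_nonneg: "0 \<le> sd x y"
  by (simp add: sd_def)

lemma sd_triangle: "x < n \<Longrightarrow> y < n \<Longrightarrow> z < n \<Longrightarrow> sd x z \<le> sd x y + sd y z"
  using triangle[of x y z] unfolding sd_def by (simp add: mult_left_mono flip: distrib_left)

text \<open>\<open>greedy_half\<close> bounds the sum of the final truncated costs. These are true
  upper bounds for the opened set: a value still equal to the initial
  \<open>sd j (p i) + r i\<close> is realized by the facility opened in ball \<open>i\<close>, by
  the triangle inequality.\<close>

lemma good_word_cost:
  assumes l: "1 \<le> l" "l \<le> k"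
    and p: "\<And>i. i < k \<Longrightarrow> p i < n"
    and f: "\<And>i. i < l \<Longrightarrow> f i \<in> ball (p i) (r i)" "inj_on f {..<l}" "independent I (f ` {..<l})"
    and pad: "\<And>i. l \<le> i \<Longrightarrow> i < k \<Longrightarrow> p i = p 0 \<and> r i = r 0"
    and cur: "\<And>x. x < n \<Longrightarrow> \<exists>i<k. cur x = sd x (p i) + r i"
    and cl: "\<And>j. j \<in> C \<Longrightarrow> cl j < l"
  shows "\<exists>c. (\<forall>i. c i \<le> k) \<and> independent I (opened cur p r c k) \<and> opened cur p r c k \<noteq> {} \<and>
    2 * scost (opened cur p r c k) \<le> sum cur C + (\<Sum>j\<in>C. sd j (f (cl j)))"
proof -
  obtain c where c: "\<forall>i'. c i' \<le> k" "independent I (opened cur p r c l \<union> f ` {l..<l})"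
    "\<forall>i'<l. let g = choice_of (curs cur p r c i') (p i') (r i') (c i') in g \<in> ball (p i') (r i') \<and>
       trunc_cost (curs cur p r c i') g \<le> trunc_cost (curs cur p r c i') (f i')"
    using good_choices[OF f order_refl, of cur] by blast
  define c' where "c' i = (if i < l then c i else 0)" for i
  have op: "opened cur p r c' k = opened cur p r c l" "curs cur p r c' l = curs cur p r c l"
    using curs_no_choice(2)[of l k c' cur p r] opened_cong[of l c c' cur p r] curs_cong[of l c c' cur p r] l
    by (simp_all add: c'_def)
  let ?S = "opened cur p r c l"
  let ?g = "\<lambda>i. choice_of (curs cur p r c i) (p i) (r i) (c i)"
  have g: "?g i < n" "sd (p i) (?g i) \<le> r i" "?g i \<in> ?S"
     "trunc_cost (curs cur p r c i) (?g i) \<le> trunc_cost (curs cur p r c i) (f i)" if "i < l" for i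
    using c(3) that by (auto simp: Let_def ball_def opened_def)
  have curs: "curs cur p r c (Suc i) = (\<lambda>x. min (curs cur p r c i x) (sd x (?g i)))" if "i < l" for i
    using g(1)[OF that] by (simp add: Let_def)
  have ne: "?S \<noteq> {}" using g(3)[of 0] l by auto
  have fin: "finite ?S" by (rule finite_subset[of _ "{..<n}"]) (auto simp: opened_def)
  have lower: "Min (sd j ` ?S) \<le> curs cur p r c l j" if "j \<in> C" for j
  proof -
    have jn: "j < n" using client_less that by simp
    consider (facility) g where "g \<in> ?S" "curs cur p r c l j = sd j g" | (initial) "curs cur p r c l j = cur j"
      using curs_cases[of cur p r c l j] by blast
    then have "\<exists>g\<in>?S. sd j g \<le> curs cur p r c l j"
    proof cases
      case initial
      obtain i where i: "i < k" "cur j = sd j (p i) + r i" using cur[OF jn] by blast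
      \<comment> \<open>A padded position repeats the leader and radius of position 0, in whose ball
        a facility has been opened.\<close>
      define i' where "i' = (if i < l then i else 0)"
      have i': "i' < l" "p i' = p i" "r i' = r i" using l pad[of i] i(1) by (auto simp: i'_def)
      have "sd j (?g i') \<le> sd j (p i') + sd (p i') (?g i')"
        using sd_triangle[OF jn _ g(1)[OF i'(1)]] p[OF i(1)] i'(2) by simp
      also have "\<dots> \<le> cur j" using g(2)[OF i'(1)] i(2) i' by simp
      finally show ?thesis using g(3)[OF i'(1)] initial by auto
    qed auto
    then show ?thesis using fin by (meson Min_le finite_imageI image_eqI order_trans)
  qed
  have "scost ?S \<le> sum (curs cur p r c l) C"
    unfolding scost_def by (rule sum_mono) (rule lower)
  moreover have "2 * sum (curs cur p r c l) C \<le> sum (curs cur p r c 0) C + (\<Sum>j\<in>C. sd j (f (cl j)))"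
  proof (rule greedy_half[OF fin_C cl])
    fix i assume i: "i < l"
    show "curs cur p r c (Suc i) j \<le> curs cur p r c i j" for j unfolding curs[OF i] by simp
    show "sum (curs cur p r c (Suc i)) C \<le> (\<Sum>j\<in>C. min (curs cur p r c i j) (sd j (f i)))"
      using g(4)[OF i] unfolding curs[OF i] trunc_cost_def .
  qed
  ultimately have "2 * scost ?S \<le> sum cur C + (\<Sum>j\<in>C. sd j (f (cl j)))" by simp
  then show ?thesis using c(1,2) ne unfolding op(1)[symmetric]
    by (intro exI[of _ c']) (simp add: c'_def op(1)[symmetric])
qed

section \<open>Evaluating one guess\<close>

definition ps :: "state \<Rightarrow> nat \<Rightarrow> nat" where "ps s i = nmem s ''T'' (nmem s ''dig'' i)"
definition rs :: "state \<Rightarrow> nat \<Rightarrow> real" where "rs s i = rmem s ''gr'' (nmem s ''dig'' (i + k))"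
definition cs :: "state \<Rightarrow> nat \<Rightarrow> nat" where "cs s i = nmem s ''dig'' (i + (k + k))"

lemma static_simps:
  assumes "static s"
  shows "nmem s ''kk'' 0 = k" "nmem s ''M'' 0 = 3 * k" "nmem s ''Y'' 0 = Y" "nmem s ''PW'' 0 = Y ^ (3 * k)"
    "nmem s ''Z'' 0 = Z"
    "x < n \<Longrightarrow> nmem s ''off'' x = x * n" "x < n \<Longrightarrow> y < n \<Longrightarrow> rmem s ''sd'' (x * n + y) = sd x y"
  using assms by (simp_all add: static_def)

lemma bound_spec:
  assumes s: "static s" and k1: "1 \<le> k" and p: "\<And>i. i < k \<Longrightarrow> ps s i < n" and x: "x < n"
  shows "\<exists>i<k. rmem (ev I bound_prog s) ''cur'' x = sd x (ps s i) + rs s i"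
    and "i < k \<Longrightarrow> rmem (ev I bound_prog s) ''cur'' x \<le> sd x (ps s i) + rs s i"
proof -
  let ?b = "\<lambda>x i. sd x (ps s i) + rs s i"
  let ?q = "PFor ''i'' (nv ''kk'') (
       setr ''val'' (RAdd (sdist (nv ''x'') (leader (nv ''i''))) (radius (nv ''i'')));;
       ifp (RLess (rv ''val'') (RCell ''cur'' (nv ''x''))) (PR ''cur'' (nv ''x'') (rv ''val'')))"
  note st = static_simps[OF s]
  have q: "(\<exists>i<k. rmem (ev I ?q u) ''cur'' x = ?b x i) \<and>
      (\<forall>i<nval I u (nv ''kk''). rmem (ev I ?q u) ''cur'' x \<le> ?b x i) \<and>
      (\<forall>y. y \<noteq> x \<longrightarrow> rmem (ev I ?q u) ''cur'' y = rmem u ''cur'' y)"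
    if x: "x < n" and u: "nmem u ''x'' 0 = x" "rmem u ''cur'' x = ?b x 0" "nmem u ''kk'' 0 = k"
      "nmem u ''off'' = nmem s ''off''" "nmem u ''dig'' = nmem s ''dig''" "nmem u ''T'' = nmem s ''T''"
      "rmem u ''sd'' = rmem s ''sd''" "rmem u ''gr'' = rmem s ''gr''" for u x
  proof (rule ev_For_inv[where P = "\<lambda>i t. (\<exists>i<k. rmem t ''cur'' x = ?b x i) \<and>
      (\<forall>i'<i. rmem t ''cur'' x \<le> ?b x i') \<and> (\<forall>y. y \<noteq> x \<longrightarrow> rmem t ''cur'' y = rmem u ''cur'' y)"], goal_cases)
    case 2
    show ?case using u(2) k1 by (auto intro!: exI[of _ 0])
  next
    case (3 i t)
    let ?v = "rmem t ''sd'' (nmem t ''off'' (nmem t ''x'' 0) + nmem t ''T'' (nmem t ''dig'' (nmem t ''i'' 0))) +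
       rmem t ''gr'' (nmem t ''dig'' (nmem t ''i'' 0 + nmem t ''kk'' 0))"
    have i: "i < k" using 3(1) u(3) by simp
    have v: "?v = ?b x i" and tx: "nmem t ''x'' 0 = x"
      using 3(3-5) u x p[OF i] st by (simp_all add: ps_def rs_def)
    note v' = v[unfolded tx]
    show ?case
    proof (cases "?b x i < rmem t ''cur'' x")
      case True
      then show ?thesis using 3(2) i by (auto simp: v' tx less_Suc_eq)
    next
      case False
      then show ?thesis using 3(2) by (auto simp: v' tx less_Suc_eq)
    qed
  qed simp_all
  have "\<forall>x<nval I s NPoints. (\<exists>i<k. rmem (ev I bound_prog s) ''cur'' x = ?b x i) \<and>
      (\<forall>i<k. rmem (ev I bound_prog s) ''cur'' x \<le> ?b x i)"
    unfolding bound_prog_def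
  proof (rule ev_For_inv[where P = "\<lambda>j t. \<forall>x<j. (\<exists>i<k. rmem t ''cur'' x = ?b x i) \<and>
      (\<forall>i<k. rmem t ''cur'' x \<le> ?b x i)"], goal_cases)
    case (3 j t)
    let ?a = "PR ''cur'' (nv ''x'') (RAdd (sdist (nv ''x'') (leader (NConst 0))) (radius (NConst 0)))"
    define u where "u = ev I ?a t"
    have j: "j < n" using 3(1) by simp
    have p0: "ps s 0 < n" using p k1 by simp
    have u: "nmem u ''x'' 0 = j" "nmem u ''kk'' 0 = k"
      "nmem u ''off'' = nmem s ''off''" "nmem u ''dig'' = nmem s ''dig''" "nmem u ''T'' = nmem s ''T''"
      "rmem u ''sd'' = rmem s ''sd''" "rmem u ''gr'' = rmem s ''gr''"
      using 3(3-5) st by (simp_all add: u_def)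
    have cur: "rmem u ''cur'' = (rmem t ''cur'')(j := ?b j 0)"
      using 3(3-5) st p0 j by (simp add: u_def ps_def rs_def)
    have "(\<exists>i<k. rmem (ev I ?q u) ''cur'' j = ?b j i) \<and>
      (\<forall>i<nval I u (nv ''kk''). rmem (ev I ?q u) ''cur'' j \<le> ?b j i) \<and>
      (\<forall>y. y \<noteq> j \<longrightarrow> rmem (ev I ?q u) ''cur'' y = rmem u ''cur'' y)"
      by (rule q[OF j u(1) _ u(2-)]) (simp add: cur)
    moreover have "ev I (?a;; ?q) t = ev I ?q u" by (simp add: u_def)
    ultimately show ?case using 3(2) u(2) cur by (auto simp: less_Suc_eq)
  qed simp_all
  then show "\<exists>i<k. rmem (ev I bound_prog s) ''cur'' x = ?b x i"
    "i < k \<Longrightarrow> rmem (ev I bound_prog s) ''cur'' x \<le> ?b x i"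
    using x by simp_all
qed

lemma value_spec:
  assumes s: "static s" and f: "f < n"
  shows "rmem (ev I value_prog s) ''vl'' f = trunc_cost (rmem s ''cur'') f"
proof -
  let ?q = "PFor ''x'' NPoints (ifp (IsClient (nv ''x''))
       (PIf (RLess (sdist (nv ''x'') (nv ''f'')) (RCell ''cur'' (nv ''x'')))
         (incr ''acc'' (sdist (nv ''x'') (nv ''f'')))
         (incr ''acc'' (RCell ''cur'' (nv ''x'')))))"
  note st = static_simps[OF s]
  have q: "rmem (ev I ?q u) ''acc'' 0 = rmem u ''acc'' 0 + trunc_cost (rmem s ''cur'') f"
    if f: "f < n" and u: "nmem u ''f'' 0 = f" "nmem u ''off'' = nmem s ''off''" "rmem u ''sd'' = rmem s ''sd''"
      "rmem u ''cur'' = rmem s ''cur''" for u f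
  proof -
    have "rmem (ev I ?q u) ''acc'' 0 = rmem u ''acc'' 0 +
        (\<Sum>j<nval I u NPoints. if j \<in> C then min (rmem s ''cur'' j) (sd j f) else 0)"
    proof (rule ev_For_inv[where P = "\<lambda>i t. rmem t ''acc'' 0 = rmem u ''acc'' 0 +
        (\<Sum>j<i. if j \<in> C then min (rmem s ''cur'' j) (sd j f) else 0)"], goal_cases)
      case (3 i t)
      then show ?case using u f st by (simp add: min_def)
    qed simp_all
    then show ?thesis by (simp add: sum_lessThan_clients[OF C_sub] trunc_cost_def)
  qed
  have "\<forall>f<nval I s NPoints. rmem (ev I value_prog s) ''vl'' f = trunc_cost (rmem s ''cur'') f"
    unfolding value_prog_def
  proof (rule ev_For_inv[where P = "\<lambda>i t. \<forall>f<i. rmem t ''vl'' f = trunc_cost (rmem s ''cur'') f"], goal_cases)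
    case (3 i t)
    define u where "u = ev I ?q (rupdate ''acc'' 0 0 t)"
    have "rmem u ''acc'' 0 = trunc_cost (rmem s ''cur'') i"
      using q[of i "rupdate ''acc'' 0 0 t"] 3 by (simp add: u_def)
    moreover have "rmem u ''vl'' = rmem t ''vl''" "nmem u ''f'' = nmem t ''f''"
      by (simp_all add: u_def nmem_ev rmem_ev)
    ultimately show ?case using 3(2,3) by (auto simp: u_def[symmetric] less_Suc_eq)
  qed simp_all
  then show ?thesis using f by simp
qed

lemma marked_nupdate: "x \<noteq> y \<Longrightarrow> marked I (nupdate x i v s) y = marked I s y"
  by (simp add: marked_def)

lemma marked_insert: "i < n \<Longrightarrow> v \<noteq> 0 \<Longrightarrow> marked I (nupdate x i v s) x = insert i (marked I s x)"
  by (auto simp: marked_def)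

lemma cand_spec:
  assumes s: "static s" and f: "nmem s ''f'' 0 < n" and p: "ps s (nmem s ''i'' 0) < n"
  defines "K \<equiv> cands (ball (ps s (nmem s ''i'' 0)) (rs s (nmem s ''i'' 0))) (marked I s ''A'')"
  shows "nmem (ev I cand_prog s) ''A'' = nmem s ''A''"
    and "nmem (ev I cand_prog s) ''bf'' 0 = (if nmem s ''f'' 0 \<in> K \<and>
       \<not> (nmem s ''bf'' 0 < n \<and> rmem s ''vl'' (nmem s ''bf'' 0) \<le> rmem s ''vl'' (nmem s ''f'' 0))
       then nmem s ''f'' 0 else nmem s ''bf'' 0)"
proof -
  let ?f = "nmem s ''f'' 0"
  note st = static_simps[OF s]
  have r: "rval I s (radius (nv ''i'')) = rs s (nmem s ''i'' 0)"
    "rval I s (sdist (leader (nv ''i'')) (nv ''f'')) = sd (ps s (nmem s ''i'' 0)) ?f"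
    using st f p by (simp_all add: rs_def ps_def)
  have m: "?f \<in> marked I s ''A'' \<longleftrightarrow> nmem s ''A'' ?f \<noteq> 0" using f by (simp add: marked_def)
  have m': "marked I (nupdate ''A'' ?f 1 s) ''A'' = insert ?f (marked I s ''A'')"
    using f by (simp add: marked_insert)
  show "nmem (ev I cand_prog s) ''A'' = nmem s ''A''"
    unfolding cand_prog_def by (auto simp: fun_eq_iff)
  show "nmem (ev I cand_prog s) ''bf'' 0 = (if ?f \<in> K \<and>
       \<not> (nmem s ''bf'' 0 < n \<and> rmem s ''vl'' (nmem s ''bf'' 0) \<le> rmem s ''vl'' ?f)
       then ?f else nmem s ''bf'' 0)"
    unfolding cand_prog_def K_def cands_def ball_def
    by (auto simp add: r[simplified] m m' f not_less)
qed

lemma next_spec: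
  assumes s: "static s" and p: "ps s (nmem s ''i'' 0) < n"
    and v: "\<And>f. f < n \<Longrightarrow> rmem s ''vl'' f = v f"
  defines "K \<equiv> cands (ball (ps s (nmem s ''i'' 0)) (rs s (nmem s ''i'' 0))) (marked I s ''A'')"
  shows "marked I (ev I next_prog s) ''A'' =
      (if K = {} then marked I s ''A'' else insert (best v K) (marked I s ''A''))"
    and "nmem (ev I next_prog s) ''g'' 0 = (if K = {} then nmem s ''g'' 0 else best v K)"
proof -
  let ?q = "PFor ''f'' NPoints cand_prog"
  let ?s = "nupdate ''bf'' 0 n s"
  \<comment> \<open>The strict inequality for smaller indices records that \<open>bf\<close> is the
    first minimizer, as the \<open>LEAST\<close> in \<open>best\<close> demands.\<close>
  let ?P = "\<lambda>i t. nmem t ''A'' = nmem s ''A'' \<and>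
    (nmem t ''bf'' 0 = n \<and> (\<forall>f\<in>K. i \<le> f) \<or>
     nmem t ''bf'' 0 \<in> K \<and> nmem t ''bf'' 0 < i \<and>
     (\<forall>f\<in>K. f < i \<longrightarrow> v (nmem t ''bf'' 0) \<le> v f \<and> (f < nmem t ''bf'' 0 \<longrightarrow> v (nmem t ''bf'' 0) < v f)))"
  have Kn: "f \<in> K \<Longrightarrow> f < n" for f by (simp add: K_def cands_def ball_def)
  have P: "?P (nval I ?s NPoints) (ev I ?q ?s)"
  proof (rule ev_For_inv[where P = ?P], goal_cases)
    case (3 i t)
    have st: "static t" using s 3(4,5) by (simp add: static_def)
    have i: "i < n" using 3(1) by simp
    have A: "nmem t ''A'' = nmem s ''A''" using 3(2) by blast
    have K: "cands (ball (ps t (nmem t ''i'' 0)) (rs t (nmem t ''i'' 0))) (marked I t ''A'') = K"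
      using 3(4,5) A by (simp add: K_def ps_def rs_def marked_def)
    have vt: "rmem t ''vl'' f = v f" if "f < n" for f using 3(5) v that by simp
    have pt: "ps t (nmem t ''i'' 0) < n" using p 3(4) by (simp add: ps_def)
    have c: "nmem (ev I cand_prog t) ''A'' = nmem s ''A''"
      "nmem (ev I cand_prog t) ''bf'' 0 = (if i \<in> K \<and> \<not> (nmem t ''bf'' 0 < n \<and> v (nmem t ''bf'' 0) \<le> v i)
         then i else nmem t ''bf'' 0)"
      using cand_spec[OF st _ pt] 3(3) i vt A unfolding K by auto
    let ?b = "nmem t ''bf'' 0"
    have "?P (Suc i) (ev I cand_prog t)"
    proof (cases "i \<in> K")
      case False
      then have "\<And>f. f \<in> K \<Longrightarrow> f < Suc i \<longleftrightarrow> f < i" by (metis less_Suc_eq)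
      moreover have "\<And>f. f \<in> K \<Longrightarrow> Suc i \<le> f \<longleftrightarrow> i \<le> f" using False by (metis Suc_le_eq le_eq_less_or_eq)
      ultimately show ?thesis using 3(2) c False by auto
    next
      case iK: True
      from 3(2) consider "?b = n" "\<forall>f\<in>K. i \<le> f"
        | "?b \<in> K" "?b < i" "\<forall>f\<in>K. f < i \<longrightarrow> v ?b \<le> v f \<and> (f < ?b \<longrightarrow> v ?b < v f)"
        by blast
      then show ?thesis
      proof cases
        case 1
        then have "nmem (ev I cand_prog t) ''bf'' 0 = i" using c iK by simp
        then show ?thesis using c(1) iK 1(2) by (auto simp: less_Suc_eq)
      next
        case 2
        then have bn: "?b < n" using Kn by blast
        show ?thesis
        proof (cases "v ?b \<le> v i")
          case True
          then have "nmem (ev I cand_prog t) ''bf'' 0 = ?b" using c bn by simp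
          then show ?thesis using c(1) 2 True by (auto simp: less_Suc_eq)
        next
          case False
          then have "nmem (ev I cand_prog t) ''bf'' 0 = i" using c iK by simp
          moreover have "\<forall>f\<in>K. f < i \<longrightarrow> v i < v f" using 2(3) False by force
          ultimately show ?thesis using c(1) iK by (auto simp: less_Suc_eq)
        qed
      qed
    qed
    then show ?case by simp
  qed simp_all
  define u where "u = ev I ?q ?s"
  have uA: "nmem u ''A'' = nmem s ''A''" and ug: "nmem u ''g'' = nmem s ''g''"
    using P by (simp_all add: u_def nmem_ev)
  have ev: "ev I next_prog s = ev I (ifp (NLess (nv ''bf'') NPoints)
      (PN ''A'' (nv ''bf'') (NConst 1);; setn ''g'' (nv ''bf''))) u"
    by (simp add: next_prog_def u_def)
  have mu: "marked I u ''A'' = marked I s ''A''" by (simp add: marked_def uA)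
  show "marked I (ev I next_prog s) ''A'' =
      (if K = {} then marked I s ''A'' else insert (best v K) (marked I s ''A''))"
    "nmem (ev I next_prog s) ''g'' 0 = (if K = {} then nmem s ''g'' 0 else best v K)"
  proof -
    consider "nmem u ''bf'' 0 = n" "K = {}" | "nmem u ''bf'' 0 \<in> K"
        "\<forall>f\<in>K. v (nmem u ''bf'' 0) \<le> v f \<and> (f < nmem u ''bf'' 0 \<longrightarrow> v (nmem u ''bf'' 0) < v f)"
      using P Kn unfolding u_def[symmetric] by fastforce
    then have "marked I (ev I next_prog s) ''A'' =
      (if K = {} then marked I s ''A'' else insert (best v K) (marked I s ''A'')) \<and>
      nmem (ev I next_prog s) ''g'' 0 = (if K = {} then nmem s ''g'' 0 else best v K)"
    proof cases
      case 1
      then show ?thesis unfolding ev by (simp add: mu ug)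
    next
      case 2
      have "best v K = nmem u ''bf'' 0"
        unfolding best_def
      proof (rule Least_equality)
        show "nmem u ''bf'' 0 \<in> K \<and> (\<forall>f'\<in>K. v (nmem u ''bf'' 0) \<le> v f')" using 2 by blast
        fix y assume "y \<in> K \<and> (\<forall>f'\<in>K. v y \<le> v f')"
        then show "nmem u ''bf'' 0 \<le> y" using 2 by (meson not_le)
      qed
      moreover have "K \<noteq> {}" "nmem u ''bf'' 0 < n" using 2(1) Kn by auto
      ultimately show ?thesis unfolding ev by (simp add: marked_nupdate marked_insert mu)
    qed
    then show "marked I (ev I next_prog s) ''A'' =
      (if K = {} then marked I s ''A'' else insert (best v K) (marked I s ''A''))"
     "nmem (ev I next_prog s) ''g'' 0 = (if K = {} then nmem s ''g'' 0 else best v K)" by blast+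
  qed
qed


lemma choose_spec:
  assumes s: "static s" and p: "ps s (nmem s ''i'' 0) < n" and c: "cs s (nmem s ''i'' 0) \<le> k"
    and v: "\<And>f. f < n \<Longrightarrow> rmem s ''vl'' f = v f"
  shows "nmem (ev I choose_prog s) ''g'' 0 =
     gpick v (ball (ps s (nmem s ''i'' 0)) (rs s (nmem s ''i'' 0))) (cs s (nmem s ''i'' 0))"
proof -
  let ?i = "nmem s ''i'' 0"
  let ?B = "ball (ps s ?i) (rs s ?i)" and ?c = "cs s ?i"
  let ?clr = "PFor ''x'' NPoints (PN ''A'' (nv ''x'') (NConst 0))"
  let ?q = "PFor ''t'' (nv ''kk'') (ifp (NLess (nv ''t'') (choice (nv ''i''))) next_prog)"
  have clr: "\<forall>x<nval I s NPoints. nmem (ev I ?clr s) ''A'' x = 0"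
    by (rule ev_For_inv[where P = "\<lambda>i t. \<forall>x<i. nmem t ''A'' x = 0"]) (auto simp: less_Suc_eq)
  define a where "a = nupdate ''g'' 0 n (ev I ?clr s)"
  have a: "nmem a ''kk'' 0 = k" "marked I a ''A'' = {}" "nmem a ''g'' 0 = n"
    using clr static_simps(1)[OF s] by (simp_all add: a_def nmem_ev marked_def)
  have fa: "nmem a y = nmem s y" if "y \<notin> {''x'', ''A'', ''g''}" for y using that by (simp add: a_def nmem_ev)
  have ra: "rmem a = rmem s" by (simp add: a_def fun_eq_iff rmem_ev)
  let ?P = "\<lambda>t u. marked I u ''A'' = gset v ?B (min ?c t) \<and> nmem u ''g'' 0 = gpick v ?B (min ?c t)"
  have "?P (nval I a (nv ''kk'')) (ev I ?q a)"
  proof (rule ev_For_inv[where P = ?P], goal_cases)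
    case 2
    show ?case using a by (simp add: marked_def)
  next
    case (3 t u)
    have fu: "nmem u y = nmem s y" if "y \<notin> {''x'', ''A'', ''g'', ''t'', ''bf'', ''f''}" for y
      using 3(4)[of y] fa[of y] that by simp
    have ru: "rmem u = rmem s" using 3(5) ra by (simp add: fun_eq_iff)
    have su: "static u" using s fu ru by (simp add: static_def)
    have iu: "nmem u ''i'' 0 = ?i" using fu by simp
    have pu: "ps u ?i = ps s ?i" "rs u ?i = rs s ?i" using fu ru by (simp_all add: ps_def rs_def)
    have cu: "nmem u ''dig'' (nmem u ''i'' 0 + (nmem u ''kk'' 0 + nmem u ''kk'' 0)) = ?c"
      using fu static_simps(1)[OF s] by (simp add: cs_def)
    have "?P (Suc t) (ev I (ifp (NLess (nv ''t'') (choice (nv ''i''))) next_prog) u)"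
    proof (cases "t < ?c")
      case True
      then have "min ?c t = t" "min ?c (Suc t) = Suc t" by auto
      moreover have "ev I (ifp (NLess (nv ''t'') (choice (nv ''i''))) next_prog) u = ev I next_prog u"
        using True 3(3) cu by simp
      ultimately show ?thesis
        using next_spec[OF su, of v] 3(2) p v unfolding iu pu ru by simp
    next
      case False
      then have "min ?c t = ?c" "min ?c (Suc t) = ?c" by auto
      moreover have "ev I (ifp (NLess (nv ''t'') (choice (nv ''i''))) next_prog) u = u"
        using False 3(3) cu by simp
      ultimately show ?thesis using 3(2) by simp
    qed
    then show ?case by (simp add: marked_nupdate)
  qed simp_all
  moreover have "ev I choose_prog s = ev I ?q a" by (simp add: choose_prog_def a_def)
  ultimately show ?thesis using a(1) c by simp
qed

lemma trunc_cost_cong: "(\<And>x. x < n \<Longrightarrow> cur x = cur' x) \<Longrightarrow> trunc_cost cur = trunc_cost cur'"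
  unfolding trunc_cost_def by (intro ext sum.cong refl) (simp add: client_less)

lemma stage_spec:
  assumes s: "static s" and p: "ps s (nmem s ''i'' 0) < n" and c: "cs s (nmem s ''i'' 0) \<le> k"
    and cur: "\<And>x. x < n \<Longrightarrow> rmem s ''cur'' x = cur x"
  defines "g \<equiv> choice_of cur (ps s (nmem s ''i'' 0)) (rs s (nmem s ''i'' 0)) (cs s (nmem s ''i'' 0))"
  shows "x < n \<Longrightarrow> rmem (ev I stage_prog s) ''cur'' x = (if g < n then min (cur x) (sd x g) else cur x)"
    and "marked I (ev I stage_prog s) ''S'' = (if g < n then insert g (marked I s ''S'') else marked I s ''S'')"
proof -
  let ?i = "nmem s ''i'' 0"
  let ?q = "PFor ''x'' NPoints (ifp (RLess (sdist (nv ''x'') (nv ''g'')) (RCell ''cur'' (nv ''x'')))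
         (PR ''cur'' (nv ''x'') (sdist (nv ''x'') (nv ''g''))))"
  define a where "a = ev I choose_prog (ev I value_prog s)"
  have sv: "static (ev I value_prog s)" by (rule static_ev[OF s]) simp_all
  have sa: "static a" unfolding a_def by (rule static_ev[OF sv]) simp_all
  have fv: "nmem (ev I value_prog s) y = nmem s y" if "y \<notin> {''f'', ''x''}" for y using that by (simp add: nmem_ev)
  have gv: "rmem (ev I value_prog s) ''gr'' = rmem s ''gr''" by (simp add: rmem_ev)
  have i: "nmem (ev I value_prog s) ''i'' 0 = ?i" "ps (ev I value_prog s) ?i = ps s ?i"
    "rs (ev I value_prog s) ?i = rs s ?i" "cs (ev I value_prog s) ?i = cs s ?i"
    using fv gv by (simp_all add: ps_def rs_def cs_def)
  have ag: "nmem a ''g'' 0 = g"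
    unfolding a_def g_def choice_of_def
    using choose_spec[OF sv, of "trunc_cost cur"] p c value_spec[OF s] trunc_cost_cong[of "rmem s ''cur''" cur] cur
    unfolding i by simp
  have ac: "rmem a ''cur'' = rmem s ''cur''" "nmem a ''S'' = nmem s ''S''"
    by (simp_all add: a_def nmem_ev rmem_ev)
  have ev: "ev I stage_prog s = (if g < n then ev I ?q (nupdate ''S'' g 1 a) else a)"
    by (simp add: stage_prog_def a_def[symmetric] ag)
  have q: "\<forall>x<nval I u NPoints. rmem (ev I ?q u) ''cur'' x = min (rmem u ''cur'' x) (sd x g)"
    if u: "static u" "nmem u ''g'' 0 = g" "g < n" for u
  proof -
    have "\<forall>x. rmem (ev I ?q u) ''cur'' x = (if x < nval I u NPoints then min (rmem u ''cur'' x) (sd x g) else rmem u ''cur'' x)"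
    proof (rule ev_For_inv[where P = "\<lambda>i t. \<forall>x. rmem t ''cur'' x =
        (if x < i then min (rmem u ''cur'' x) (sd x g) else rmem u ''cur'' x)"], goal_cases)
      case (3 i t)
      have "rmem t ''sd'' (nmem t ''off'' i + nmem t ''g'' 0) = sd i g"
        using 3(1,4,5) u static_simps(6,7)[OF u(1)] by simp
      then show ?case using 3(2,3) by (auto simp: less_Suc_eq min_def)
    qed simp_all
    then show ?thesis by simp
  qed
  show "rmem (ev I stage_prog s) ''cur'' x = (if g < n then min (cur x) (sd x g) else cur x)" if "x < n"
  proof (cases "g < n")
    case True
    have "static (nupdate ''S'' g 1 a)" using sa by (simp add: static_def)
    then show ?thesis using q[of "nupdate ''S'' g 1 a"] True that ag ac cur unfolding ev by simp
  next
    case False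
    then show ?thesis using that ac cur unfolding ev by simp
  qed
  have "nmem (ev I ?q u) ''S'' = nmem u ''S''" for u by (rule nmem_ev) simp
  then show "marked I (ev I stage_prog s) ''S'' = (if g < n then insert g (marked I s ''S'') else marked I s ''S'')"
    unfolding ev by (auto simp: marked_def ac)
qed

lemma total_spec:
  assumes s: "static s" and g: "nmem s ''g'' 0 \<in> marked I s ''S''"
  shows "rmem (ev I total_prog s) ''tot'' 0 = scost (marked I s ''S'')"
proof -
  let ?S = "marked I s ''S''"
  let ?q = "PFor ''f'' NPoints (ifp (BAnd (pos (NCell ''S'' (nv ''f''))) (RLess (sdist (nv ''x'') (nv ''f'')) (rv ''val'')))
          (setr ''val'' (sdist (nv ''x'') (nv ''f''))))"
  let ?p = "PFor ''x'' NPoints (ifp (IsClient (nv ''x''))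
       (setr ''val'' (sdist (nv ''x'') (nv ''g''));; ?q;; incr ''tot'' (rv ''val'')))"
  note st = static_simps(6,7)[OF s]
  have Sn: "f \<in> ?S \<Longrightarrow> f < n" for f by (simp add: marked_def)
  have finS: "finite ?S" by (rule finite_subset[of _ "{..<n}"]) (auto simp: marked_def)
  have q: "rmem (ev I ?q u) ''val'' 0 = Min (sd x ` ?S)"
    if x: "x < n" and u: "nmem u ''x'' 0 = x" "nmem u ''S'' = nmem s ''S''" "nmem u ''off'' = nmem s ''off''"
      "rmem u ''sd'' = rmem s ''sd''" "rmem u ''val'' 0 = sd x (nmem s ''g'' 0)" for u x
  proof -
    have "(\<exists>f\<in>?S. rmem (ev I ?q u) ''val'' 0 = sd x f) \<and>
        (\<forall>f\<in>?S. f < nval I u NPoints \<longrightarrow> rmem (ev I ?q u) ''val'' 0 \<le> sd x f)"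
    proof (rule ev_For_inv[where P = "\<lambda>i t. (\<exists>f\<in>?S. rmem t ''val'' 0 = sd x f) \<and>
        (\<forall>f\<in>?S. f < i \<longrightarrow> rmem t ''val'' 0 \<le> sd x f)"], goal_cases)
      case 2
      show ?case using u g by auto
    next
      case (3 i t)
      have "rmem t ''sd'' (nmem t ''off'' (nmem t ''x'' 0) + nmem t ''f'' 0) = sd x i"
        using 3(1,3-5) u x st by simp
      moreover have "nmem t ''S'' (nmem t ''f'' 0) \<noteq> 0 \<longleftrightarrow> i \<in> ?S"
        using 3(1,3,4) u by (simp add: marked_def)
      ultimately show ?case using 3(2) by (auto simp: less_Suc_eq)
    qed simp_all
    then obtain f where f: "f \<in> ?S" "rmem (ev I ?q u) ''val'' 0 = sd x f"
      "\<forall>f\<in>?S. rmem (ev I ?q u) ''val'' 0 \<le> sd x f"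
      using Sn by auto
    show ?thesis by (rule Min_eqI[symmetric]) (use f finS in auto)
  qed
  let ?a = "rupdate ''tot'' 0 0 s"
  have "rmem (ev I ?p ?a) ''tot'' 0 = (\<Sum>j<nval I ?a NPoints. if j \<in> C then Min (sd j ` ?S) else 0)"
  proof (rule ev_For_inv[where P = "\<lambda>i t. rmem t ''tot'' 0 = (\<Sum>j<i. if j \<in> C then Min (sd j ` ?S) else 0)"], goal_cases)
    case (3 i t)
    define u where "u = ev I (setr ''val'' (sdist (nv ''x'') (nv ''g''))) t"
    have i: "i < n" using 3(1) by simp
    have gn: "nmem s ''g'' 0 < n" using Sn g by blast
    have u: "nmem u ''x'' 0 = i" "nmem u ''S'' = nmem s ''S''" "nmem u ''off'' = nmem s ''off''"
      "rmem u ''sd'' = rmem s ''sd''" "rmem u ''val'' 0 = sd i (nmem s ''g'' 0)"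
      using 3(3-5) st i gn by (simp_all add: u_def)
    have val: "rmem (ev I ?q u) ''val'' 0 = Min (sd i ` ?S)" by (rule q[OF i u])
    have "rmem (ev I ?q u) ''tot'' = rmem t ''tot''" by (simp add: rmem_ev u_def)
    moreover have "ev I (setr ''val'' (sdist (nv ''x'') (nv ''g''));; ?q;; incr ''tot'' (rv ''val'')) t =
        ev I (incr ''tot'' (rv ''val'')) (ev I ?q u)" by (simp add: u_def)
    ultimately show ?case using 3(2,3) val by simp
  qed simp_all
  then show ?thesis by (simp add: total_prog_def sum_lessThan_clients[OF C_sub] scost_def)
qed

section \<open>The best solution recorded so far\<close>

text \<open>Holds throughout the enumeration, whether or not a guess is right: before the first
  solution is recorded, \<open>out\<close> is the empty set.\<close>

definition sound :: "state \<Rightarrow> bool" where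
  "sound s \<longleftrightarrow> independent I (marked I s ''out'') \<and>
     (nmem s ''has'' 0 \<noteq> 0 \<longrightarrow> marked I s ''out'' \<noteq> {} \<and> rmem s ''best'' 0 = scost (marked I s ''out''))"

text \<open>Persists once reached, because a recorded solution is replaced only by a strictly
  cheaper one.\<close>

definition good :: "real \<Rightarrow> state \<Rightarrow> bool" where
  "good thr s \<longleftrightarrow> nmem s ''has'' 0 \<noteq> 0 \<and> rmem s ''best'' 0 \<le> thr"

lemma evaluate_spec:
  assumes s: "static s" and snd: "sound s"
  defines "S \<equiv> marked I s ''S''"
  shows "sound (ev I evaluate_prog s)" "good thr s \<Longrightarrow> good thr (ev I evaluate_prog s)"
    and "S \<noteq> {} \<Longrightarrow> independent I S \<Longrightarrow> scost S \<le> thr \<Longrightarrow> good thr (ev I evaluate_prog s)"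
proof -
  let ?f = "PFor ''f'' NPoints (ifp (pos (NCell ''S'' (nv ''f''))) (setn ''g'' (nv ''f'')))"
  let ?o = "PFor ''x'' NPoints (PN ''out'' (nv ''x'') (NCell ''S'' (nv ''x'')))"
  let ?a = "nupdate ''g'' 0 n s"
  have f: "if (\<exists>f\<in>S. f < nval I ?a NPoints) then nmem (ev I ?f ?a) ''g'' 0 \<in> S else nmem (ev I ?f ?a) ''g'' 0 = n"
  proof (rule ev_For_inv[where P = "\<lambda>i t. if (\<exists>f\<in>S. f < i) then nmem t ''g'' 0 \<in> S else nmem t ''g'' 0 = n"], goal_cases)
    case (3 i t)
    have "nmem t ''S'' i \<noteq> 0 \<longleftrightarrow> i \<in> S" using 3(1,4) by (simp add: S_def marked_def)
    then show ?case using 3(2,3) by (auto simp: less_Suc_eq split: if_splits)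
  qed simp_all
  have Sn: "f \<in> S \<Longrightarrow> f < n" for f by (simp add: S_def marked_def)
  define u where "u = ev I ?f ?a"
  have ug: "if S \<noteq> {} then nmem u ''g'' 0 \<in> S else nmem u ''g'' 0 = n"
    using f Sn unfolding u_def by (auto split: if_splits)
  have su: "static u" unfolding u_def using static_ev[of ?a ?f] s by (simp add: static_def)
  have fu: "marked I u ''S'' = S" "nmem u ''out'' = nmem s ''out''" "nmem u ''has'' = nmem s ''has''"
    "rmem u ''best'' = rmem s ''best''"
    by (simp_all add: u_def nmem_ev rmem_ev marked_def S_def)
  define w where "w = ev I total_prog u"
  have w: "rmem w ''tot'' 0 = scost S" if "S \<noteq> {}"
    using total_spec[OF su] ug that by (simp add: w_def fu)
  have fw: "nmem w ''S'' = nmem u ''S''" "nmem w ''out'' = nmem s ''out''" "nmem w ''has'' = nmem s ''has''"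
    "rmem w ''best'' = rmem s ''best''"
    by (simp_all add: w_def nmem_ev rmem_ev fu)
  have o: "\<forall>x<nval I t NPoints. nmem (ev I ?o t) ''out'' x = nmem t ''S'' x" for t
    by (rule ev_For_inv[where P = "\<lambda>i r. \<forall>x<i. nmem r ''out'' x = nmem t ''S'' x"]) (auto simp: less_Suc_eq)
  define z where "z = ev I ?o (rupdate ''best'' 0 (rmem w ''tot'' 0) (nupdate ''has'' 0 1 w))"
  have z: "marked I z ''out'' = S" "nmem z ''has'' 0 = 1" "rmem z ''best'' 0 = rmem w ''tot'' 0"
  proof -
    have "marked I z ''out'' = marked I u ''S''"
      using o[of "rupdate ''best'' 0 (rmem w ''tot'' 0) (nupdate ''has'' 0 1 w)"]
      by (auto simp: z_def marked_def fw)
    then show "marked I z ''out'' = S" by (simp add: fu)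
    show "nmem z ''has'' 0 = 1" "rmem z ''best'' 0 = rmem w ''tot'' 0"
      by (simp_all add: z_def nmem_ev rmem_ev)
  qed
  have ev: "ev I evaluate_prog s = (if nmem u ''g'' 0 < n \<and> independent I S then
      (if \<not> (nmem s ''has'' 0 \<noteq> 0 \<and> \<not> rmem w ''tot'' 0 < rmem s ''best'' 0) then z else w) else u)"
    by (simp add: evaluate_prog_def u_def[symmetric] w_def[symmetric] z_def[symmetric] fu fw)
  have gS: "nmem u ''g'' 0 < n \<longleftrightarrow> S \<noteq> {}" using ug Sn by (auto split: if_splits)
  have eq: "sound u \<longleftrightarrow> sound s" "sound w \<longleftrightarrow> sound s" "good thr u \<longleftrightarrow> good thr s" "good thr w \<longleftrightarrow> good thr s"
    by (simp_all add: sound_def good_def fu fw marked_def)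
  have sz: "S \<noteq> {} \<Longrightarrow> independent I S \<Longrightarrow> sound z" by (simp add: sound_def z w)
  show "sound (ev I evaluate_prog s)"
    unfolding ev gS using snd sz eq(1,2) by (simp split: if_split)
  show "good thr s \<Longrightarrow> good thr (ev I evaluate_prog s)"
    unfolding ev using eq(3,4) by (simp split: if_split) (auto simp: good_def z)
  show "S \<noteq> {} \<Longrightarrow> independent I S \<Longrightarrow> scost S \<le> thr \<Longrightarrow> good thr (ev I evaluate_prog s)"
    unfolding ev gS using w eq(4) by (simp split: if_split) (auto simp: good_def z)
qed

text \<open>The initial bound is known only for the points below \<open>n\<close>, where it is a
  minimum over the positions; the memory beyond is arbitrary. Hence the quantification over all
  \<open>cur\<close> with these properties.\<close>

definition word_ok :: "real \<Rightarrow> state \<Rightarrow> bool" where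
  "word_ok thr s \<longleftrightarrow> (\<forall>i<k. ps s i < n \<and> cs s i \<le> k) \<and>
     (\<forall>cur. (\<forall>x<n. \<exists>i<k. cur x = sd x (ps s i) + rs s i) \<longrightarrow>
            (\<forall>x<n. \<forall>i<k. cur x \<le> sd x (ps s i) + rs s i) \<longrightarrow>
       opened cur (ps s) (rs s) (cs s) k \<noteq> {} \<and> independent I (opened cur (ps s) (rs s) (cs s) k) \<and>
       scost (opened cur (ps s) (rs s) (cs s) k) \<le> thr)"

lemma word_spec:
  assumes s: "static s" and snd: "sound s"
  shows "sound (ev I word_prog s)" "good thr s \<Longrightarrow> good thr (ev I word_prog s)"
    and "1 \<le> k \<Longrightarrow> word_ok thr s \<Longrightarrow> good thr (ev I word_prog s)"
proof -
  let ?clr = "PFor ''x'' NPoints (PN ''S'' (nv ''x'') (NConst 0))"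
  let ?st = "PFor ''i'' (nv ''kk'') stage_prog"
  define a where "a = ev I ?clr (ev I bound_prog s)"
  define b where "b = ev I ?st a"
  have sb0: "static (ev I bound_prog s)" by (rule static_ev[OF s]) simp_all
  have sa: "static a" unfolding a_def by (rule static_ev[OF sb0]) simp_all
  have sb: "static b" unfolding b_def by (rule static_ev[OF sa]) simp_all
  have ev: "ev I word_prog s = ev I evaluate_prog b" by (simp add: word_prog_def a_def b_def)
  have "nmem b ''out'' = nmem s ''out''" "nmem b ''has'' = nmem s ''has''" "rmem b ''best'' = rmem s ''best''"
    by (simp_all add: a_def b_def nmem_ev rmem_ev)
  then have eq: "sound b \<longleftrightarrow> sound s" "good thr b \<longleftrightarrow> good thr s"
    by (simp_all add: sound_def good_def marked_def)
  have sndb: "sound b" using snd eq by simp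
  show "sound (ev I word_prog s)" "good thr s \<Longrightarrow> good thr (ev I word_prog s)"
    unfolding ev using evaluate_spec(1,2)[OF sb sndb] eq by simp_all
  assume k1: "1 \<le> k" and ok: "word_ok thr s"
  then have pc: "ps s i < n \<and> cs s i \<le> k" if "i < k" for i using that by (simp add: word_ok_def)
  define cur where "cur = rmem (ev I bound_prog s) ''cur''"
  have clr: "\<forall>x<nval I u NPoints. nmem (ev I ?clr u) ''S'' x = 0" for u
    by (rule ev_For_inv[where P = "\<lambda>i t. \<forall>x<i. nmem t ''S'' x = 0"]) (auto simp: less_Suc_eq)
  have fa: "nmem a ''dig'' = nmem s ''dig''" "nmem a ''T'' = nmem s ''T''" "rmem a ''gr'' = rmem s ''gr''"
    "rmem a ''cur'' = cur"
    by (simp_all add: a_def nmem_ev rmem_ev cur_def)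
  have mS: "marked I a ''S'' = {}" using clr[of "ev I bound_prog s"] by (simp add: a_def marked_def)
  let ?cur = "curs cur (ps s) (rs s) (cs s)" and ?op = "opened cur (ps s) (rs s) (cs s)"
  let ?P = "\<lambda>i t. (\<forall>x<n. rmem t ''cur'' x = ?cur i x) \<and> marked I t ''S'' = ?op i"
  have "?P (nval I a (nv ''kk'')) b" unfolding b_def
  proof (rule ev_For_inv[where P = ?P], goal_cases)
    case 2
    show ?case using fa mS by (simp add: marked_nupdate opened_def)
  next
    case (3 i t)
    have st: "static t" using sa 3(4,5) by (simp add: static_def)
    have i: "i < k" using 3(1) sa by (simp add: static_def)
    have e: "ps t i = ps s i" "rs t i = rs s i" "cs t i = cs s i"
      using 3(4,5) fa by (simp_all add: ps_def rs_def cs_def)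
    have cu: "rmem t ''cur'' x = ?cur i x" if "x < n" for x using 3(2) that by blast
    have "?P (Suc i) (ev I stage_prog t)"
      using stage_spec[OF st, of "?cur i"] 3(2) pc[OF i] cu unfolding 3(3) e
      by (simp add: opened_Suc Let_def)
    then show ?case by (simp add: marked_nupdate)
  qed simp_all
  then have "marked I b ''S'' = ?op k" using static_simps(1)[OF sa] by simp
  moreover have "?op k \<noteq> {} \<and> independent I (?op k) \<and> scost (?op k) \<le> thr"
    using ok bound_spec[OF s k1] pc unfolding word_ok_def cur_def by blast
  ultimately show "good thr (ev I word_prog s)"
    unfolding ev using evaluate_spec(3)[OF sb sndb] by simp
qed

lemma succ_spec:
  assumes s: "static s" and Y: "1 < Y" and dig: "\<forall>i<3 * k. nmem s ''dig'' i = c div Y ^ i mod Y"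
  shows "\<forall>i<3 * k. nmem (ev I succ_prog s) ''dig'' i = Suc c div Y ^ i mod Y"
proof -
  let ?q = "PFor ''i'' (nv ''M'') (ifp (pos (nv ''cy''))
       (PN ''dig'' (nv ''i'') (NAdd (NCell ''dig'' (nv ''i'')) (NConst 1));;
        PIf (NLess (NCell ''dig'' (nv ''i'')) (nv ''Y'')) (setn ''cy'' (NConst 0))
          (PN ''dig'' (nv ''i'') (NConst 0))))"
  let ?a = "nupdate ''cy'' 0 1 s"
  note st = static_simps(2,3)[OF s]
  \<comment> \<open>The digits below \<open>i\<close> already belong to the successor, the others
    still to \<open>c\<close>, and the carry is on exactly if all digits below \<open>i\<close> have
    overflowed.\<close>
  let ?P = "\<lambda>i t. (\<forall>i'<i. nmem t ''dig'' i' = Suc c div Y ^ i' mod Y) \<and>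
    (\<forall>i'. i \<le> i' \<longrightarrow> nmem t ''dig'' i' = nmem s ''dig'' i') \<and>
    (nmem t ''cy'' 0 \<noteq> 0 \<longleftrightarrow> Y ^ i dvd Suc c)"
  have "?P (nval I ?a (nv ''M'')) (ev I ?q ?a)"
  proof (rule ev_For_inv[where P = ?P], goal_cases)
    case (3 i t)
    let ?x = "c div Y ^ i"
    have i: "i < 3 * k" using 3(1) st by simp
    have di: "nmem t ''dig'' i = ?x mod Y" using 3(2) dig i by simp
    have Yt: "nmem t ''Y'' 0 = Y" using 3(4) st by simp
    have dv: "Suc c div Y ^ i = ?x + (if Y ^ i dvd Suc c then 1 else 0)" by (rule div_power_Suc_eq[OF Y])
    have dS: "Y ^ Suc i dvd Suc c \<longleftrightarrow> Y ^ i dvd Suc c \<and> Suc (?x mod Y) = Y"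
    proof (cases "Y ^ i dvd Suc c")
      case True
      then have "Suc c = (?x + 1) * Y ^ i" using dv by (metis dvd_div_mult_self)
      then have "Y ^ Suc i dvd Suc c \<longleftrightarrow> Y dvd ?x + 1" using Y by simp
      also have "\<dots> \<longleftrightarrow> Suc (?x mod Y) = Y"
        using Y by (metis Suc_eq_plus1 Suc_lessI bot_nat_0.extremum_strict dvd_imp_mod_0 mod_Suc mod_less_divisor mod_0_imp_dvd nat.distinct(1) zero_less_Suc less_trans)
      finally show ?thesis using True by simp
    next
      case False
      then show ?thesis by (metis dvd_trans le_imp_power_dvd lessI less_imp_le)
    qed
    have lt: "?x mod Y < Y" using Y by simp
    show ?case
    proof (cases "Y ^ i dvd Suc c")
      case True
      then have cy: "nmem t ''cy'' 0 \<noteq> 0" using 3(2) by simp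
      have dig': "Suc c div Y ^ i mod Y = (if Suc (?x mod Y) = Y then 0 else Suc (?x mod Y))"
        using True dv by (simp add: One_nat_def mod_Suc)
      show ?thesis
      proof (cases "Suc (?x mod Y) = Y")
        case eq: True
        then show ?thesis using 3(2,3) cy True dS di Yt dig' by (auto simp: less_Suc_eq)
      next
        case neq: False
        then have "Suc (?x mod Y) < Y" using lt by simp
        then show ?thesis using 3(2,3) cy True dS di Yt dig' neq by (auto simp: less_Suc_eq)
      qed
    next
      case False
      then have "nmem t ''cy'' 0 = 0" using 3(2) by simp
      moreover have "Suc c div Y ^ i mod Y = ?x mod Y" using dv False by simp
      ultimately show ?thesis using 3(2,3) False dS di by (auto simp: less_Suc_eq)
    qed
  qed simp_all
  moreover have "ev I succ_prog s = ev I ?q ?a" by (simp add: succ_prog_def)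
  ultimately show ?thesis using st by simp
qed

section \<open>Enumerating all guesses\<close>

text \<open>Lets the bound found in memory be replaced by a mathematically defined minimum that
  agrees with it on the points.\<close>

lemma run_cong:
  assumes "\<And>x. x < n \<Longrightarrow> cur x = cur' x"
    and "\<And>i'. i' < i \<Longrightarrow> p i' = p' i' \<and> r i' = r' i' \<and> c i' = c' i'"
  shows "x < n \<Longrightarrow> curs cur p r c i x = curs cur' p' r' c' i x"
    and "opened cur p r c i = opened cur' p' r' c' i"
proof -
  have "(\<forall>x<n. curs cur p r c i x = curs cur' p' r' c' i x) \<and> opened cur p r c i = opened cur' p' r' c' i"
    using assms(2)
  proof (induction i)
    case 0
    then show ?case using assms(1) by (simp add: opened_def)
  next
    case (Suc i)
    then have IH: "\<forall>x<n. curs cur p r c i x = curs cur' p' r' c' i x" "opened cur p r c i = opened cur' p' r' c' i"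
      by auto
    have "trunc_cost (curs cur p r c i) = trunc_cost (curs cur' p' r' c' i)"
      by (rule trunc_cost_cong) (use IH(1) in simp)
    then have "choice_of (curs cur p r c i) (p i) (r i) (c i) = choice_of (curs cur' p' r' c' i) (p' i) (r' i) (c' i)"
      using Suc.prems[of i] by (simp add: choice_of_def)
    then show ?case using IH by (simp add: opened_Suc Let_def)
  qed
  then show "x < n \<Longrightarrow> curs cur p r c i x = curs cur' p' r' c' i x"
    "opened cur p r c i = opened cur' p' r' c' i" by blast+
qed

text \<open>Stated apart from \<open>words_spec\<close> to cover rank zero, where \<open>Y\<close>
  is 0.\<close>

lemma words_sound:
  assumes s: "static s" and snd: "sound s"
  shows "sound (ev I words_prog s)"
proof -
  let ?z = "PFor ''i'' (nv ''M'') (PN ''dig'' (nv ''i'') (NConst 0))"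
  let ?q = "PFor ''cnt'' (nv ''PW'') (word_prog;; succ_prog)"
  have sz: "static (ev I ?z s)" by (rule static_ev[OF s]) simp_all
  have "sound (ev I ?q (ev I ?z s))"
  proof (rule ev_For_inv[where P = "\<lambda>j. sound"], goal_cases)
    case 2
    then show ?case using snd by (simp add: sound_def marked_def nmem_ev rmem_ev)
  next
    case (3 j t)
    have "static t" using sz 3(4,5) by (simp add: static_def)
    then have "sound (ev I word_prog t)" using word_spec(1) 3(2) by blast
    then show ?case by (simp add: sound_def marked_def nmem_ev rmem_ev)
  qed simp
  then show ?thesis by (simp add: words_prog_def)
qed

lemma guess_sound:
  assumes t: "static t" "sound t"
  shows "sound (ev I guess_prog t)"
proof -
  have "static (ev I leaders_prog t)" by (rule static_ev[OF t(1)]) simp_all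
  then have "static (ev I grid_prog (ev I leaders_prog t))" by (rule static_ev) simp_all
  moreover have "sound (ev I grid_prog (ev I leaders_prog t))"
    using t(2) by (simp add: sound_def marked_def nmem_ev rmem_ev)
  ultimately show ?thesis using words_sound t(2) by (simp add: guess_prog_def)
qed

text \<open>The word with number \<open>w\<close> is evaluated in iteration \<open>w\<close>, and
  \<open>good\<close> persists from there. At that moment the state is known only through its
  digits, the list and the grid; so the hypothesis speaks of all states that decode to the same
  leaders, radii and positions.\<close>

lemma words_spec:
  assumes s: "static s" and snd: "sound s" and Y: "1 < Y"
  shows "good thr s \<Longrightarrow> good thr (ev I words_prog s)"
    and "\<lbrakk>1 \<le> k; \<And>i. i < 3 * k \<Longrightarrow> dg i < Y;
      \<And>t. \<lbrakk>\<And>i. i < k \<Longrightarrow> ps t i = nmem s ''T'' (dg i) \<and> rs t i = rmem s ''gr'' (dg (i + k)) \<and>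
             cs t i = dg (i + (k + k))\<rbrakk> \<Longrightarrow> word_ok thr t\<rbrakk> \<Longrightarrow> good thr (ev I words_prog s)"
proof -
  let ?z = "PFor ''i'' (nv ''M'') (PN ''dig'' (nv ''i'') (NConst 0))"
  let ?q = "PFor ''cnt'' (nv ''PW'') (word_prog;; succ_prog)"
  define a where "a = ev I ?z s"
  have a: "\<forall>i<nval I s (nv ''M''). nmem a ''dig'' i = 0"
    unfolding a_def
    by (rule ev_For_inv[where P = "\<lambda>i t. \<forall>i'<i. nmem t ''dig'' i' = 0"]) (auto simp: less_Suc_eq)
  have sa: "static a" unfolding a_def by (rule static_ev[OF s]) simp_all
  have fa: "nmem a y = nmem s y" if "y \<notin> {''i'', ''dig''}" for y
    using that by (simp add: a_def nmem_ev)
  have ra: "rmem a = rmem s" by (simp add: a_def rmem_ev fun_eq_iff)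
  have eqa: "sound a \<longleftrightarrow> sound s" "good thr a \<longleftrightarrow> good thr s"
    using fa[of "''out''"] fa[of "''has''"] ra by (simp_all add: sound_def good_def marked_def)
  have M: "nmem s ''M'' 0 = 3 * k" and PW: "nmem a ''PW'' 0 = Y ^ (3 * k)"
    using static_simps(2)[OF s] static_simps(4)[OF sa] by auto
  have ev: "ev I words_prog s = ev I ?q a" by (simp add: words_prog_def a_def)
  have step: "sound (nupdate ''cnt'' 0 j (ev I (word_prog;; succ_prog) t)) \<longleftrightarrow> sound (ev I word_prog t)"
    "good thr (nupdate ''cnt'' 0 j (ev I (word_prog;; succ_prog) t)) \<longleftrightarrow> good thr (ev I word_prog t)" for j t
    by (simp_all add: sound_def good_def marked_def nmem_ev rmem_ev)
  have digs: "\<forall>i<3 * k. nmem (nupdate ''cnt'' 0 j (ev I (word_prog;; succ_prog) t)) ''dig'' i = Suc c div Y ^ i mod Y"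
    if t: "static t" "\<forall>i<3 * k. nmem t ''dig'' i = c div Y ^ i mod Y" for j t c
  proof -
    have "static (ev I word_prog t)" by (rule static_ev[OF t(1)]) simp_all
    moreover have "\<forall>i<3 * k. nmem (ev I word_prog t) ''dig'' i = c div Y ^ i mod Y"
      using t(2) by (simp add: nmem_ev)
    ultimately show ?thesis using succ_spec[OF _ Y] by simp
  qed
  let ?P = "\<lambda>c t. sound t \<and> (\<forall>i<3 * k. nmem t ''dig'' i = c div Y ^ i mod Y) \<and> (good thr s \<longrightarrow> good thr t)"
  have P0: "?P 0 (nupdate ''cnt'' 0 0 a)"
  proof -
    have "sound (nupdate ''cnt'' 0 0 a) \<longleftrightarrow> sound a" "good thr (nupdate ''cnt'' 0 0 a) \<longleftrightarrow> good thr a"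
      by (simp_all add: sound_def good_def marked_def)
    moreover have "\<forall>i<3 * k. nmem (nupdate ''cnt'' 0 0 a) ''dig'' i = 0 div Y ^ i mod Y"
      using a M by simp
    ultimately show ?thesis using snd eqa by simp
  qed
  have Pstep: "?P (Suc c) (nupdate ''cnt'' 0 (Suc c) (ev I (word_prog;; succ_prog) t))"
    if "?P c t" "static t" for c t
  proof (intro conjI impI)
    have t: "sound t" "\<forall>i<3 * k. nmem t ''dig'' i = c div Y ^ i mod Y" "good thr s \<Longrightarrow> good thr t"
      using that(1) by blast+
    show "sound (nupdate ''cnt'' 0 (Suc c) (ev I (word_prog;; succ_prog) t))"
      unfolding step(1) by (rule word_spec(1)[OF that(2) t(1)])
    show "\<forall>i<3 * k. nmem (nupdate ''cnt'' 0 (Suc c) (ev I (word_prog;; succ_prog) t)) ''dig'' i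
        = Suc c div Y ^ i mod Y" by (rule digs[OF that(2) t(2)])
    assume "good thr s"
    then show "good thr (nupdate ''cnt'' 0 (Suc c) (ev I (word_prog;; succ_prog) t))"
      unfolding step(2) by (intro word_spec(2)[OF that(2) t(1)] t(3))
  qed
  have "?P (nval I a (nv ''PW'')) (ev I ?q a)"
  proof (rule ev_For_inv[where P = ?P], goal_cases)
    case 1
    then show ?case by simp
  next
    case 2
    then show ?case by (rule P0)
  next
    case (3 c t)
    have "static t" using sa 3(4,5) by (simp add: static_def)
    with 3(2) show ?case by (rule Pstep)
  qed
  then show "good thr s \<Longrightarrow> good thr (ev I words_prog s)"
    unfolding ev by blast+
  assume k1: "1 \<le> k" and dg: "\<And>i. i < 3 * k \<Longrightarrow> dg i < Y"
    and word: "\<And>t. \<lbrakk>\<And>i. i < k \<Longrightarrow> ps t i = nmem s ''T'' (dg i) \<and> rs t i = rmem s ''gr'' (dg (i + k)) \<and>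
             cs t i = dg (i + (k + k))\<rbrakk> \<Longrightarrow> word_ok thr t"
  obtain w where w: "w < Y ^ (3 * k)" "\<forall>i<3 * k. w div Y ^ i mod Y = dg i"
    using exists_number_with_digits[of "3 * k" dg Y] dg by blast
  let ?R = "\<lambda>c t. ?P c t \<and> (w < c \<longrightarrow> good thr t)"
  have "?R (nval I a (nv ''PW'')) (ev I ?q a)"
  proof (rule ev_For_inv[where P = ?R], goal_cases)
    case 1
    then show ?case by simp
  next
    case 2
    then show ?case using P0 by blast
  next
    case (3 c t)
    have st: "static t" using sa 3(4,5) by (simp add: static_def)
    have sndt: "sound t" using 3(2) by blast
    have "good thr (ev I word_prog t)" if "w < Suc c"
    proof (cases "w = c")
      case False
      then show ?thesis using word_spec(2)[OF st sndt] 3(2) that by simp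
    next
      case True
      have fr: "nmem t ''T'' = nmem s ''T''" "rmem t ''gr'' = rmem s ''gr''"
        using 3(4,5) fa ra by simp_all
      have d: "nmem t ''dig'' i = dg i" if "i < 3 * k" for i using 3(2) w(2) True that by simp
      have ag: "ps t i = nmem s ''T'' (dg i) \<and> rs t i = rmem s ''gr'' (dg (i + k)) \<and>
             cs t i = dg (i + (k + k))" if "i < k" for i
        using d[of i] d[of "i + k"] d[of "i + (k + k)"] that fr by (simp add: ps_def rs_def cs_def)
      show ?thesis by (rule word_spec(3)[OF st sndt k1 word[OF ag]])
    qed
    moreover have "?P (Suc c) (nupdate ''cnt'' 0 (Suc c) (ev I (word_prog;; succ_prog) t))"
      using Pstep[OF _ st] 3(2) by blast
    ultimately show ?case unfolding step by blast
  qed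
  then show "good thr (ev I words_prog s)" unfolding ev using w(1) PW by simp
qed

section \<open>Analysis of the right guess\<close>

text \<open>One base serves all three kinds of digits. It must exceed the positions, which are at
  most \<open>k\<close>, and leave room for the grid blocks up to exponent
  \<open>2 * (lg - 1) + m\<close>.\<close>

lemma Y_large:
  assumes "1 \<le> k"
  shows "k < Y" "m * (2 * (lg - 1) + m + 1) \<le> Y" "1 < Y"
proof -
  have "m * 1 * 1 \<le> m * (m + 1) * k" using assms by (intro mult_le_mono) auto
  then have Qm: "m \<le> Q" by (simp add: Q_def)
  have "m * (m + 1) \<le> Q" using assms by (simp add: Q_def)
  then have QZ: "m * (m + 1) * lg \<le> Z" unfolding Z_def by (rule mult_le_mono1)
  have "m * 1 \<le> Q * lg" using Qm lg1 by (intro mult_le_mono) auto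
  then have Zm: "m \<le> Z" by (simp add: Z_def)
  have "2 * Z \<le> m * Z" using m9 by simp
  also have "\<dots> \<le> Y" unfolding Y_def using Zm by simp
  finally have Z2: "2 * Z \<le> Y" .
  have "2 * (lg - 1) + m + 1 \<le> 2 * ((m + 1) * lg)"
  proof -
    have "m \<le> m * lg" using lg1 by simp
    moreover have "2 * ((m + 1) * lg) = 2 * (m * lg) + 2 * lg" by (simp add: algebra_simps)
    ultimately show ?thesis using lg1 by linarith
  qed
  then have "m * (2 * (lg - 1) + m + 1) \<le> m * (2 * ((m + 1) * lg))" by (rule mult_le_mono2)
  also have "\<dots> = 2 * (m * (m + 1) * lg)" by (simp only: mult_ac)
  also have "\<dots> \<le> 2 * Z" using QZ by (rule mult_le_mono2)
  finally show "m * (2 * (lg - 1) + m + 1) \<le> Y" using Z2 by simp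
  have "1 * 1 * k * 1 \<le> m * (m + 1) * k * lg" using m9 lg1 by (intro mult_le_mono) auto
  then have "k \<le> Z" by (simp add: Z_def Q_def)
  then show "k < Y" "1 < Y" using Z2 Zm m9 assms by linarith+
qed

text \<open>On the scale \<open>N = n * m\<close> the bound of a client of \<open>f\<close> is at
  most \<open>N * d j f + (2 + 2 / m) * N * d p f + D\<close>: one \<open>d p f\<close> comes from
  the triangle inequality, the other, with factor \<open>1 + 2 / m\<close>, from the rounded radius.
  Summed up this is about \<open>3 * N * opt\<close>; averaging with the optimum as in
  \<open>good_word_cost\<close> leaves about \<open>2 * N * opt\<close>.\<close>

lemma guess_spec:
  assumes s: "static s" and snd: "sound s" and k1: "1 \<le> k"
    and uv: "nmem s ''u'' 0 < n" "nmem s ''v'' 0 < n" and D: "D = d (nmem s ''u'' 0) (nmem s ''v'' 0)"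
  shows "good thr s \<Longrightarrow> good thr (ev I guess_prog s)"
    and "\<lbrakk>0 < D; C \<noteq> {}; independent I (\<pi> ` C); \<And>j. j \<in> C \<Longrightarrow> d j (\<pi> j) \<le> D; D \<le> (\<Sum>j\<in>C. d j (\<pi> j))\<rbrakk> \<Longrightarrow>
      good (real (n * m) * ((2 + 11 / real m) * (\<Sum>j\<in>C. d j (\<pi> j)))) (ev I guess_prog s)"
proof -
  note Y1 = Y_large[OF k1]
  define a where "a = ev I leaders_prog s"
  define b where "b = ev I grid_prog a"
  have sa: "static a" unfolding a_def by (rule static_ev[OF s]) simp_all
  have sb: "static b" unfolding b_def by (rule static_ev[OF sa]) simp_all
  have "nmem b ''out'' = nmem s ''out''" "nmem b ''has'' = nmem s ''has''" "rmem b ''best'' = rmem s ''best''"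
    by (simp_all add: a_def b_def nmem_ev rmem_ev)
  then have eq: "sound b \<longleftrightarrow> sound s" "good thr b \<longleftrightarrow> good thr s" for thr
    by (simp_all add: sound_def good_def marked_def)
  have sndb: "sound b" using eq snd by simp
  have ev: "ev I guess_prog s = (if 0 < D then ev I words_prog b else s)"
    by (simp add: guess_prog_def a_def b_def D)
  show "good thr s \<Longrightarrow> good thr (ev I guess_prog s)"
    unfolding ev using words_spec(1)[OF sb sndb Y1(3)] eq by simp
  assume D0: "0 < D" and C0: "C \<noteq> {}" and ind: "independent I (\<pi> ` C)"
    and \<pi>D: "\<And>j. j \<in> C \<Longrightarrow> d j (\<pi> j) \<le> D" and Dopt: "D \<le> (\<Sum>j\<in>C. d j (\<pi> j))"
  define opt where "opt = (\<Sum>j\<in>C. d j (\<pi> j))"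
  define N where "N = real (n * m)"
  define l where "l = card (\<pi> ` C)"
  let ?T = "nmem b ''T''" and ?gr = "rmem b ''gr''"
  have n0: "0 < n" using uv by simp
  have m0: "0 < real m" "0 < real k" using m9 k1 by auto
  have N0: "0 < N" using n0 m9 by (simp add: N_def)
  have opt0: "D \<le> opt" "0 < opt" using Dopt D0 by (simp_all add: opt_def)
  have \<pi>n: "\<pi> j < n" if "j \<in> C" for j using indep_less[OF ind] that by blast
  have lk: "l \<le> k" unfolding l_def by (rule card_indep_le[OF ind])
  have l1: "1 \<le> l"
  proof -
    have "0 < card (\<pi> ` C)" using C0 fin_C by (simp add: card_gt_0_iff)
    then show ?thesis by (simp add: l_def)
  qed
  obtain f where f: "bij_betw f {..<l} (\<pi> ` C)"
    using ex_bij_betw_nat_finite[of "\<pi> ` C"] fin_C unfolding l_def lessThan_atLeast0 by auto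
  have finj: "inj_on f {..<l}" and fim: "f ` {..<l} = \<pi> ` C"
    using f by (auto simp: bij_betw_def)
  have "\<forall>j\<in>C. \<exists>i<l. f i = \<pi> j"
  proof
    fix j assume "j \<in> C"
    then have "\<pi> j \<in> f ` {..<l}" unfolding fim by simp
    then show "\<exists>i<l. f i = \<pi> j" by auto
  qed
  then obtain cl where cl: "\<And>j. j \<in> C \<Longrightarrow> cl j < l \<and> f (cl j) = \<pi> j" by metis
  let ?B = "\<lambda>f. {j\<in>C. \<pi> j = f}"
  have fC: "f i \<in> \<pi> ` C" if "i < l" for i using that fim by blast
  have fn: "f i < n" if "i < l" for i using fC[OF that] \<pi>n by auto
  have T: "?T = nmem a ''T''" by (simp add: b_def nmem_ev)
  let ?near = "\<lambda>i e. e < Y \<and> ?T e < n \<and>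
      real (card (?B (f i))) * d (?T e) (f i)
        \<le> (1 + 1 / real m) * (\<Sum>j\<in>?B (f i). d j (f i)) + 7 * opt / (real m * real k) \<and>
      d (?T e) (f i) \<le> N * D"
  have "\<forall>i. \<exists>e. i < l \<longrightarrow> ?near i e"
  proof
    fix i
    show "\<exists>e. i < l \<longrightarrow> ?near i e"
    proof (cases "i < l")
      case True
      have "card (\<pi> ` C) \<le> k" using lk by (simp add: l_def)
      then show ?thesis
        using leaders_spec[OF s k1 uv D D0, of \<pi> opt "f i"] \<pi>n \<pi>D opt0(1) fC[OF True] opt_def
        unfolding T a_def N_def by blast
    qed simp
  qed
  from choice[OF this] obtain e where "\<forall>i. i < l \<longrightarrow> ?near i (e i)" ..
  note e = this[rule_format]
  let ?round = "\<lambda>i b. b < Y \<and> sd (?T (e i)) (f i) \<le> ?gr b \<and>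
      ?gr b \<le> (1 + 2 / real m) * sd (?T (e i)) (f i) + D"
  have "\<forall>i. \<exists>b. i < l \<longrightarrow> ?round i b"
  proof
    fix i
    show "\<exists>b. i < l \<longrightarrow> ?round i b"
    proof (cases "i < l")
      case True
      let ?x = "sd (?T (e i)) (f i)" and ?t = "2 * (lg - 1) + m"
      have Da: "D = d (nmem a ''u'' 0) (nmem a ''v'' 0)" by (simp add: D a_def nmem_ev)
      note gs = grid_spec[OF sa Da, folded b_def]
      \<comment> \<open>Leaders lie within \<open>N * D\<close> in the original metric. On the scale
        this is \<open>N * N * D\<close>, or \<open>n * n * m\<close> times the end
        \<open>m * D\<close> of the first block.\<close>
      have "?x \<le> N * (N * D)" using e[OF True] N0 unfolding sd_def N_def[symmetric] by (intro mult_left_mono) auto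
      also have "\<dots> = (real n * real n * real m) * (real m * D)" by (simp add: N_def)
      also have "\<dots> \<le> 2 ^ ?t * (real m * D)"
      proof (rule mult_right_mono)
        have "real n * real n * real m \<le> 2 ^ (lg - 1) * 2 ^ (lg - 1) * 2 ^ m"
          by (intro mult_mono n_le_real m_le_real) auto
        also have "\<dots> = 2 ^ ?t" by (simp add: mult_2 power_add)
        finally show "real n * real n * real m \<le> 2 ^ ?t" .
        show "0 \<le> real m * D" using D0 by simp
      qed
      finally have x: "?x \<le> 2 ^ ?t * real m * D" by (simp add: mult.assoc)
      have "\<exists>b<Y. ?x \<le> ?gr b \<and> ?gr b \<le> (1 + 2 / real m) * ?x + D"
        by (rule grid_rounding[where t = ?t]) (use m9 D0 gs x Y1(2) sd_nonneg in simp_all)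
      then show ?thesis by blast
    qed simp
  qed
  from choice[OF this] obtain h where "\<forall>i. i < l \<longrightarrow> ?round i (h i)" ..
  note h = this[rule_format]
  \<comment> \<open>Positions beyond the \<open>l\<close> facilities in use copy position 0, which
    does not change the minimum over the positions.\<close>
  define \<iota> where "\<iota> i = (if i < l then i else 0)" for i
  have \<iota>: "\<iota> i < l" for i using l1 by (simp add: \<iota>_def)
  define p where "p i = ?T (e (\<iota> i))" for i
  define r where "r i = ?gr (h (\<iota> i))" for i
  define cur where "cur x = Min ((\<lambda>i. sd x (p i) + r i) ` {..<k})" for x
  have ne: "(\<lambda>i. sd x (p i) + r i) ` {..<k} \<noteq> {}" for x
  proof -
    have "0 \<in> {..<k}" using k1 by simp
    then show ?thesis by blast
  qed
  have cur1: "\<exists>i<k. cur x = sd x (p i) + r i" for x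
    using Min_in[OF _ ne[of x]] unfolding cur_def by auto
  have cur2: "cur x \<le> sd x (p i) + r i" if "i < k" for x i
    unfolding cur_def by (rule Min_le) (use that in auto)
  have "\<exists>c. (\<forall>i. c i \<le> k) \<and> independent I (opened cur p r c k) \<and> opened cur p r c k \<noteq> {} \<and>
    2 * scost (opened cur p r c k) \<le> sum cur C + (\<Sum>j\<in>C. sd j (f (cl j)))"
  proof (rule good_word_cost[where f = f and cl = cl and p = p and r = r, OF l1 lk])
    show "p i < n" for i using e[OF \<iota>] by (simp add: p_def)
    show "f i \<in> ball (p i) (r i)" if "i < l" for i
      using h[OF that] fn[OF that] that by (simp add: ball_def p_def r_def \<iota>_def)
    show "independent I (f ` {..<l})" unfolding fim by (rule ind)
    show "p i = p 0 \<and> r i = r 0" if "l \<le> i" for i using that by (simp add: p_def r_def \<iota>_def)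
  qed (use finj cur1 cl in auto)
  then obtain c where c: "\<forall>i. c i \<le> k" "independent I (opened cur p r c k)" "opened cur p r c k \<noteq> {}"
    "2 * scost (opened cur p r c k) \<le> sum cur C + (\<Sum>j\<in>C. sd j (f (cl j)))" by blast
  have sdN: "sd x y = N * d x y" for x y by (simp add: sd_def N_def)
  have c4: "(\<Sum>j\<in>C. sd j (f (cl j))) = N * opt"
    using cl by (simp add: sdN opt_def sum_distrib_left)
  \<comment> \<open>Of the 8, one comes from the factor \<open>1 + 1 / m\<close> of the cluster
    bound, and seven from at most \<open>k\<close> error terms
    \<open>7 * opt / (m * k)\<close>.\<close>
  have \<delta>: "(\<Sum>j\<in>C. d (p (cl j)) (f (cl j))) \<le> (1 + 8 / real m) * opt"
  proof -
    obtain q where q: "\<And>j. j \<in> C \<Longrightarrow> p (cl j) = q (\<pi> j)"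
    proof -
      define q where "q y = p (inv_into {..<l} f y)" for y
      have "q (\<pi> j) = p (cl j)" if "j \<in> C" for j
        using cl[OF that] inv_into_f_f[OF finj, of "cl j"] by (simp add: q_def)
      then show ?thesis using that[of q] by simp
    qed
    have "(\<Sum>j\<in>C. d (p (cl j)) (f (cl j))) = (\<Sum>j\<in>C. d (q (\<pi> j)) (\<pi> j))"
      by (intro sum.cong refl) (simp add: q cl)
    also have "\<dots> = (\<Sum>y\<in>\<pi> ` C. real (card (?B y)) * d (q y) y)"
      by (rule sum_over_fibres[OF fin_C])
    also have "\<dots> \<le> (\<Sum>y\<in>\<pi> ` C. (1 + 1 / real m) * (\<Sum>j\<in>?B y. d j y) + 7 * opt / (real m * real k))"
    proof (rule sum_mono)
      fix y assume "y \<in> \<pi> ` C"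
      then obtain j where j: "j \<in> C" "y = \<pi> j" by blast
      then have y: "y = f (cl j)" "cl j < l" using cl by auto
      have "q y = ?T (e (cl j))" using q[OF j(1)] j(2) y(2) by (simp add: p_def \<iota>_def)
      then show "real (card (?B y)) * d (q y) y
          \<le> (1 + 1 / real m) * (\<Sum>j\<in>?B y. d j y) + 7 * opt / (real m * real k)"
        using e[OF y(2)] y(1) by simp
    qed
    also have "\<dots> = (1 + 1 / real m) * (\<Sum>y\<in>\<pi> ` C. \<Sum>j\<in>?B y. d j y) + real l * (7 * opt / (real m * real k))"
      by (simp add: sum.distrib sum_distrib_left l_def)
    also have "(\<Sum>y\<in>\<pi> ` C. \<Sum>j\<in>?B y. d j y) = opt"
    proof -
      have "opt = (\<Sum>y\<in>\<pi> ` C. \<Sum>j\<in>?B y. d j (\<pi> j))"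
        unfolding opt_def by (rule sum.image_gen[OF fin_C])
      also have "\<dots> = (\<Sum>y\<in>\<pi> ` C. \<Sum>j\<in>?B y. d j y)" by (intro sum.cong refl) auto
      finally show ?thesis by simp
    qed
    also have "(1 + 1 / real m) * opt + real l * (7 * opt / (real m * real k))
        \<le> (1 + 1 / real m) * opt + real k * (7 * opt / (real m * real k))"
      using lk opt0 by (intro add_left_mono mult_right_mono) auto
    also have "\<dots> = (1 + 8 / real m) * opt" using m0 by (simp add: field_simps)
    finally show ?thesis .
  qed
  have "sum cur C \<le> (\<Sum>j\<in>C. N * d j (\<pi> j) + (2 + 2 / real m) * (N * d (p (cl j)) (f (cl j))) + D)"
  proof (rule sum_mono)
    fix j assume j: "j \<in> C"
    let ?i = "cl j"
    have i: "?i < l" "f ?i = \<pi> j" using cl[OF j] by auto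
    have pi: "p ?i = ?T (e ?i)" "r ?i = ?gr (h ?i)" using i by (simp_all add: p_def r_def \<iota>_def)
    have pn: "p ?i < n" using e[OF i(1)] pi by simp
    have "cur j \<le> sd j (p ?i) + r ?i" using cur2 i lk by simp
    also have "\<dots> \<le> (sd j (f ?i) + sd (f ?i) (p ?i)) + ((1 + 2 / real m) * sd (p ?i) (f ?i) + D)"
      using h[OF i(1)] sd_triangle[OF client_less[OF j] fn[OF i(1)] pn] unfolding pi[symmetric]
      by (intro add_mono) auto
    also have "\<dots> = N * d j (\<pi> j) + (2 + 2 / real m) * (N * d (p ?i) (f ?i)) + D"
      unfolding sdN i(2) commute[of "\<pi> j" "p ?i"] by (simp add: algebra_simps)
    finally show "cur j \<le> N * d j (\<pi> j) + (2 + 2 / real m) * (N * d (p (cl j)) (f (cl j))) + D" .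
  qed
  also have "\<dots> = N * opt + (2 + 2 / real m) * (N * (\<Sum>j\<in>C. d (p (cl j)) (f (cl j)))) + real (card C) * D"
    by (simp add: sum.distrib sum_distrib_left opt_def)
  also have "\<dots> \<le> N * opt + (2 + 2 / real m) * (N * ((1 + 8 / real m) * opt)) + real n * opt"
  proof (intro add_mono order_refl mult_left_mono \<delta>)
    have "card C \<le> n" using card_mono[OF _ C_sub] by simp
    then show "real (card C) * D \<le> real n * opt" using opt0 D0 by (intro mult_mono) auto
  qed (use N0 in auto)
  \<comment> \<open>Here the scaling pays off: the rounding errors \<open>D\<close> of all clients
    add up to only \<open>1 / m\<close> of the scaled optimum.\<close>
  also have "real n * opt = N * (opt / real m)" using m0 by (simp add: N_def)
  finally have "2 * scost (opened cur p r c k) \<le>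
      N * opt + (2 + 2 / real m) * (N * ((1 + 8 / real m) * opt)) + N * (opt / real m) + N * opt"
    using c(4) c4 by simp
  also have "\<dots> = N * ((2 + (2 + 2 / real m) * (1 + 8 / real m) + 1 / real m) * opt)"
  proof -
    have "N * opt + a * (N * (b * opt)) + N * (opt / real m) + N * opt = N * ((2 + a * b + 1 / real m) * opt)"
      for a b by (simp add: algebra_simps)
    then show ?thesis .
  qed
  also have "\<dots> \<le> N * ((4 + 22 / real m) * opt)"
  proof (intro mult_left_mono mult_right_mono)
    \<comment> \<open>The product contributes \<open>18 / m\<close> and the second-order term
      \<open>16 / (m * m)\<close>, which is at most \<open>3 / m\<close>; with the rounding term
      \<open>1 / m\<close> this makes \<open>22 / m\<close>, to be halved to
      \<open>11 / m\<close>.\<close>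
    have "16 / (real m * real m) \<le> 3 / real m" using m9 by (simp add: field_simps)
    moreover have "(2 + 2 / real m) * (1 + 8 / real m) = 2 + 18 / real m + 16 / (real m * real m)"
      using m0 by (simp add: field_simps)
    moreover have "18 / real m + 3 / real m + 1 / real m = 22 / real m" by simp
    ultimately show "2 + (2 + 2 / real m) * (1 + 8 / real m) + 1 / real m \<le> 4 + 22 / real m" by linarith
  qed (use N0 opt0 in auto)
  also have "\<dots> = 2 * (N * ((2 + 11 / real m) * opt))"
  proof -
    have "4 + 22 / real m = 2 * (2 + 11 / real m)" by simp
    then show ?thesis by (simp only: mult_ac)
  qed
  finally have cost: "scost (opened cur p r c k) \<le> N * ((2 + 11 / real m) * opt)"
    by (simp only: mult_le_cancel_left_pos zero_less_numeral)
  define dg where "dg i = (if i < k then e (\<iota> i) else if i < k + k then h (\<iota> (i - k)) else c (i - (k + k)))" for i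
  have "good (N * ((2 + 11 / real m) * opt)) (ev I words_prog b)"
  proof (rule words_spec(2)[OF sb sndb Y1(3) k1, where dg = dg])
    fix i assume "i < 3 * k"
    show "dg i < Y" using e[OF \<iota>] h[OF \<iota>] c(1) Y1(1) by (auto simp: dg_def intro: le_less_trans)
  next
    fix t assume "\<And>i. i < k \<Longrightarrow> ps t i = ?T (dg i) \<and> rs t i = ?gr (dg (i + k)) \<and> cs t i = dg (i + (k + k))"
    then have t: "ps t i = p i \<and> rs t i = r i \<and> cs t i = c i" if "i < k" for i
      using that by (simp add: dg_def p_def r_def)
    show "word_ok (N * ((2 + 11 / real m) * opt)) t"
      unfolding word_ok_def
    proof (intro conjI allI impI)
      fix i assume i: "i < k"
      show "ps t i < n" using t[OF i] e[OF \<iota>] by (simp add: p_def)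
      show "cs t i \<le> k" using t[OF i] c(1) by simp
    next
      fix cur'
      assume 1: "\<forall>x<n. \<exists>i<k. cur' x = sd x (ps t i) + rs t i"
        and 2: "\<forall>x<n. \<forall>i<k. cur' x \<le> sd x (ps t i) + rs t i"
      have "cur' x = cur x" if x: "x < n" for x
      proof (rule antisym)
        obtain i where i: "i < k" "cur x = sd x (p i) + r i" using cur1 by blast
        have "cur' x \<le> sd x (ps t i) + rs t i" using 2 x i(1) by blast
        then show "cur' x \<le> cur x" using i t[of i] by simp
        obtain i where "i < k" "cur' x = sd x (ps t i) + rs t i" using 1 x by blast
        then show "cur x \<le> cur' x" using cur2[of i x] t[of i] by simp
      qed
      then have "opened cur' (ps t) (rs t) (cs t) k = opened cur p r c k"
        using t by (intro run_cong(2)) auto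
      then show "opened cur' (ps t) (rs t) (cs t) k \<noteq> {}" "independent I (opened cur' (ps t) (rs t) (cs t) k)"
        "scost (opened cur' (ps t) (rs t) (cs t) k) \<le> N * ((2 + 11 / real m) * opt)"
        using c cost by simp_all
    qed
  qed
  then show "good (real (n * m) * ((2 + 11 / real m) * (\<Sum>j\<in>C. d j (\<pi> j)))) (ev I guess_prog s)"
    unfolding ev using D0 by (simp add: N_def opt_def)
qed


section \<open>Costs, the optimum and the main loop\<close>

lemma scost_eq: "F \<noteq> {} \<Longrightarrow> finite F \<Longrightarrow> scost F = real (n * m) * (\<Sum>j\<in>C. Min (d j ` F))"
proof -
  assume F: "F \<noteq> {}" "finite F"
  have "Min (sd j ` F) = real (n * m) * Min (d j ` F)" for j
  proof -
    have "mono (\<lambda>x. real (n * m) * x)" by (intro monoI mult_left_mono) auto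
    then have "real (n * m) * Min (d j ` F) = Min ((\<lambda>x. real (n * m) * x) ` d j ` F)"
      by (rule mono_Min_commute) (use F in auto)
    then show ?thesis by (simp add: sd_def image_image)
  qed
  then show ?thesis by (simp add: scost_def sum_distrib_left)
qed

lemma mm_cost_eq:
  assumes "F \<noteq> {}" "finite F"
  shows "mm_cost I F = ereal (\<Sum>j\<in>C. Min (d j ` F))"
proof -
  have "connection_cost I j F = ereal (Min (d j ` F))" for j
  proof -
    have "connection_cost I j F = Min ((\<lambda>f. ereal (d j f)) ` F)"
      unfolding connection_cost_def using assms by (simp add: cInf_eq_Min)
    also have "\<dots> = Min (ereal ` d j ` F)" by (simp add: image_image)
    also have "\<dots> = ereal (Min (d j ` F))"
      by (rule mono_Min_commute[symmetric]) (use assms in \<open>auto intro: monoI\<close>)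
    finally show ?thesis .
  qed
  then show ?thesis by (simp add: mm_cost_def)
qed

lemma mm_opt_attained: "\<exists>F. independent I F \<and> mm_opt I = mm_cost I F"
proof -
  have fin: "finite (mm_cost I ` {F. independent I F})" using finite_indep_sets by simp
  have ne: "mm_cost I ` {F. independent I F} \<noteq> {}" using indep_empty by auto
  have "mm_opt I = Min (mm_cost I ` {F. independent I F})"
    unfolding mm_opt_def by (rule cInf_eq_Min[OF fin ne])
  then show ?thesis using Min_in[OF fin ne] by auto
qed

text \<open>The iteration for the pair \<open>u\<close>, \<open>v\<close> makes the state good, and
  the pairs that follow keep it so.\<close>

lemma guesses_spec:
  assumes s: "static s" and snd: "sound s" and k1: "1 \<le> k" and C0: "C \<noteq> {}" and ind: "independent I (\<pi> ` C)"
    and D: "u < n" "v < n" "0 < d u v" "\<And>j. j \<in> C \<Longrightarrow> d j (\<pi> j) \<le> d u v" "d u v \<le> (\<Sum>j\<in>C. d j (\<pi> j))"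
  defines "s' \<equiv> ev I (PFor ''u'' NPoints (PFor ''v'' NPoints guess_prog)) s"
  shows "good (real (n * m) * ((2 + 11 / real m) * (\<Sum>j\<in>C. d j (\<pi> j)))) s'"
proof -
  let ?thr = "real (n * m) * ((2 + 11 / real m) * (\<Sum>j\<in>C. d j (\<pi> j)))"
  let ?q = "PFor ''v'' NPoints guess_prog"
  have same: "sound (nupdate y i z t) \<longleftrightarrow> sound t" "good ?thr (nupdate y i z t) \<longleftrightarrow> good ?thr t"
    if "y = ''u'' \<or> y = ''v''" for y i z t
    using that by (auto simp: sound_def good_def marked_def)
  let ?R = "\<lambda>i j t0 t. sound t \<and> (good ?thr t0 \<or> i = u \<and> v < j \<longrightarrow> good ?thr t)"
  have q: "?R i n t0 (ev I ?q t0)"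
    if t0: "static t0" "sound t0" "nmem t0 ''u'' 0 = i" "i < n" for i t0
  proof -
    have "?R i (nval I t0 NPoints) t0 (ev I ?q t0)"
    proof (rule ev_For_inv[where P = "\<lambda>j t. ?R i j t0 t"], goal_cases)
      case 2
      then show ?case using t0 same by simp
    next
      case (3 j t)
      have st: "static t" using t0(1) 3(4,5) by (simp add: static_def)
      have sndt: "sound t" using 3(2) by blast
      have ut: "nmem t ''u'' 0 = i" using 3(4) t0(3) by simp
      have uv: "nmem t ''u'' 0 < n" "nmem t ''v'' 0 < n" using ut t0(4) 3(1,3) by simp_all
      note gs = guess_spec[OF st sndt k1 uv refl]
      have "good ?thr (ev I guess_prog t)" if "good ?thr t0 \<or> i = u \<and> v < Suc j"
      proof (cases "good ?thr t")
        case True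
        then show ?thesis by (rule gs(1))
      next
        case False
        then have "i = u \<and> v = j" using that 3(2) by auto
        then have "nmem t ''u'' 0 = u" "nmem t ''v'' 0 = v" using ut 3(3) by simp_all
        then show ?thesis using gs(2)[of \<pi>] D(3-5) C0 ind by simp
      qed
      then show ?case using guess_sound[OF st sndt] same by simp
    qed simp_all
    then show ?thesis by simp
  qed
  let ?P = "\<lambda>i t. sound t \<and> (u < i \<longrightarrow> good ?thr t)"
  have "?P (nval I s NPoints) s'" unfolding s'_def
  proof (rule ev_For_inv[where P = ?P], goal_cases)
    case 2
    then show ?case using snd same by simp
  next
    case (3 i t)
    have st: "static t" using s 3(4,5) by (simp add: static_def)
    have sndt: "sound t" using 3(2) by blast
    have "i < n" using 3(1) by simp
    then have "?R i n t (ev I ?q t)" using q[OF st sndt 3(3)] by blast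
    then show ?case using 3(2) D(2) same by (auto simp: less_Suc_eq)
  qed simp_all
  then show ?thesis using D(1) by simp
qed

lemma guesses_sound:
  assumes s: "static s" and snd: "sound s"
  shows "sound (ev I (PFor ''u'' NPoints (PFor ''v'' NPoints guess_prog)) s)"
proof -
  have same: "sound (nupdate y i z t) \<longleftrightarrow> sound t" if "y = ''u'' \<or> y = ''v''" for y i z t
    using that by (auto simp: sound_def marked_def)
  have q: "sound (ev I (PFor ''v'' NPoints guess_prog) t0)" if t0: "static t0" "sound t0" for t0
  proof (rule ev_For_inv[where P = "\<lambda>j. sound"], goal_cases)
    case (3 j t)
    have "static t" using t0(1) 3(4,5) by (simp add: static_def)
    then show ?case using guess_sound 3(2) same by simp
  qed (use t0 same in simp_all)
  show ?thesis
  proof (rule ev_For_inv[where P = "\<lambda>j. sound"], goal_cases)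
    case (3 i t)
    have "static t" using s 3(4,5) by (simp add: static_def)
    then show ?case using q 3(2) same by simp
  qed (use snd same in simp_all)
qed

lemma mm_cost_empty:
  assumes "C \<noteq> {}"
  shows "mm_cost I {} = \<infinity>"
proof -
  have "connection_cost I j {} = \<infinity>" for j by (simp add: connection_cost_def top_ereal_def)
  moreover have "\<exists>j. j \<in> C" using assms by blast
  ultimately show ?thesis unfolding mm_cost_def using fin_C by (simp add: sum_Pinfty)
qed

text \<open>Settles rank zero: against an infinite optimum every independent output
  qualifies.\<close>

lemma no_solution_without_facilities:
  assumes "k = 0" "C \<noteq> {}"
  shows "mm_opt I = \<infinity>"
proof -
  obtain F where F: "independent I F" "mm_opt I = mm_cost I F" using mm_opt_attained by blast
  have "F = {}" using card_indep_le[OF F(1)] indep_finite[OF F(1)] assms(1) by simp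
  moreover have "mm_cost I {} = \<infinity>" by (rule mm_cost_empty[OF assms(2)])
  ultimately show ?thesis using F(2) by simp
qed

lemma main_spec:
  assumes s: "static s" and z: "\<And>x. nmem s ''out'' x = 0" "nmem s ''has'' 0 = 0"
  defines "s' \<equiv> ev I main_prog s"
  shows "independent I (marked I s' ''out'')"
    and "mm_cost I (marked I s' ''out'') \<le> ereal (2 + 11 / real m) * mm_opt I"
proof -
  let ?c = "PFor ''x'' NPoints (ifp (IsClient (nv ''x'')) (PN ''out'' (nv ''x'') (NConst 1)))"
  let ?z = "PFor ''x'' NPoints (PN ''out'' (nv ''x'') (NConst 0))"
  let ?g = "PFor ''u'' NPoints (PFor ''v'' NPoints guess_prog)"
  define a where "a = ev I ?c s"
  define b where "b = ev I ?z a"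
  have "\<forall>x. nmem a ''out'' x \<noteq> 0 \<longleftrightarrow> x < nval I s NPoints \<and> x \<in> C"
    unfolding a_def
    by (rule ev_For_inv[where P = "\<lambda>i t. \<forall>x. nmem t ''out'' x \<noteq> 0 \<longleftrightarrow> x < i \<and> x \<in> C"])
      (auto simp: z less_Suc_eq)
  then have ma: "marked I a ''out'' = C" using client_less by (auto simp: marked_def)
  have clr: "\<forall>x<nval I t NPoints. nmem (ev I ?z t) ''out'' x = 0" for t
    by (rule ev_For_inv[where P = "\<lambda>i t. \<forall>x<i. nmem t ''out'' x = 0"]) (auto simp: less_Suc_eq)
  have mb: "marked I b ''out'' = {}" using clr[of a] by (simp add: marked_def b_def)
  have hb: "nmem b ''has'' 0 = 0" using z by (simp add: a_def b_def nmem_ev)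
  have sa: "static a" unfolding a_def by (rule static_ev[OF s]) simp_all
  have sb: "static b" unfolding b_def by (rule static_ev[OF sa]) simp_all
  have sndb: "sound b" using mb hb indep_empty by (simp add: sound_def)
  have ev: "s' = (if independent I C then a else ev I ?g b)"
    using ma by (simp add: s'_def main_prog_def a_def[symmetric] b_def[symmetric])
  have \<rho>0: "0 < 2 + 11 / real m" by (simp add: add_pos_nonneg)
  have "independent I (marked I s' ''out'') \<and>
      mm_cost I (marked I s' ''out'') \<le> ereal (2 + 11 / real m) * mm_opt I"
  proof (cases "independent I C")
    case True
    have cost0: "mm_cost I C \<le> 0"
    proof (cases "C = {}")
      case True
      then show ?thesis by (simp add: mm_cost_def)
    next
      case False
      have "Min (d j ` C) \<le> 0" if "j \<in> C" for j
      proof -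
        have "Min (d j ` C) \<le> d j j" by (rule Min_le) (use fin_C that in auto)
        then show ?thesis using zero[of j j] client_less[OF that] by simp
      qed
      then show ?thesis using False fin_C by (simp add: mm_cost_eq sum_nonpos)
    qed
    have "0 \<le> mm_opt I"
    proof -
      obtain F where F: "independent I F" "mm_opt I = mm_cost I F" using mm_opt_attained by blast
      show ?thesis unfolding F(2) mm_cost_def connection_cost_def
        by (intro sum_nonneg INF_greatest) simp
    qed
    then have "0 \<le> ereal (2 + 11 / real m) * mm_opt I" using \<rho>0 by simp
    then show ?thesis using True cost0 ma unfolding ev by (simp add: order_trans)
  next
    case False
    have C0: "C \<noteq> {}" using False indep_empty by auto
    have s': "s' = ev I ?g b" using ev False by simp
    show ?thesis
    proof (cases "k = 0")
      case True
      have "sound s'" unfolding s' by (rule guesses_sound[OF sb sndb])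
      then show ?thesis using no_solution_without_facilities[OF True C0] \<rho>0 by (simp add: sound_def)
    next
      case k: False
      then have k1: "1 \<le> k" by simp
      have snd': "sound s'" unfolding s' by (rule guesses_sound[OF sb sndb])
      obtain F where F: "independent I F" "mm_opt I = mm_cost I F" using mm_opt_attained by blast
      show ?thesis
      proof (cases "mm_opt I = \<infinity>")
        case True
        then show ?thesis using snd' \<rho>0 by (simp add: sound_def)
      next
        case fin: False
        have Fne: "F \<noteq> {}"
        proof
          assume "F = {}"
          then have "mm_cost I F = \<infinity>" using mm_cost_empty[OF C0] by simp
          then show False using fin F(2) by simp
        qed
        have finF: "finite F" by (rule indep_finite[OF F(1)])
        have "\<forall>j. \<exists>f\<in>F. d j f = Min (d j ` F)"
        proof
          fix j
          have "Min (d j ` F) \<in> d j ` F" by (rule Min_in) (use Fne finF in auto)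
          then show "\<exists>f\<in>F. d j f = Min (d j ` F)" by auto
        qed
        then obtain \<pi> where \<pi>: "\<And>j. \<pi> j \<in> F" "\<And>j. d j (\<pi> j) = Min (d j ` F)" by metis
        define opt where "opt = (\<Sum>j\<in>C. d j (\<pi> j))"
        have opt: "mm_opt I = ereal opt"
          unfolding F(2) mm_cost_eq[OF Fne finF] opt_def \<pi>(2) ..
        have ind: "independent I (\<pi> ` C)" by (rule indep_hereditary[OF F(1)]) (use \<pi>(1) in auto)
        \<comment> \<open>The right guess is a client with the largest connection distance together
          with its facility.\<close>
        obtain u where u: "u \<in> C" "\<And>j. j \<in> C \<Longrightarrow> d j (\<pi> j) \<le> d u (\<pi> u)"
        proof -
          have "Max ((\<lambda>j. d j (\<pi> j)) ` C) \<in> (\<lambda>j. d j (\<pi> j)) ` C" by (rule Max_in) (use fin_C C0 in auto)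
          then obtain u where "u \<in> C" "Max ((\<lambda>j. d j (\<pi> j)) ` C) = d u (\<pi> u)" by auto
          moreover from this have "d j (\<pi> j) \<le> d u (\<pi> u)" if "j \<in> C" for j
            using Max_ge[of "(\<lambda>j. d j (\<pi> j)) ` C" "d j (\<pi> j)"] fin_C that by auto
          ultimately show ?thesis using that by blast
        qed
        have un: "u < n" "\<pi> u < n" using client_less[OF u(1)] indep_less[OF F(1) \<pi>(1)] by auto
        \<comment> \<open>If all connection distances were zero, every client would coincide with
          its facility. Then \<open>C\<close> would be a subset of the independent \<open>F\<close>,
          contrary to the present case.\<close>
        have D0: "0 < d u (\<pi> u)"
        proof (rule ccontr)
          assume "\<not> ?thesis"
          then have "d j (\<pi> j) = 0" if "j \<in> C" for j using u(2)[OF that] nonneg[of j "\<pi> j"] by linarith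
          then have "\<pi> j = j" if "j \<in> C" for j
            using zero[of j "\<pi> j"] that client_less[OF that] indep_less[OF F(1) \<pi>(1)[of j]] by simp
          then have "C \<subseteq> F" using \<pi>(1) by (metis subsetI)
          then show False using False indep_hereditary[OF F(1)] by blast
        qed
        have Dopt: "d u (\<pi> u) \<le> (\<Sum>j\<in>C. d j (\<pi> j))"
          by (rule member_le_sum[OF u(1)]) (use fin_C in auto)
        have "good (real (n * m) * ((2 + 11 / real m) * opt)) s'"
          unfolding s' opt_def by (rule guesses_spec[OF sb sndb k1 C0 ind un D0 u(2) Dopt])
        then have sc: "scost (marked I s' ''out'') \<le> real (n * m) * ((2 + 11 / real m) * opt)"
          and ne: "marked I s' ''out'' \<noteq> {}"
          using snd' by (auto simp: good_def sound_def)
        have fin': "finite (marked I s' ''out'')"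
          by (rule finite_subset[of _ "{..<n}"]) (auto simp: marked_def)
        have nm: "0 < real (n * m)" using un m9 by simp
        have "(\<Sum>j\<in>C. Min (d j ` marked I s' ''out'')) \<le> (2 + 11 / real m) * opt"
          using sc nm unfolding scost_eq[OF ne fin'] by (simp only: mult_le_cancel_left_pos)
        then show ?thesis using snd' by (simp add: sound_def opt mm_cost_eq[OF ne fin'])
      qed
    qed
  qed
  then show "independent I (marked I s' ''out'')"
    "mm_cost I (marked I s' ''out'') \<le> ereal (2 + 11 / real m) * mm_opt I" by blast+
qed

end

section \<open>Running time and the theorem\<close>

definition sizes_prog :: "nat \<Rightarrow> prog" where
  "sizes_prog m = mul_prog ''Q'' ''kk'' (NConst (m * (m + 1)));; mul_prog ''Z'' ''lg'' (nv ''Q'');;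
     mul_prog ''Y'' ''Z'' (nv ''Z'');; setn ''M'' (NAdd (nv ''kk'') (NAdd (nv ''kk'') (nv ''kk'')));;
     pow_prog;; setn ''m'' (NConst m);; dist_prog"

definition mm_prog :: "nat \<Rightarrow> prog" where
  "mm_prog m = rank_prog;; log_prog;; sizes_prog m;; main_prog"

lemma rank_spec:
  assumes inst: "mm_instance I" and z: "nmem s ''kk'' 0 = 0" "\<And>v. nmem s ''A'' v = 0"
  shows "nmem (ev I rank_prog s) ''kk'' 0 = mm_rank I"
proof -
  interpret matroid "facilities I" "independent I" using inst by (simp add: mm_instance_def)
  have less: "v < npoints I" if "independent I S" "v \<in> S" for S v
    using inst indep_subset_ground[OF that(1)] that(2) by (auto simp: mm_instance_def)
  let ?P = "\<lambda>i t. independent I (marked I t ''A'') \<and> (\<forall>v\<ge>i. nmem t ''A'' v = 0) \<and>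
      nmem t ''kk'' 0 = card (marked I t ''A'') \<and>
      (\<forall>v<i. v \<notin> marked I t ''A'' \<longrightarrow> \<not> independent I (insert v (marked I t ''A'')))"
  have "?P (nval I s NPoints) (ev I rank_prog s)" unfolding rank_prog_def
  proof (rule ev_For_inv[where P = ?P], goal_cases)
    case 2
    have "marked I s ''A'' = {}" using z by (simp add: marked_def)
    then show ?case using z indep_empty by (simp add: marked_def)
  next
    case (3 i t)
    let ?A = "marked I t ''A''"
    have iA: "i \<notin> ?A" using 3(2) by (simp add: marked_def)
    have fin: "finite ?A" by (simp add: marked_def)
    have m1: "marked I (nupdate ''A'' i 1 t) ''A'' = insert i ?A"
      using 3(1) by (auto simp: marked_def)
    show ?case
    proof (cases "independent I (insert i ?A)")
      case True
      let ?t' = "nupdate ''v'' 0 (Suc i) (nupdate ''kk'' 0 (nmem t ''kk'' 0 + 1) (nupdate ''A'' i 1 t))"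
      have mt: "marked I ?t' ''A'' = insert i ?A" using m1 by (simp add: marked_def)
      have "?P (Suc i) ?t'"
        unfolding mt
      proof (intro conjI allI impI)
        show "independent I (insert i ?A)" by (rule True)
        show "nmem ?t' ''A'' v = 0" if "Suc i \<le> v" for v using 3(2) that by simp
        show "nmem ?t' ''kk'' 0 = card (insert i ?A)" using 3(2) iA fin by simp
        \<comment> \<open>An element once rejected stays rejected as \<open>A\<close> grows, by
          heredity.\<close>
        show "\<not> independent I (insert v (insert i ?A))" if "v < Suc i" "v \<notin> insert i ?A" for v
        proof
          assume "independent I (insert v (insert i ?A))"
          then have "independent I (insert v ?A)" by (rule indep_hereditary) blast
          moreover have "v < i" "v \<notin> ?A" using that by auto
          ultimately show False using 3(2) by blast
        qed
      qed
      then show ?thesis using True m1 3(3) by simp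
    next
      case False
      have "nmem (nupdate ''A'' i 0 (nupdate ''A'' i 1 t)) ''A'' = nmem t ''A''"
        using 3(2) by (auto simp: fun_eq_iff)
      then show ?thesis using False m1 3(2,3) by (auto simp: marked_def less_Suc_eq)
    qed
  qed simp_all
  then have P: "?P (npoints I) (ev I rank_prog s)" by simp
  have "matroid_rank (independent I) = card (marked I (ev I rank_prog s) ''A'')"
  proof (rule rank_eq_card_maximal)
    show "independent I (marked I (ev I rank_prog s) ''A'')" using P by blast
    show "\<not> independent I (insert v (marked I (ev I rank_prog s) ''A''))"
      if "v \<notin> marked I (ev I rank_prog s) ''A''" for v
      using P that less[of _ v] by blast
  qed
  then show ?thesis using P by (simp add: mm_rank_def)
qed

lemma log_spec:
  defines "l \<equiv> \<lambda>I s. nmem (ev I log_prog s) ''lg'' 0"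
  shows "1 \<le> l I s" "npoints I \<le> 2 ^ (l I s - 1)" "2 ^ l I s \<le> 4 * max 1 (npoints I)"
proof -
  let ?q = "PFor ''v'' NPoints (ifp (NLess (nv ''pow'') NPoints)
         (setn ''pow'' (NAdd (nv ''pow'') (nv ''pow''));; incn ''lg'' (NConst 1)))"
  let ?a = "nupdate ''lg'' 0 1 (nupdate ''pow'' 0 1 s)"
  \<comment> \<open>While \<open>pow\<close> is below the number of points it doubles in every
    iteration and hence exceeds \<open>i\<close>; so it has caught up when the loop ends.\<close>
  let ?P = "\<lambda>i t. 1 \<le> nmem t ''lg'' 0 \<and> nmem t ''pow'' 0 = 2 ^ (nmem t ''lg'' 0 - 1) \<and>
    (npoints I \<le> nmem t ''pow'' 0 \<or> i < nmem t ''pow'' 0) \<and>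
    nmem t ''pow'' 0 \<le> 2 * max 1 (npoints I)"
  have "?P (nval I ?a NPoints) (ev I ?q ?a)"
  proof (rule ev_For_inv[where P = ?P], goal_cases)
    case (3 i t)
    obtain l where l: "nmem t ''lg'' 0 = Suc l" using 3(2) by (cases "nmem t ''lg'' 0") auto
    show ?case using 3(2) l by (auto simp: power_add)
  qed simp_all
  moreover have "ev I log_prog s = ev I ?q ?a" by (simp add: log_prog_def)
  ultimately have P: "1 \<le> l I s" "nmem (ev I log_prog s) ''pow'' 0 = 2 ^ (l I s - 1)"
    "npoints I \<le> nmem (ev I log_prog s) ''pow'' 0"
    "nmem (ev I log_prog s) ''pow'' 0 \<le> 2 * max 1 (npoints I)"
    by (auto simp: l_def)
  have "2 ^ l I s = 2 * (2::nat) ^ (l I s - 1)" using P(1) by (cases "l I s") auto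
  then show "1 \<le> l I s" "npoints I \<le> 2 ^ (l I s - 1)" "2 ^ l I s \<le> 4 * max 1 (npoints I)"
    using P by simp_all
qed

lemma mul_spec:
  assumes "z \<noteq> ''v''" "l \<noteq> z" "l \<noteq> ''v''"
    and "\<And>t. \<lbrakk>\<And>y. y \<notin> {z, ''v''} \<Longrightarrow> nmem t y = nmem s y\<rbrakk> \<Longrightarrow> nval I t e = b"
  shows "nmem (ev I (mul_prog z l e) s) z 0 = b * nmem s l 0"
proof -
  let ?q = "PFor ''v'' (nv l) (incn z e)"
  let ?a = "nupdate z 0 0 s"
  have "nmem (ev I ?q ?a) z 0 = b * nval I ?a (nv l)"
    by (rule ev_For_inv[where P = "\<lambda>i t. nmem t z 0 = b * i"]) (use assms in simp_all)
  then show ?thesis using assms by (simp add: mul_prog_def)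
qed

lemma nw_mul: "y \<notin> {z, ''v''} \<Longrightarrow> y \<notin> nw (mul_prog z l e)" "y \<notin> rw (mul_prog z l e)"
  by (simp_all add: mul_prog_def)

lemma pow_spec: "nmem (ev I pow_prog s) ''PW'' 0 = nmem s ''Y'' 0 ^ nmem s ''M'' 0"
proof -
  let ?q = "PFor ''u'' (nv ''M'') (mul_prog ''tmp'' ''Y'' (nv ''PW'');; setn ''PW'' (nv ''tmp''))"
  let ?a = "nupdate ''PW'' 0 1 s"
  have mul: "nmem (ev I (mul_prog ''tmp'' ''Y'' (nv ''PW'')) t) ''tmp'' 0 = nmem t ''PW'' 0 * nmem t ''Y'' 0" for t
    by (rule mul_spec) simp_all
  have "nmem (ev I ?q ?a) ''PW'' 0 = nmem s ''Y'' 0 ^ nval I ?a (nv ''M'')"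
    by (rule ev_For_inv[where P = "\<lambda>i t. nmem t ''PW'' 0 = nmem s ''Y'' 0 ^ i"])
      (simp_all add: mul nw_mul)
  then show ?thesis by (simp add: pow_prog_def)
qed

lemma nw_pow: "y \<notin> {''PW'', ''u'', ''tmp'', ''v''} \<Longrightarrow> y \<notin> nw pow_prog" "y \<notin> rw pow_prog"
  by (simp_all add: pow_prog_def nw_mul)

lemma dist_spec:
  assumes m: "nmem s ''m'' 0 = m" and off: "nmem s ''off'' 0 = 0"
  shows "x \<le> npoints I \<Longrightarrow> nmem (ev I dist_prog s) ''off'' x = x * npoints I"
    and "x < npoints I \<Longrightarrow> y < npoints I \<Longrightarrow>
      rmem (ev I dist_prog s) ''sd'' (x * npoints I + y) = real (npoints I * m) * metric I x y"
proof -
  let ?n = "npoints I"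
  let ?o = "PFor ''x'' NPoints (PN ''off'' (NAdd (nv ''x'') (NConst 1)) (NAdd (NCell ''off'' (nv ''x'')) NPoints))"
  let ?j = "PFor ''j'' (nv ''m'') (incr ''acc'' (RDist (nv ''x'') (nv ''y'')))"
  let ?y = "PFor ''y'' NPoints (setr ''acc'' (RConst 0);; PFor ''i'' NPoints ?j;;
       PR ''sd'' (NAdd (NCell ''off'' (nv ''x'')) (nv ''y'')) (rv ''acc''))"
  have o: "\<forall>x\<le>nval I s NPoints. nmem (ev I ?o s) ''off'' x = x * ?n"
    by (rule ev_For_inv[where P = "\<lambda>i t. \<forall>x\<le>i. nmem t ''off'' x = x * ?n"])
      (auto simp: off le_Suc_eq)
  have j: "rmem (ev I ?j t) ''acc'' 0 = rmem t ''acc'' 0 + real (nval I t (nv ''m'')) * metric I (nmem t ''x'' 0) (nmem t ''y'' 0)"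
    for t by (rule ev_repeat_incr) simp
  have i: "rmem (ev I (PFor ''i'' NPoints ?j) t) ''acc'' 0 =
      rmem t ''acc'' 0 + real (?n * m) * metric I (nmem t ''x'' 0) (nmem t ''y'' 0)"
    if "nmem t ''m'' 0 = m" for t
  proof -
    have "rmem (ev I (PFor ''i'' NPoints ?j) t) ''acc'' 0 = rmem t ''acc'' 0 +
        real (nval I t NPoints) * (real m * metric I (nmem t ''x'' 0) (nmem t ''y'' 0))"
      by (rule ev_For_inv[where P = "\<lambda>i u. rmem u ''acc'' 0 = rmem t ''acc'' 0 +
        real i * (real m * metric I (nmem t ''x'' 0) (nmem t ''y'' 0))"])
        (simp_all add: j that algebra_simps)
    then show ?thesis by (simp add: mult.assoc)
  qed
  let ?F = "\<lambda>x y. real (?n * m) * metric I x y"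
  have y: "(\<forall>y<nval I t NPoints. rmem (ev I ?y t) ''sd'' (x * ?n + y) = ?F x y) \<and>
      (\<forall>x' y. x' \<noteq> x \<longrightarrow> y < ?n \<longrightarrow> rmem (ev I ?y t) ''sd'' (x' * ?n + y) = rmem t ''sd'' (x' * ?n + y))"
    if t: "nmem t ''m'' 0 = m" "nmem t ''x'' 0 = x" "nmem t ''off'' x = x * ?n" for t x
  proof (rule ev_For_inv[where P = "\<lambda>i u. (\<forall>y<i. rmem u ''sd'' (x * ?n + y) = ?F x y) \<and>
      (\<forall>x' y. x' \<noteq> x \<longrightarrow> y < ?n \<longrightarrow> rmem u ''sd'' (x' * ?n + y) = rmem t ''sd'' (x' * ?n + y))"], goal_cases)
    case (3 l u)
    have ln: "l < ?n" using 3(1) by simp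
    define w where "w = ev I (PFor ''i'' NPoints ?j) (rupdate ''acc'' 0 0 u)"
    have "rmem w ''acc'' 0 = ?F x l"
      using i[of "rupdate ''acc'' 0 0 u"] 3(3,4) t by (simp add: w_def)
    moreover have "rmem w ''sd'' = rmem u ''sd''" "nmem w ''off'' x = x * ?n" "nmem w ''x'' 0 = x" "nmem w ''y'' 0 = l"
      using 3(3,4) t by (simp_all add: w_def nmem_ev rmem_ev)
    ultimately have "rmem (ev I (setr ''acc'' (RConst 0);; PFor ''i'' NPoints ?j;;
       PR ''sd'' (NAdd (NCell ''off'' (nv ''x'')) (nv ''y'')) (rv ''acc'')) u) ''sd'' =
        (rmem u ''sd'')(x * ?n + l := ?F x l)"
      by (simp add: w_def)
    then show ?case using 3(2) ln by (auto simp: less_Suc_eq index_inj)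
  qed simp_all
  define a where "a = ev I ?o s"
  have a: "nmem a ''m'' 0 = m" "\<And>x. x < ?n \<Longrightarrow> nmem a ''off'' x = x * ?n"
    using o m by (simp_all add: a_def nmem_ev)
  have "\<forall>x<nval I a NPoints. \<forall>y<?n. rmem (ev I (PFor ''x'' NPoints ?y) a) ''sd'' (x * ?n + y) = ?F x y"
  proof (rule ev_For_inv[where P = "\<lambda>i t. \<forall>x<i. \<forall>y<?n. rmem t ''sd'' (x * ?n + y) = ?F x y"], goal_cases)
    case (3 i t)
    have "nmem t ''m'' 0 = m" "nmem t ''off'' i = i * ?n" using 3(1,4) a by simp_all
    then show ?case using y[of t i] 3(2,3) by (auto simp: less_Suc_eq)
  qed simp_all
  moreover have ev: "ev I dist_prog s = ev I (PFor ''x'' NPoints ?y) a" by (simp add: dist_prog_def a_def)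
  ultimately show "x < ?n \<Longrightarrow> y < ?n \<Longrightarrow> rmem (ev I dist_prog s) ''sd'' (x * ?n + y) = ?F x y" by simp
  show "x \<le> ?n \<Longrightarrow> nmem (ev I dist_prog s) ''off'' x = x * ?n"
    unfolding ev using o by (simp add: a_def nmem_ev)
qed

lemma nw_rank: "y \<notin> {''A'', ''kk'', ''v''} \<Longrightarrow> y \<notin> nw rank_prog" "y \<notin> rw rank_prog"
  by (simp_all add: rank_prog_def)

lemma nw_log: "y \<notin> {''pow'', ''lg'', ''v''} \<Longrightarrow> y \<notin> nw log_prog" "y \<notin> rw log_prog"
  by (simp_all add: log_prog_def)

lemma nw_dist: "y \<notin> {''off'', ''x'', ''y'', ''i'', ''j''} \<Longrightarrow> y \<notin> nw dist_prog"
  "y \<notin> {''acc'', ''sd''} \<Longrightarrow> y \<notin> rw dist_prog"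
  by (simp_all add: dist_prog_def)

lemmas nw_prologue = nw_rank nw_log nw_mul nw_pow nw_dist

section \<open>Accounting of steps\<close>

text \<open>The common exponent 6 is the nesting depth of \<open>main_prog\<close>. It lets the
  costs of the phases be added, although each phase has its own loop limits, some computed by the
  phases before it.\<close>

definition timely :: "nat \<Rightarrow> mm_input \<Rightarrow> prog \<Rightarrow> state \<Rightarrow> bool" where
  "timely X I p s \<longleftrightarrow> (\<exists>t\<le>sz p * X ^ 6. exec I (compile p) s t (ev I p s))"

lemma timely_Seq: "timely X I p s \<Longrightarrow> timely X I q (ev I p s) \<Longrightarrow> timely X I (p;; q) s"
proof -
  assume "timely X I p s" "timely X I q (ev I p s)"
  then obtain t u where tu: "t \<le> sz p * X ^ 6" "exec I (compile p) s t (ev I p s)"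
    "u \<le> sz q * X ^ 6" "exec I (compile q) (ev I p s) u (ev I q (ev I p s))"
    unfolding timely_def by blast
  have "exec I (compile (p;; q)) s (t + u) (ev I (p;; q) s)" using exec.Seq[OF tu(2,4)] by simp
  moreover have "t + u \<le> sz (p;; q) * X ^ 6" using tu(1,3) by (simp add: add_mult_distrib)
  ultimately show ?thesis unfolding timely_def by blast
qed

lemma timelyI:
  assumes "1 \<le> X" "npoints I \<le> X" "limits_in L p" "L \<inter> nw p = {}" "\<forall>l\<in>L. nmem s l 0 \<le> X" "depth p \<le> 6"
  shows "timely X I p s"
proof -
  obtain t where t: "t \<le> sz p * X ^ depth p" "exec I (compile p) s t (ev I p s)"
    using exec_compile[OF assms(1-5)] by blast
  have "sz p * X ^ depth p \<le> sz p * X ^ 6"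
    using assms(1,6) by (intro mult_le_mono2 power_increasing)
  then show ?thesis unfolding timely_def using t order_trans by blast
qed

text \<open>With \<open>q = x div p\<close> one has \<open>x < p * (q + 1)\<close> and
  \<open>q + 1 \<le> 2 ^ q\<close>. For \<open>x = lg\<close> and \<open>p = 6 * k\<close> this
  turns a power of the logarithm into a function of \<open>k\<close> times the number of
  points.\<close>

lemma power_le_exp_nat: "x ^ p \<le> p ^ p * 2 ^ (x::nat)"
proof (cases "p = 0")
  case False
  let ?q = "x div p"
  have "x < p * (?q + 1)" using False by (simp add: dividend_less_times_div algebra_simps)
  then have "x ^ p \<le> (p * (?q + 1)) ^ p" by (intro power_mono) auto
  also have "\<dots> \<le> (p * 2 ^ ?q) ^ p"
  proof (intro power_mono mult_le_mono2)
    show "?q + 1 \<le> 2 ^ ?q" using less_exp[of ?q] by linarith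
  qed auto
  also have "\<dots> = p ^ p * 2 ^ (?q * p)" by (simp add: power_mult_distrib power_mult)
  also have "\<dots> \<le> p ^ p * 2 ^ x"
    by (intro mult_le_mono2 power_increasing) auto
  finally show ?thesis .
qed simp

text \<open>Multiplied by the square of the number of points, the summands dominate in turn 1, the
  number of points, \<open>lg\<close>, \<open>m\<close>, \<open>Q\<close>, \<open>Z\<close>,
  \<open>Y\<close>, \<open>M\<close>, \<open>k\<close> and the number \<open>Y ^ (3 * k)\<close> of
  words.\<close>

definition time_bound :: "nat \<Rightarrow> nat \<Rightarrow> nat" where
  "time_bound m k = (let Q = m * (m + 1) * k in
     1 + 1 + 4 + m + Q + 4 * Q + 16 * (Q * Q) + 3 * k + k + Q ^ (6 * k) * ((6 * k) ^ (6 * k) * 4))"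

lemma mm_prog_spec:
  assumes inst: "mm_instance I" and m: "9 \<le> m"
  defines "s \<equiv> ev I (mm_prog m) init_state"
  shows "independent I (marked I s ''out'')"
    and "mm_cost I (marked I s ''out'') \<le> ereal (2 + 11 / real m) * mm_opt I"
    and "\<exists>t\<le>sz (mm_prog m) * (time_bound m (mm_rank I) * (max 1 (npoints I))\<^sup>2) ^ 6.
      exec I (compile (mm_prog m)) init_state t s"
proof -
  let ?k = "mm_rank I"
  define s1 where "s1 = ev I rank_prog init_state"
  define s2 where "s2 = ev I log_prog s1"
  define lg where "lg = nmem s2 ''lg'' 0"
  have lg: "1 \<le> lg" "npoints I \<le> 2 ^ (lg - 1)" "2 ^ lg \<le> 4 * max 1 (npoints I)"
    using log_spec[of I s1] by (simp_all add: lg_def s2_def)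
  interpret mm_run I m lg using inst m lg by unfold_locales
  define s3 where "s3 = ev I (mul_prog ''Q'' ''kk'' (NConst (m * (m + 1)))) s2"
  define s4 where "s4 = ev I (mul_prog ''Z'' ''lg'' (nv ''Q'')) s3"
  define s5 where "s5 = ev I (mul_prog ''Y'' ''Z'' (nv ''Z'')) s4"
  define s6 where "s6 = ev I (setn ''M'' (NAdd (nv ''kk'') (NAdd (nv ''kk'') (nv ''kk'')))) s5"
  define s7 where "s7 = ev I pow_prog s6"
  define s8 where "s8 = ev I (setn ''m'' (NConst m)) s7"
  define s9 where "s9 = ev I dist_prog s8"
  have s: "s = ev I main_prog s9"
    by (simp add: s_def mm_prog_def sizes_prog_def s1_def s2_def s3_def s4_def s5_def s6_def s7_def s8_def s9_def)
  have k1: "nmem s1 ''kk'' 0 = ?k" unfolding s1_def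
    by (rule rank_spec[OF inst]) (simp_all add: init_state_def)
  have k2: "nmem s2 ''kk'' 0 = ?k" using k1 by (simp add: s2_def nmem_ev nw_prologue)
  have k3: "nmem s3 ''kk'' 0 = ?k" "nmem s3 ''lg'' 0 = lg"
    using k2 by (simp_all add: s3_def nmem_ev nw_prologue lg_def)
  have Q3: "nmem s3 ''Q'' 0 = Q" unfolding s3_def using k2 by (subst mul_spec[where b = "m * (m + 1)"]) (simp_all add: Q_def)
  have Z4: "nmem s4 ''Z'' 0 = Z" unfolding s4_def using k3 Q3 by (subst mul_spec[where b = Q]) (simp_all add: Z_def)
  have k4: "nmem s4 ''kk'' 0 = ?k" "nmem s4 ''Q'' 0 = Q"
    using k3 Q3 by (simp_all add: s4_def nmem_ev nw_prologue)
  have Y5: "nmem s5 ''Y'' 0 = Y" unfolding s5_def using Z4 by (subst mul_spec[where b = Z]) (simp_all add: Y_def)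
  have k5: "nmem s5 ''kk'' 0 = ?k" "nmem s5 ''Q'' 0 = Q" "nmem s5 ''Z'' 0 = Z"
    using k4 Z4 by (simp_all add: s5_def nmem_ev nw_prologue)
  have k6: "nmem s6 ''kk'' 0 = ?k" "nmem s6 ''Q'' 0 = Q" "nmem s6 ''Z'' 0 = Z" "nmem s6 ''Y'' 0 = Y" "nmem s6 ''M'' 0 = 3 * ?k"
    using k5 Y5 by (simp_all add: s6_def)
  have k7: "nmem s7 ''kk'' 0 = ?k" "nmem s7 ''Q'' 0 = Q" "nmem s7 ''Z'' 0 = Z" "nmem s7 ''Y'' 0 = Y"
    "nmem s7 ''M'' 0 = 3 * ?k" "nmem s7 ''PW'' 0 = Y ^ (3 * ?k)"
    using k6 by (simp_all add: s7_def nmem_ev nw_prologue pow_spec)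
  have k8: "nmem s8 ''kk'' 0 = ?k" "nmem s8 ''Q'' 0 = Q" "nmem s8 ''Z'' 0 = Z" "nmem s8 ''Y'' 0 = Y"
    "nmem s8 ''M'' 0 = 3 * ?k" "nmem s8 ''PW'' 0 = Y ^ (3 * ?k)" "nmem s8 ''m'' 0 = m"
    using k7 by (simp_all add: s8_def)
  have k9: "nmem s9 ''kk'' 0 = ?k" "nmem s9 ''Q'' 0 = Q" "nmem s9 ''Z'' 0 = Z" "nmem s9 ''Y'' 0 = Y"
    "nmem s9 ''M'' 0 = 3 * ?k" "nmem s9 ''PW'' 0 = Y ^ (3 * ?k)" "nmem s9 ''m'' 0 = m"
    using k8 by (simp_all add: s9_def nmem_ev nw_prologue)
  have off: "nmem s8 ''off'' 0 = 0"
    by (simp add: s1_def s2_def s3_def s4_def s5_def s6_def s7_def s8_def nmem_ev nw_prologue init_state_def)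
  have static9: "static s9"
    unfolding static_def sd_def using k9 dist_spec[OF k8(7) off] by (simp add: s9_def)
  have z: "nmem s9 ''out'' = nmem init_state ''out''" "nmem s9 ''has'' = nmem init_state ''has''"
    by (simp_all add: s1_def s2_def s3_def s4_def s5_def s6_def s7_def s8_def s9_def nmem_ev nw_prologue)
  show "independent I (marked I s ''out'')"
    "mm_cost I (marked I s ''out'') \<le> ereal (2 + 11 / real m) * mm_opt I"
    unfolding s using main_spec[OF static9] z by (simp_all add: init_state_def)
  define n' where "n' = max 1 n"
  define X where "X = time_bound m ?k * n'\<^sup>2"
  have n': "1 \<le> n'" "n \<le> n'" by (auto simp: n'_def)
  then have n'_sq: "n' \<le> n'\<^sup>2" by (simp add: power2_eq_square)
  have lgn: "lg \<le> 4 * n'" unfolding n'_def using less_exp[of lg] lg(3) by linarith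
  let ?E = "Q ^ (6 * ?k) * ((6 * ?k) ^ (6 * ?k) * 4)"
  have X: "X = n'\<^sup>2 + n'\<^sup>2 + 4 * n'\<^sup>2 + m * n'\<^sup>2 + Q * n'\<^sup>2 + 4 * Q * n'\<^sup>2 + 16 * (Q * Q) * n'\<^sup>2 + 3 * ?k * n'\<^sup>2 +
      ?k * n'\<^sup>2 + ?E * n'\<^sup>2"
    by (simp only: X_def time_bound_def Let_def Q_def[symmetric] add_mult_distrib mult_1)
  have n2: "1 \<le> n'\<^sup>2" using n' n'_sq by linarith
  have small: "a \<le> a * n'\<^sup>2" for a using n2 by simp
  have le: "1 \<le> X" "n \<le> X" "m \<le> X" "?k \<le> X" "3 * ?k \<le> X" "Q \<le> X"
    using n' n'_sq n2 small[of m] small[of ?k] small[of "3 * ?k"] small[of Q] unfolding X by linarith+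
  have lgX: "lg \<le> X"
  proof -
    have "lg \<le> 4 * n'\<^sup>2" using lgn n'_sq by linarith
    then show ?thesis unfolding X by linarith
  qed
  have ZX: "Z \<le> X"
  proof -
    have "Z \<le> Q * (4 * n')" unfolding Z_def by (rule mult_le_mono2[OF lgn])
    also have "\<dots> = 4 * Q * n'" by simp
    also have "\<dots> \<le> 4 * Q * n'\<^sup>2" by (rule mult_le_mono2[OF n'_sq])
    finally show ?thesis unfolding X by linarith
  qed
  have YX: "Y \<le> X"
  proof -
    have "Y = Q * Q * (lg * lg)" by (simp add: Y_def Z_def)
    also have "\<dots> \<le> Q * Q * ((4 * n') * (4 * n'))" by (intro mult_le_mono2 mult_le_mono lgn)
    also have "\<dots> = 16 * (Q * Q) * n'\<^sup>2" by (simp add: power2_eq_square)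
    finally show ?thesis unfolding X by linarith
  qed
  have PX: "Y ^ (3 * ?k) \<le> X"
  proof -
    have "Y = (Q * lg)\<^sup>2" by (simp add: Y_def Z_def power2_eq_square)
    then have "Y ^ (3 * ?k) = (Q * lg) ^ (6 * ?k)" by (simp flip: power_mult)
    also have "\<dots> = Q ^ (6 * ?k) * lg ^ (6 * ?k)" by (rule power_mult_distrib)
    also have "\<dots> \<le> Q ^ (6 * ?k) * ((6 * ?k) ^ (6 * ?k) * 2 ^ lg)"
      by (rule mult_le_mono2[OF power_le_exp_nat])
    also have "\<dots> \<le> Q ^ (6 * ?k) * ((6 * ?k) ^ (6 * ?k) * (4 * n'))"
      using lg(3) by (intro mult_le_mono2) (simp add: n'_def)
    also have "\<dots> = ?E * n'" by simp
    also have "\<dots> \<le> ?E * n'\<^sup>2" by (rule mult_le_mono2[OF n'_sq])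
    finally show ?thesis unfolding X by linarith
  qed
  note tI = timelyI[OF le(1,2)]
  have t1: "timely X I rank_prog init_state"
    by (rule tI[where L = "{}"]) (simp_all add: rank_prog_def)
  have t2: "timely X I log_prog s1"
    by (rule tI[where L = "{}"]) (simp_all add: log_prog_def)
  have t3: "timely X I (mul_prog ''Q'' ''kk'' (NConst (m * (m + 1)))) s2"
    by (rule tI[where L = "{''kk''}"]) (use k2 le in \<open>simp_all add: mul_prog_def\<close>)
  have t4: "timely X I (mul_prog ''Z'' ''lg'' (nv ''Q'')) s3"
    by (rule tI[where L = "{''lg''}"]) (use k3 lgX in \<open>simp_all add: mul_prog_def\<close>)
  have t5: "timely X I (mul_prog ''Y'' ''Z'' (nv ''Z'')) s4"
    by (rule tI[where L = "{''Z''}"]) (use Z4 ZX in \<open>simp_all add: mul_prog_def\<close>)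
  have t6: "timely X I (setn ''M'' (NAdd (nv ''kk'') (NAdd (nv ''kk'') (nv ''kk'')))) s5"
    by (rule tI[where L = "{}"]) simp_all
  have t7: "timely X I pow_prog s6"
    by (rule tI[where L = "{''M'', ''Y''}"]) (use k6 le YX in \<open>simp_all add: pow_prog_def mul_prog_def\<close>)
  have t8: "timely X I (setn ''m'' (NConst m)) s7"
    by (rule tI[where L = "{}"]) simp_all
  have t9: "timely X I dist_prog s8"
    by (rule tI[where L = "{''m''}"]) (use k8 le in \<open>simp_all add: dist_prog_def\<close>)
  have t10: "timely X I main_prog s9"
    by (rule tI[OF limits_main nw_main]) (use k9 le ZX YX PX in simp_all)
  have "timely X I (sizes_prog m) s2"
    unfolding sizes_prog_def
    by (intro timely_Seq) (simp_all only: t3 t4 t5 t6 t7 t8 t9 s3_def[symmetric] s4_def[symmetric]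
      s5_def[symmetric] s6_def[symmetric] s7_def[symmetric] s8_def[symmetric])
  moreover have "ev I (sizes_prog m) s2 = s9"
    by (simp add: sizes_prog_def s3_def s4_def s5_def s6_def s7_def s8_def s9_def)
  ultimately have "timely X I (sizes_prog m;; main_prog) s2"
    using t10 by (intro timely_Seq) simp_all
  then have "timely X I (mm_prog m) init_state"
    unfolding mm_prog_def s2_def
    using timely_Seq[OF t1, folded s1_def, OF timely_Seq[OF t2]] by blast
  then show "\<exists>t\<le>sz (mm_prog m) * (time_bound m ?k * (max 1 n)\<^sup>2) ^ 6.
      exec I (compile (mm_prog m)) init_state t s"
    by (simp only: timely_def X_def n'_def s_def)
qed

theorem theorem3:
  shows "\<exists>(f :: nat \<Rightarrow> real \<Rightarrow> real) (c :: nat). \<forall>\<epsilon>>0. \<exists>A.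
           mm_approx_algorithm (2 + \<epsilon>) A \<and>
           mm_runs_in_time A (\<lambda>I. f (mm_rank I) \<epsilon> * real (max 1 (npoints I)) ^ c)"
proof -
  \<comment> \<open>The ceiling makes \<open>11 / m\<close> at most \<open>\<epsilon>\<close>, and
    the summand 9 provides the lower bound on \<open>m\<close>. The exponent 12 below is the loop
    depth 6 times the exponent 2 of the number of points in the bound on the loop limits.\<close>
  define M where "M \<epsilon> = nat \<lceil>11 / \<epsilon>\<rceil> + 9" for \<epsilon> :: real
  define f where "f k \<epsilon> = real (sz (mm_prog (M \<epsilon>)) * time_bound (M \<epsilon>) k ^ 6)" for k and \<epsilon> :: real
  have "mm_approx_algorithm (2 + \<epsilon>) (compile (mm_prog (M \<epsilon>))) \<and>
      mm_runs_in_time (compile (mm_prog (M \<epsilon>))) (\<lambda>I. f (mm_rank I) \<epsilon> * real (max 1 (npoints I)) ^ 12)"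
    if "0 < \<epsilon>" for \<epsilon>
  proof
    have M9: "9 \<le> M \<epsilon>" by (simp add: M_def)
    have "11 / \<epsilon> \<le> real (M \<epsilon>)" unfolding M_def by linarith
    then have "11 / real (M \<epsilon>) \<le> \<epsilon>" using that M9 by (simp add: field_simps)
    then have \<rho>: "ereal (2 + 11 / real (M \<epsilon>)) \<le> ereal (2 + \<epsilon>)" by simp
    show "mm_approx_algorithm (2 + \<epsilon>) (compile (mm_prog (M \<epsilon>)))"
      unfolding mm_approx_algorithm_def
    proof (intro allI impI)
      fix I assume inst: "mm_instance I"
      let ?s = "ev I (mm_prog (M \<epsilon>)) init_state"
      note sp = mm_prog_spec[OF inst M9]
      have "0 \<le> mm_opt I"
        unfolding mm_opt_def mm_cost_def connection_cost_def
      proof (intro INF_greatest sum_nonneg)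
        fix F j f
        have "Metric_space {..<npoints I} (metric I)" using inst by (simp add: mm_instance_def)
        then show "0 \<le> ereal (metric I j f)" using Metric_space.nonneg by simp
      qed
      then have "mm_cost I (marked I ?s ''out'') \<le> ereal (2 + \<epsilon>) * mm_opt I"
        using order_trans[OF sp(2) ereal_mult_right_mono[OF \<rho>]] by simp
      then show "\<exists>t s. exec I (compile (mm_prog (M \<epsilon>))) init_state t s \<and>
          independent I (marked I s ''out'') \<and> mm_cost I (marked I s ''out'') \<le> ereal (2 + \<epsilon>) * mm_opt I"
        using sp(1,3) by blast
    qed
    show "mm_runs_in_time (compile (mm_prog (M \<epsilon>))) (\<lambda>I. f (mm_rank I) \<epsilon> * real (max 1 (npoints I)) ^ 12)"
      unfolding mm_runs_in_time_def
    proof (intro allI impI)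
      fix I assume inst: "mm_instance I"
      obtain t where t: "t \<le> sz (mm_prog (M \<epsilon>)) * (time_bound (M \<epsilon>) (mm_rank I) * (max 1 (npoints I))\<^sup>2) ^ 6"
        "exec I (compile (mm_prog (M \<epsilon>))) init_state t (ev I (mm_prog (M \<epsilon>)) init_state)"
        using mm_prog_spec(3)[OF inst M9] by blast
      have "sz (mm_prog (M \<epsilon>)) * (time_bound (M \<epsilon>) (mm_rank I) * (max 1 (npoints I))\<^sup>2) ^ 6
          = sz (mm_prog (M \<epsilon>)) * time_bound (M \<epsilon>) (mm_rank I) ^ 6 * (max 1 (npoints I)) ^ 12"
        by (simp add: power_mult_distrib flip: power_mult)
      then have "real t \<le> real (sz (mm_prog (M \<epsilon>)) * time_bound (M \<epsilon>) (mm_rank I) ^ 6 * (max 1 (npoints I)) ^ 12)"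
        using t(1) by (simp only: of_nat_le_iff)
      then have "real t \<le> f (mm_rank I) \<epsilon> * real (max 1 (npoints I)) ^ 12"
        by (simp only: f_def of_nat_mult of_nat_power)
      then show "\<exists>t s. exec I (compile (mm_prog (M \<epsilon>))) init_state t s \<and>
          real t \<le> f (mm_rank I) \<epsilon> * real (max 1 (npoints I)) ^ 12"
        using t(2) by blast
    qed
  qed
  then show ?thesis by blast
qed

end
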